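(* Assume in addition to the standing assumptions that $\omega_{ij}^k=-\omega_{ik}^j$ for all $1\le i,j,k\le n$. Then for every $C^\infty$ function $f:\mathbb{R}^n\to\mathbb{R}$ bounded together with all its derivatives, every $t\in[0,1]$ and every $x\in\mathbb{R}^n$, $$\sqrt{\Gamma(P_tf)(x)}\le P_t\big(\sqrt{\Gamma(f)}\big)(x),$$ where $\Gamma(g)=\sum_{i=1}^n(V_ig)^2$ for smooth $g:\mathbb{R}^n\to\mathbb{R}$.
   Context: Setting. Fix $H\in(1/2,1)$ and $n\ge 1$. Let $B=(B^1,\dots,B^n)$ be an $n$-dimensional fractional Brownian motion on $[0,1]$ with Hurst parameter $H$: $B^1,\dots,B^n$ are independent continuous centered Gaussian processes with covariance $R(t,s)=\frac12(s^{2H}+t^{2H}-|t-s|^{2H})$. Integrals against $B$ are pathwise Young (Riemann–Stieltjes) integrals. Standing assumptions on the vector fields: $V_1,\dots,V_n$ are bounded smooth vector fields on $\mathbb{R}^n$ with bounded derivatives of every order; for each $x$, $(V_1(x),\dots,V_n(x))$ is a basis of $\mathbb{R}^n$; and the functions $\omega_{ij}^k$ determined by $[V_i,V_j]=\sum_k\omega_{ij}^kV_k$ are bounded smooth functions with bounded derivatives of every order. Vector fields act on functions as derivations: $V_if=\langle\nabla f,V_i\rangle$. For $x\in\mathbb{R}^n$, $(X^x_t)_{t\in[0,1]}$ is the unique solution of $X_t^x=x+\sum_{i=1}^n\int_0^tV_i(X^x_s)\,dB^i_s$, and $P_tf(x)=\mathbb{E}(f(X_t^x))$. *)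

theory Defs
  imports "HOL-Probability.Probability"
begin

section \<open>Smooth functions and vector fields\<close>

primrec iterated_partial ::
    "'n list \<Rightarrow> (real ^ 'n::finite \<Rightarrow> 'b::real_normed_vector) \<Rightarrow> real ^ 'n \<Rightarrow> 'b" where
  "iterated_partial [] f = f"
| "iterated_partial (i # is) f =
     (\<lambda>x. frechet_derivative (iterated_partial is f) (at x) (axis i 1))"

text \<open>The class of smooth functions that are bounded together with all their partial
  derivatives.  Requiring every iterated partial derivative to be (Frechet) differentiable
  everywhere makes all of them continuous, so the first condition is exactly smoothness.\<close>

definition smooth_bounded :: "(real ^ 'n::finite \<Rightarrow> 'b::real_normed_vector) \<Rightarrow> bool" where
  "smooth_bounded f \<longleftrightarrow>
     (\<forall>is x. iterated_partial is f differentiable (at x)) \<and>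
     (\<forall>is. bounded (range (iterated_partial is f)))"

definition lie_derivative ::
    "(real ^ 'n::finite \<Rightarrow> real ^ 'n) \<Rightarrow> (real ^ 'n \<Rightarrow> real) \<Rightarrow> real ^ 'n \<Rightarrow> real" where
  "lie_derivative V f x = frechet_derivative f (at x) (V x)"

text \<open>The sign is the one for which the bracket is the commutator of derivations,
  i.e. \<open>[V, W] f = V (W f) - W (V f)\<close>.\<close>

definition lie_bracket ::
    "(real ^ 'n::finite \<Rightarrow> real ^ 'n) \<Rightarrow> (real ^ 'n \<Rightarrow> real ^ 'n) \<Rightarrow> real ^ 'n \<Rightarrow> real ^ 'n" where
  "lie_bracket V W x = frechet_derivative W (at x) (V x) - frechet_derivative V (at x) (W x)"

definition is_basis :: "('n::finite \<Rightarrow> real ^ 'n) \<Rightarrow> bool" where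
  "is_basis v \<longleftrightarrow> inj v \<and> independent (range v) \<and> span (range v) = UNIV"

definition carre_du_champ ::
    "('n::finite \<Rightarrow> real ^ 'n \<Rightarrow> real ^ 'n) \<Rightarrow> (real ^ 'n \<Rightarrow> real) \<Rightarrow> real ^ 'n \<Rightarrow> real" where
  "carre_du_champ V g x = (\<Sum>i\<in>UNIV. (lie_derivative (V i) g x)\<^sup>2)"


section \<open>Young integrals and differential equations\<close>

text \<open>Limit of Riemann-Stieltjes sums as the mesh tends to zero: the gauge is constant, in
  contrast to the variable gauges of the Henstock-Kurzweil integral.\<close>

definition has_riemann_stieltjes_integral ::
    "(real \<Rightarrow> 'b::real_normed_vector) \<Rightarrow> (real \<Rightarrow> real) \<Rightarrow> real \<Rightarrow> real \<Rightarrow> 'b \<Rightarrow> bool" where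
  "has_riemann_stieltjes_integral f g a b I \<longleftrightarrow>
     (\<forall>e>0. \<exists>d>0. \<forall>p. p tagged_division_of {a..b} \<and> (\<lambda>s. ball s d) fine p \<longrightarrow>
        norm ((\<Sum>(s, K)\<in>p. (g (Sup K) - g (Inf K)) *\<^sub>R f s) - I) < e)"

definition holder_on :: "real \<Rightarrow> real set \<Rightarrow> (real \<Rightarrow> 'b::real_normed_vector) \<Rightarrow> bool" where
  "holder_on \<alpha> S f \<longleftrightarrow> (\<exists>C. \<forall>s\<in>S. \<forall>t\<in>S. norm (f s - f t) \<le> C * \<bar>s - t\<bar> powr \<alpha>)"

text \<open>Young's condition on the Hoelder exponents is part of the notion.  It selects the class of
  paths in which the differential equation below is well posed; for a driving fractional Brownian
  path, the solutions are then the ones that are Hoelder continuous of every order below \<open>H\<close>.\<close>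

definition has_young_integral ::
    "(real \<Rightarrow> 'b::real_normed_vector) \<Rightarrow> (real \<Rightarrow> real) \<Rightarrow> real \<Rightarrow> real \<Rightarrow> 'b \<Rightarrow> bool" where
  "has_young_integral f g a b I \<longleftrightarrow>
     (\<exists>\<alpha>>0. \<exists>\<beta>>0. \<alpha> + \<beta> > 1 \<and> holder_on \<alpha> {a..b} f \<and> holder_on \<beta> {a..b} g) \<and>
     has_riemann_stieltjes_integral f g a b I"

definition solves_young_equation ::
    "('n::finite \<Rightarrow> real ^ 'n \<Rightarrow> real ^ 'n) \<Rightarrow> ('n \<Rightarrow> real \<Rightarrow> real) \<Rightarrow> real ^ 'n \<Rightarrow>
     (real \<Rightarrow> real ^ 'n) \<Rightarrow> bool" where
  "solves_young_equation V g x y \<longleftrightarrow>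
     (\<forall>t\<in>{0..1}. \<exists>I. (\<forall>i. has_young_integral (\<lambda>s. V i (y s)) (g i) 0 t (I i)) \<and>
        y t = x + (\<Sum>i\<in>UNIV. I i))"


section \<open>Fractional Brownian motion\<close>

text \<open>A Gaussian variable may be degenerate, i.e. almost surely constant.\<close>

definition gaussian_rv :: "'w measure \<Rightarrow> ('w \<Rightarrow> real) \<Rightarrow> bool" where
  "gaussian_rv M Y \<longleftrightarrow> Y \<in> borel_measurable M \<and>
     (\<exists>\<mu>. (AE w in M. Y w = \<mu>) \<or> (\<exists>\<sigma>>0. distributed M lborel Y (normal_density \<mu> \<sigma>)))"

definition gaussian_process :: "'w measure \<Rightarrow> real set \<Rightarrow> (real \<Rightarrow> 'w \<Rightarrow> real) \<Rightarrow> bool" where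
  "gaussian_process M T Y \<longleftrightarrow>
     (\<forall>F c. finite F \<and> F \<subseteq> T \<longrightarrow> gaussian_rv M (\<lambda>w. \<Sum>t\<in>F. c t * Y t w))"

definition fbm_covariance :: "real \<Rightarrow> real \<Rightarrow> real \<Rightarrow> real" where
  "fbm_covariance H t s = (s powr (2 * H) + t powr (2 * H) - \<bar>t - s\<bar> powr (2 * H)) / 2"

text \<open>An \<open>'n\<close>-dimensional fractional Brownian motion on the time interval \<open>[0, 1]\<close>.
  Independence of the components is independence of whole processes, viewed as random elements
  of the product space over \<open>[0, 1]\<close>.  The expectation of the product is the covariance because
  the components are centered.\<close>

definition fractional_brownian_motion ::
    "'w measure \<Rightarrow> real \<Rightarrow> ('n::finite \<Rightarrow> real \<Rightarrow> 'w \<Rightarrow> real) \<Rightarrow> bool" where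
  "fractional_brownian_motion M H B \<longleftrightarrow>
     prob_space M \<and>
     prob_space.indep_vars M (\<lambda>i. PiM {0..1::real} (\<lambda>t. borel))
       (\<lambda>i w. \<lambda>t\<in>{0..1}. B i t w) UNIV \<and>
     (\<forall>i. gaussian_process M {0..1} (B i) \<and>
       (\<forall>t\<in>{0..1}. prob_space.expectation M (B i t) = 0) \<and>
       (\<forall>t\<in>{0..1}. \<forall>s\<in>{0..1}.
          prob_space.expectation M (\<lambda>w. B i t w * B i s w) = fbm_covariance H t s) \<and>
       (\<forall>w\<in>space M. continuous_on {0..1} (\<lambda>t. B i t w)))"

definition transition_operator ::
    "'w measure \<Rightarrow> (real ^ 'n::finite \<Rightarrow> real \<Rightarrow> 'w \<Rightarrow> real ^ 'n) \<Rightarrow> real \<Rightarrow>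
     (real ^ 'n \<Rightarrow> real) \<Rightarrow> real ^ 'n \<Rightarrow> real" where
  "transition_operator M X t f x = prob_space.expectation M (\<lambda>w. f (X x t w))"

end

theory Submission
  imports Defs
begin

text \<open>
  Everything is first done for a fixed driving path of Hoelder regularity above \<open>1 / 2\<close>, which by
  Kolmogorov's criterion is the case for almost every path of \<open>B\<close>. Solutions are
  the paths with \<open>y t - y s = (\<Sum>i. (g i t - g i s) V i (y s)) + O(|t - s| powr 2\<beta>)\<close>; since
  \<open>2\<beta> > 1\<close>, sewing makes such expansions determine the path, with stability estimates that are linear
  in the data. They give the derivative \<open>J t\<close> of the flow in the initial value as a limit of
  difference quotients, with a quadratic remainder.

  The skew symmetry of \<open>\<omega>\<close> says that the \<open>V i\<close> are Killing fields for the metric in which they are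
  orthonormal. Accordingly \<open>J t C(x) (J t)\<^sup>T\<close> and \<open>C(X t)\<close>, where \<open>C = (\<Sum>k. V k (V k)\<^sup>T)\<close> is the
  cometric, solve the same linear equation and coincide. Hence the vector with components
  \<open>\<nabla>f(X t) \<bullet> J t (V i x)\<close> has length \<open>sqrt (\<Gamma> f (X t))\<close>, and the flow is Lipschitz near \<open>x\<close> with a
  deterministic constant. The latter allows differentiation under the expectation, and the inequality
  is then \<open>|E Y| \<le> E |Y|\<close> for this vector \<open>Y\<close>.
\<close>

section \<open>Sewing and linear growth\<close>

text \<open>The solutions are given one starting point at a time, each with its own null set, and no
  common event for all starting points is provided. Every pathwise statement is therefore arranged
  to involve countably many starting points only: difference quotients with steps
  \<open>1 / Suc m\<close> along the axes, sequences tending to \<open>x\<close>, subdivisions of a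
  segment. In the same spirit the linear equation for the derivative is never solved; its solution
  arises as a limit of differences of the given paths.

  The pathwise constants contain the random Hoelder constant \<open>G\<close> through factors
  \<open>(3 / 2) ^ N\<close>, even nested, since \<open>growth_rate\<close> contains
  \<open>holder_bound\<close>. No moments of them are estimated: they enter only where a limit is
  taken along one fixed path, while the dominating function is built from the constant that the
  Killing property provides.

  A product of two increments is of order \<open>2 * \<beta>\<close> and so belongs to the error of
  the expansion. Hence the Leibniz and chain rules hold without second-order terms, and the argument
  for the cometric runs path by path as for smooth drivers.\<close>

lemma contraction_bound:
  fixes f w :: "'a \<Rightarrow> real"
  assumes fin: "\<And>p. p \<in> S \<Longrightarrow> f p \<le> C0 * w p"
    and w: "\<And>p. p \<in> S \<Longrightarrow> 0 \<le> w p"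
    and \<theta>: "0 \<le> \<theta>" "\<theta> < 1" and a: "0 \<le> a"
    and step: "\<And>C p. 0 \<le> C \<Longrightarrow> (\<And>q. q \<in> S \<Longrightarrow> f q \<le> C * w q) \<Longrightarrow> p \<in> S \<Longrightarrow>
      f p \<le> (\<theta> * C + a) * w p"
    and p: "p \<in> S"
  shows "f p \<le> a / (1 - \<theta>) * w p"
proof -
  \<comment> \<open>Iterating \<open>C \<mapsto> \<theta> * C + a\<close> from
    \<open>max C0 0\<close> stays below its fixed point \<open>a / (1 - \<theta>)\<close> plus a
    multiple of \<open>\<theta> ^ k\<close>. The maximum is taken because \<open>step\<close>
    accepts only nonnegative constants.\<close>
  have *: "\<forall>q\<in>S. f q \<le> (a / (1 - \<theta>) + \<theta> ^ k * max C0 0) * w q" for k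
  proof (induction k)
    case 0
    show ?case
    proof
      fix q assume q: "q \<in> S"
      have "f q \<le> C0 * w q" using fin q .
      also have "\<dots> \<le> (a / (1 - \<theta>) + \<theta> ^ 0 * max C0 0) * w q"
        using a \<theta> by (intro mult_right_mono w q) (auto simp: max_def add_increasing)
      finally show "f q \<le> (a / (1 - \<theta>) + \<theta> ^ 0 * max C0 0) * w q" .
    qed
  next
    case (Suc k)
    have eq: "\<theta> * (a / (1 - \<theta>) + \<theta> ^ k * max C0 0) + a = a / (1 - \<theta>) + \<theta> ^ Suc k * max C0 0"
      using \<theta> by (simp add: field_simps)
    have "0 \<le> a / (1 - \<theta>) + \<theta> ^ k * max C0 0"
      using a \<theta> by (intro add_nonneg_nonneg mult_nonneg_nonneg) auto
    then show ?case
      using step[of "a / (1 - \<theta>) + \<theta> ^ k * max C0 0"] Suc.IH unfolding eq by blast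
  qed
  have "(\<lambda>k. (a / (1 - \<theta>) + \<theta> ^ k * max C0 0) * w p) \<longlonglongrightarrow> (a / (1 - \<theta>) + 0 * max C0 0) * w p"
    using \<theta> by (intro tendsto_intros LIMSEQ_realpow_zero) auto
  from LIMSEQ_le_const[OF this] show ?thesis using * p by auto
qed

lemma norm_add_diff_le:
  fixes a b c :: "'e::real_normed_vector"
  shows "norm (a + b - c) \<le> norm a + norm b + norm c"
  using norm_triangle_ineq4[of "a + b" c] norm_triangle_ineq[of a b] by linarith

text \<open>The effect of one bisection on an error of order \<open>\<gamma>\<close>: the factor
  \<open>2 powr (1 - \<gamma>)\<close> is below 1 exactly when \<open>\<gamma> > 1\<close>, which is
  what makes sewing a contraction.\<close>

lemma powr_half_twice:
  fixes x :: real
  assumes "0 \<le> x"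
  shows "(x / 2) powr \<gamma> + (x / 2) powr \<gamma> = 2 powr (1 - \<gamma>) * x powr \<gamma>"
  using assms by (simp add: powr_divide powr_diff)

lemma two_powr_less_1: "1 < \<gamma> \<Longrightarrow> 2 powr (1 - \<gamma>) < (1::real)"
  using powr_less_mono[of "1 - \<gamma>" 0 2] by simp

text \<open>The error of the approximation improves on bisection, so an arbitrary a priori constant
  can be replaced by the one that the defect of additivity of \<open>\<Xi>\<close> dictates.\<close>

lemma sewing:
  fixes z :: "real \<Rightarrow> 'e::real_normed_vector" and \<Xi> :: "real \<Rightarrow> real \<Rightarrow> 'e"
  assumes \<gamma>: "1 < \<gamma>" and M: "0 \<le> M"
    and rough: "\<And>s t. a \<le> s \<Longrightarrow> s \<le> t \<Longrightarrow> t \<le> b \<Longrightarrow>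
      norm (z t - z s - \<Xi> s t) \<le> C * (t - s) powr \<gamma>"
    and defect: "\<And>s u t. a \<le> s \<Longrightarrow> s \<le> u \<Longrightarrow> u \<le> t \<Longrightarrow> t \<le> b \<Longrightarrow>
      norm (\<Xi> s t - \<Xi> s u - \<Xi> u t) \<le> M * (t - s) powr \<gamma>"
    and st: "a \<le> s" "s \<le> t" "t \<le> b"
  shows "norm (z t - z s - \<Xi> s t) \<le> M / (1 - 2 powr (1 - \<gamma>)) * (t - s) powr \<gamma>"
proof -
  define S where "S = {(s, t). a \<le> s \<and> s \<le> t \<and> t \<le> b}"
  define e where "e = (\<lambda>(s, t). norm (z t - z s - \<Xi> s t))"
  define w where "w = (\<lambda>(s::real, t). (t - s) powr \<gamma>)"
  have "e (s, t) \<le> M / (1 - 2 powr (1 - \<gamma>)) * w (s, t)"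
  proof (rule contraction_bound[where S = S and ?C0.0 = C])
    fix C p assume C: "0 \<le> C" and IH: "\<And>q. q \<in> S \<Longrightarrow> e q \<le> C * w q" and "p \<in> S"
    then obtain s t where p: "p = (s, t)" "a \<le> s" "s \<le> t" "t \<le> b" by (auto simp: S_def)
    define u where "u = (s + t) / 2"
    have u: "s \<le> u" "u \<le> t" "u - s = (t - s) / 2" "t - u = (t - s) / 2"
      using p by (auto simp: u_def field_simps)
    have eq: "z t - z s - \<Xi> s t = (z u - z s - \<Xi> s u) + (z t - z u - \<Xi> u t) - (\<Xi> s t - \<Xi> s u - \<Xi> u t)"
      by (simp add: algebra_simps)
    have "e p \<le> e (s, u) + e (u, t) + norm (\<Xi> s t - \<Xi> s u - \<Xi> u t)"
      using norm_add_diff_le[of "z u - z s - \<Xi> s u" "z t - z u - \<Xi> u t"] by (simp only: e_def p eq prod.case)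
    also have "\<dots> \<le> C * ((t - s) / 2) powr \<gamma> + C * ((t - s) / 2) powr \<gamma> + M * (t - s) powr \<gamma>"
      using IH[of "(s, u)"] IH[of "(u, t)"] defect[of s u t] p u by (auto simp: S_def w_def intro!: add_mono)
    also have "C * ((t - s) / 2) powr \<gamma> + C * ((t - s) / 2) powr \<gamma>
        = C * (2 powr (1 - \<gamma>) * (t - s) powr \<gamma>)"
      using p by (subst powr_half_twice[symmetric]) (auto simp: algebra_simps)
    finally show "e p \<le> (2 powr (1 - \<gamma>) * C + M) * w p"
      by (simp add: p w_def algebra_simps)
  qed (use assms two_powr_less_1[OF \<gamma>] in \<open>auto simp: S_def e_def w_def\<close>)
  then show ?thesis by (simp add: e_def w_def)
qed

text \<open>The constant is a parameter, not hidden in an existential as in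
  \<open>holder_on\<close>, because stability is read off from the way the constants depend on the
  data.\<close>

definition holder_const :: "real \<Rightarrow> real \<Rightarrow> (real \<Rightarrow> 'e::real_normed_vector) \<Rightarrow> bool" where
  "holder_const \<beta> C z \<longleftrightarrow> (\<forall>s t. 0 \<le> s \<longrightarrow> s \<le> t \<longrightarrow> t \<le> 1 \<longrightarrow> norm (z t - z s) \<le> C * (t - s) powr \<beta>)"

text \<open>The left-point approximation over \<open>[s, t]\<close> of the sum of the Young
  integrals of \<open>F i\<close> against \<open>g i\<close>.\<close>

definition germ :: "('n::finite \<Rightarrow> real \<Rightarrow> real) \<Rightarrow> ('n \<Rightarrow> real \<Rightarrow> 'e::real_normed_vector) \<Rightarrow>
    real \<Rightarrow> real \<Rightarrow> 'e" where
  "germ g F s t = (\<Sum>i\<in>UNIV. (g i t - g i s) *\<^sub>R F i s)"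

text \<open>The description of solutions by their local expansion, due to Davie.\<close>

definition davie :: "real \<Rightarrow> real \<Rightarrow> ('n::finite \<Rightarrow> real \<Rightarrow> real) \<Rightarrow>
    ('n \<Rightarrow> real \<Rightarrow> 'e::real_normed_vector) \<Rightarrow> (real \<Rightarrow> 'e) \<Rightarrow> bool" where
  "davie \<beta> C g F z \<longleftrightarrow> (\<forall>s t. 0 \<le> s \<longrightarrow> s \<le> t \<longrightarrow> t \<le> 1 \<longrightarrow>
     norm (z t - z s - germ g F s t) \<le> C * (t - s) powr (2 * \<beta>))"

lemma holder_constD: "holder_const \<beta> C z \<Longrightarrow> 0 \<le> s \<Longrightarrow> s \<le> t \<Longrightarrow> t \<le> 1 \<Longrightarrow>
    norm (z t - z s) \<le> C * (t - s) powr \<beta>"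
  by (simp add: holder_const_def)

lemma davieD: "davie \<beta> C g F z \<Longrightarrow> 0 \<le> s \<Longrightarrow> s \<le> t \<Longrightarrow> t \<le> 1 \<Longrightarrow>
    norm (z t - z s - germ g F s t) \<le> C * (t - s) powr (2 * \<beta>)"
  by (simp add: davie_def)

lemma holder_const_mono: "holder_const \<beta> C z \<Longrightarrow> C \<le> C' \<Longrightarrow> holder_const \<beta> C' z"
  unfolding holder_const_def by (meson mult_right_mono order_trans powr_ge_zero)

lemma davie_mono: "davie \<beta> C g F z \<Longrightarrow> C \<le> C' \<Longrightarrow> davie \<beta> C' g F z"
  unfolding davie_def by (meson mult_right_mono order_trans powr_ge_zero)

lemma norm_germ_le:
  fixes F :: "'n::finite \<Rightarrow> real \<Rightarrow> 'e::real_normed_vector" and G L \<beta> :: real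
  assumes g: "\<And>i. holder_const \<beta> G (g i)" and F: "\<And>i. norm (F i s) \<le> L" and L: "0 \<le> L"
    and st: "0 \<le> s" "s \<le> t" "t \<le> 1"
  shows "norm (germ g F s t) \<le> CARD('n) * G * L * (t - s) powr \<beta>"
proof -
  have "norm (germ g F s t) \<le> (\<Sum>i\<in>(UNIV :: 'n set). norm ((g i t - g i s) *\<^sub>R F i s))"
    unfolding germ_def by (rule norm_sum)
  also have "\<dots> \<le> (\<Sum>i\<in>(UNIV :: 'n set). G * (t - s) powr \<beta> * L)"
    using holder_constD[OF g st] F L
    by (intro sum_mono) (auto intro!: mult_mono intro: order_trans[OF abs_ge_zero])
  finally show ?thesis by (simp add: mult_ac)
qed

text \<open>The defect equals minus the sum of
  \<open>(g i t - g i u) *\<^sub>R (F i u - F i s)\<close>. Each summand is a product of two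
  increments of order \<open>\<beta>\<close>, hence of order \<open>2 * \<beta>\<close>, the
  exponent above 1 required by \<open>sewing\<close>.\<close>

lemma norm_germ_defect_le:
  fixes F :: "'n::finite \<Rightarrow> real \<Rightarrow> 'e::real_normed_vector" and G L \<beta> :: real
  assumes g: "\<And>i. holder_const \<beta> G (g i)" and G: "0 \<le> G" and \<beta>: "0 \<le> \<beta>"
    and F: "\<And>i. norm (F i u - F i s) \<le> L * (u - s) powr \<beta>" and L: "0 \<le> L"
    and st: "0 \<le> s" "s \<le> u" "u \<le> t" "t \<le> 1"
  shows "norm (germ g F s t - germ g F s u - germ g F u t) \<le> CARD('n) * G * L * (t - s) powr (2 * \<beta>)"
proof -
  have eq: "germ g F s t - germ g F s u - germ g F u t = - (\<Sum>i\<in>UNIV. (g i t - g i u) *\<^sub>R (F i u - F i s))"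
    unfolding germ_def by (simp add: sum_subtractf[symmetric] sum_negf[symmetric] algebra_simps)
  have "norm (germ g F s t - germ g F s u - germ g F u t)
      \<le> (\<Sum>i\<in>(UNIV :: 'n set). norm ((g i t - g i u) *\<^sub>R (F i u - F i s)))"
    unfolding eq norm_minus_cancel by (rule norm_sum)
  also have "\<dots> \<le> (\<Sum>i\<in>(UNIV :: 'n set). (G * (t - s) powr \<beta>) * (L * (t - s) powr \<beta>))"
  proof (intro sum_mono)
    fix i
    have "norm (g i t - g i u) \<le> G * (t - u) powr \<beta>" using holder_constD[OF g] st by auto
    also have "\<dots> \<le> G * (t - s) powr \<beta>" using st \<beta> G by (intro mult_left_mono powr_mono2) auto
    finally have 1: "norm (g i t - g i u) \<le> G * (t - s) powr \<beta>" .
    have "norm (F i u - F i s) \<le> L * (t - s) powr \<beta>"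
      using F[of i] st \<beta> L by (elim order_trans) (intro mult_left_mono powr_mono2, auto)
    with 1 G show "norm ((g i t - g i u) *\<^sub>R (F i u - F i s)) \<le> (G * (t - s) powr \<beta>) * (L * (t - s) powr \<beta>)"
      by (auto intro!: mult_mono)
  qed
  also have "\<dots> = CARD('n) * G * L * (t - s) powr (2 * \<beta>)"
    by (simp add: mult_ac flip: powr_add)
  finally show ?thesis .
qed

text \<open>\<open>N\<close> is the number of pieces into which \<open>[0, 1]\<close> has to be cut for the equation to be
  a contraction on each of them, and the solution grows by a factor of at most \<open>3 / 2\<close> on each.\<close>

definition gronwall_constant :: "nat \<Rightarrow> real \<Rightarrow> real \<Rightarrow> real \<Rightarrow> real" where
  "gronwall_constant n \<beta> G K =
     (let c = 1 / (1 - 2 powr (1 - 2 * \<beta>)); a = n * G * (1 + c);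
          N = nat \<lceil>max 1 ((4 * K * a) powr (1 / \<beta>))\<rceil>;
          C1 = (3 / 2) ^ N * (1 + 4 * a);
          C2 = 2 * a * (K * C1 + 1) + 2 * C1 / (1 / real N) powr \<beta>;
          C3 = n * G * (K * C2 + K * C1 + 1) * c
      in C1 + C2 + C3)"

text \<open>The a priori constants \<open>L\<close> and \<open>D\<close> do not enter the bounds.\<close>

proposition young_gronwall:
  fixes \<beta> G K \<epsilon> :: real and g :: "'n::finite \<Rightarrow> real \<Rightarrow> real" and z :: "real \<Rightarrow> 'e::real_normed_vector"
  assumes \<beta>: "1 / 2 < \<beta>" "\<beta> \<le> 1" and G: "0 \<le> G" and K: "0 \<le> K" and \<epsilon>: "0 \<le> \<epsilon>"
    and g: "\<And>i. holder_const \<beta> G (g i)" and zL: "holder_const \<beta> L z" and zD: "davie \<beta> D g F z"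
    and F: "\<And>i s. 0 \<le> s \<Longrightarrow> s \<le> 1 \<Longrightarrow> norm (F i s) \<le> K * norm (z s) + \<epsilon>"
    and dF: "\<And>i s t. 0 \<le> s \<Longrightarrow> s \<le> t \<Longrightarrow> t \<le> 1 \<Longrightarrow>
       norm (F i t - F i s) \<le> K * norm (z t - z s) + (K * norm (z s) + \<epsilon>) * (t - s) powr \<beta>"
  defines "C \<equiv> gronwall_constant CARD('n) \<beta> G K"
  shows "0 \<le> C" "\<And>s. 0 \<le> s \<Longrightarrow> s \<le> 1 \<Longrightarrow> norm (z s) \<le> C * (norm (z 0) + \<epsilon>)"
    "holder_const \<beta> (C * (norm (z 0) + \<epsilon>)) z" "davie \<beta> (C * (norm (z 0) + \<epsilon>)) g F z"
proof -
  define n where "n = real (CARD('n))"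
  define c where "c = 1 / (1 - 2 powr (1 - 2 * \<beta>))"
  have c: "0 < c" using two_powr_less_1[of "2 * \<beta>"] \<beta> by (simp add: c_def)
  have n: "0 \<le> n" by (simp add: n_def)
  define a where "a = n * G * (1 + c)"
  have a: "0 \<le> a" "n * G \<le> a" "n * G * c \<le> a"
    using n G c by (auto simp: a_def algebra_simps)
  \<comment> \<open>Chosen such that pieces of length \<open>\<delta> = 1 / N\<close> satisfy
    \<open>4 * K * a * \<eta> \<le> 1\<close> with \<open>\<eta> = \<delta> powr \<beta>\<close>;
    this makes the contraction factor on a piece at most \<open>1 / 2\<close>.\<close>
  define N where "N = nat \<lceil>max 1 ((4 * K * a) powr (1 / \<beta>))\<rceil>"
  have "max 1 ((4 * K * a) powr (1 / \<beta>)) \<le> real N" unfolding N_def by linarith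
  then have N: "1 \<le> real N" "(4 * K * a) powr (1 / \<beta>) \<le> real N" by auto
  have N\<beta>: "4 * K * a \<le> real N powr \<beta>"
  proof -
    have "4 * K * a = ((4 * K * a) powr (1 / \<beta>)) powr \<beta>"
      using \<beta> K a by (simp add: powr_powr)
    also have "\<dots> \<le> real N powr \<beta>" using N \<beta> by (intro powr_mono2) auto
    finally show ?thesis .
  qed
  define \<delta> where "\<delta> = 1 / real N"
  have \<delta>: "0 < \<delta>" "\<delta> \<le> 1" using N by (auto simp: \<delta>_def)
  define \<eta> where "\<eta> = \<delta> powr \<beta>"
  have \<eta>: "0 < \<eta>" "\<eta> \<le> 1" "4 * K * a * \<eta> \<le> 1"
  proof -
    show "0 < \<eta>" using \<delta> by (simp add: \<eta>_def)
    show "\<eta> \<le> 1" using \<delta> \<beta> by (simp add: \<eta>_def powr_le1)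
    have "\<eta> = 1 / real N powr \<beta>" using N by (simp add: \<eta>_def \<delta>_def powr_divide)
    then show "4 * K * a * \<eta> \<le> 1" using N\<beta> N by (simp add: divide_le_eq)
  qed
  \<comment> \<open>Relative to \<open>norm (z 0) + \<epsilon>\<close>, the three constants bound
    the supremum of \<open>z\<close>, its Hoelder constant and the error of its expansion, in this
    order.\<close>
  define C1 where "C1 = (3 / 2) ^ N * (1 + 4 * a)"
  define C2 where "C2 = 2 * a * (K * C1 + 1) + 2 * C1 / \<eta>"
  define C3 where "C3 = n * G * (K * C2 + K * C1 + 1) * c"
  have C1: "0 \<le> C1" using a by (simp add: C1_def)
  have C2: "0 \<le> C2" using a C1 K \<eta> by (simp add: C2_def)
  have C3: "0 \<le> C3" using n c G C1 C2 K by (simp add: C3_def)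
  \<comment> \<open>Sewing on a subinterval trades the a priori constant \<open>D\<close> for one
    that is linear in the bounds \<open>h\<close> and \<open>A\<close> for \<open>z\<close> on that
    subinterval.\<close>
  have davie_on: "norm (z t - z s - germ g F s t) \<le> n * G * (K * h + K * A + \<epsilon>) * c * (t - s) powr (2 * \<beta>)"
    if h: "0 \<le> h" "0 \<le> A" and p: "0 \<le> p" "q \<le> 1"
      and zh: "\<And>s t. p \<le> s \<Longrightarrow> s \<le> t \<Longrightarrow> t \<le> q \<Longrightarrow> norm (z t - z s) \<le> h * (t - s) powr \<beta>"
      and zA: "\<And>s. p \<le> s \<Longrightarrow> s \<le> q \<Longrightarrow> norm (z s) \<le> A"
      and st: "p \<le> s" "s \<le> t" "t \<le> q"
    for h A p q s t
  proof -
    have "norm (z t - z s - germ g F s t)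
        \<le> (n * G * (K * h + K * A + \<epsilon>)) / (1 - 2 powr (1 - 2 * \<beta>)) * (t - s) powr (2 * \<beta>)"
    proof (rule sewing[where a = p and b = q and C = D])
      fix s u t assume *: "p \<le> s" "s \<le> u" "u \<le> t" "t \<le> q"
      show "norm (germ g F s t - germ g F s u - germ g F u t)
          \<le> n * G * (K * h + K * A + \<epsilon>) * (t - s) powr (2 * \<beta>)"
        unfolding n_def
      proof (rule norm_germ_defect_le)
        fix i
        have "norm (F i u - F i s) \<le> K * norm (z u - z s) + (K * norm (z s) + \<epsilon>) * (u - s) powr \<beta>"
          using * p by (intro dF) auto
        also have "\<dots> \<le> K * (h * (u - s) powr \<beta>) + (K * A + \<epsilon>) * (u - s) powr \<beta>"
          using * K zh[of s u] zA[of s] by (intro add_mono mult_left_mono mult_right_mono) auto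
        finally show "norm (F i u - F i s) \<le> (K * h + K * A + \<epsilon>) * (u - s) powr \<beta>"
          by (simp add: algebra_simps)
      qed (use g G \<beta> * p K h \<epsilon> in auto)
    qed (use \<beta> n G K h \<epsilon> p st in \<open>auto intro!: davieD[OF zD]\<close>)
    then show ?thesis by (simp add: c_def)
  qed
  \<comment> \<open>On a short interval a Hoelder constant \<open>h\<close> of \<open>z\<close>
    improves to \<open>h / 2\<close> plus a multiple of the data at the left end: the germ is
    bounded through \<open>z p\<close>, and the sewing error carries the small factor
    \<open>\<eta>\<close>. Then \<open>contraction_bound\<close> removes the a priori constant
    \<open>L\<close>.\<close>
  have loc: "norm (z t - z s) \<le> 2 * a * (K * norm (z p) + \<epsilon>) * (t - s) powr \<beta>"
    if p: "0 \<le> p" "q \<le> 1" "q - p \<le> \<delta>" and st: "p \<le> s" "s \<le> t" "t \<le> q" for p q s t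
  proof -
    define S where "S = {(s, t). p \<le> s \<and> s \<le> t \<and> t \<le> q}"
    define e where "e = (\<lambda>(s, t). norm (z t - z s))"
    define w where "w = (\<lambda>(s::real, t). (t - s) powr \<beta>)"
    have "e (s, t) \<le> (a * (K * norm (z p) + \<epsilon>)) / (1 - 1 / 2) * w (s, t)"
    proof (rule contraction_bound[where S = S and ?C0.0 = L])
      fix h pp assume h: "0 \<le> h" and IH: "\<And>q. q \<in> S \<Longrightarrow> e q \<le> h * w q" and "pp \<in> S"
      then obtain s t where st: "pp = (s, t)" "p \<le> s" "s \<le> t" "t \<le> q" by (auto simp: S_def)
      define A where "A = norm (z p) + h * \<eta>"
      have zh: "norm (z t - z s) \<le> h * (t - s) powr \<beta>" if "p \<le> s" "s \<le> t" "t \<le> q" for s t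
        using IH[of "(s, t)"] that by (simp add: S_def e_def w_def)
      have small: "(t - s) powr \<beta> \<le> \<eta>" if "p \<le> s" "s \<le> t" "t \<le> q" for s t
        unfolding \<eta>_def using that p \<beta> by (intro powr_mono2) auto
      have zA: "norm (z s) \<le> A" if "p \<le> s" "s \<le> q" for s
      proof -
        have "norm (z s) \<le> norm (z p) + norm (z s - z p)" by (metis norm_triangle_sub)
        also have "norm (z s - z p) \<le> h * (s - p) powr \<beta>" using zh that by auto
        also have "\<dots> \<le> h * \<eta>" using small[of p s] that h by (intro mult_left_mono) auto
        finally show ?thesis by (simp add: A_def)
      qed
      have A: "0 \<le> A" using h \<eta> by (simp add: A_def)
      have "norm (z t - z s) \<le> norm (germ g F s t) + norm (z t - z s - germ g F s t)"
        by (metis norm_triangle_sub)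
      also have "norm (germ g F s t) \<le> n * G * (K * A + \<epsilon>) * (t - s) powr \<beta>"
        unfolding n_def
      proof (rule norm_germ_le[OF g])
        show "norm (F i s) \<le> K * A + \<epsilon>" for i
          using F[of s i] zA[of s] K st p by (smt (verit) mult_left_mono)
      qed (use st p K A \<epsilon> in auto)
      also have "norm (z t - z s - germ g F s t) \<le> n * G * (K * h + K * A + \<epsilon>) * c * (t - s) powr (2 * \<beta>)"
        using h A p zh zA st by (intro davie_on[where p = p and q = q]) auto
      also have "\<dots> \<le> n * G * (K * h + K * A + \<epsilon>) * c * (\<eta> * (t - s) powr \<beta>)"
      proof (intro mult_left_mono)
        have "(t - s) powr (2 * \<beta>) = (t - s) powr \<beta> * (t - s) powr \<beta>"
          by (simp flip: powr_add)
        also have "\<dots> \<le> \<eta> * (t - s) powr \<beta>" using small[of s t] st by (intro mult_right_mono) auto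
        finally show "(t - s) powr (2 * \<beta>) \<le> \<eta> * (t - s) powr \<beta>" .
      qed (use n G K h A \<epsilon> c in auto)
      finally have 1: "norm (z t - z s)
          \<le> (n * G * (K * A + \<epsilon>) + n * G * (K * h + K * A + \<epsilon>) * c * \<eta>) * (t - s) powr \<beta>"
        by (simp add: algebra_simps)
      have "n * G * (K * A + \<epsilon>) + n * G * (K * h + K * A + \<epsilon>) * c * \<eta>
          = n * G * (K * A + \<epsilon>) + n * G * c * (K * A + \<epsilon>) * \<eta> + (n * G * c) * (K * h * \<eta>)"
        by (simp add: algebra_simps)
      also have "\<dots> \<le> n * G * (K * A + \<epsilon>) + n * G * c * (K * A + \<epsilon>) * 1 + a * (K * h * \<eta>)"
        using n G c K A \<epsilon> \<eta> a h by (intro add_mono mult_left_mono mult_right_mono) auto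
      \<comment> \<open>The term \<open>a * K * h * \<eta>\<close> occurs twice, once through
        \<open>A\<close> in the bound for \<open>F\<close> and once through the oscillation of
        \<open>F\<close>; by the choice of \<open>N\<close> the two together are at most
        \<open>h / 2\<close>.\<close>
      also have "\<dots> = a * (K * norm (z p) + \<epsilon>) + (4 * K * a * \<eta>) * (h / 2)"
        by (simp add: a_def A_def algebra_simps)
      also have "\<dots> \<le> a * (K * norm (z p) + \<epsilon>) + 1 * (h / 2)"
        using \<eta> h K \<epsilon> by (intro add_mono mult_right_mono) auto
      finally have 2: "n * G * (K * A + \<epsilon>) + n * G * (K * h + K * A + \<epsilon>) * c * \<eta>
          \<le> 1 / 2 * h + a * (K * norm (z p) + \<epsilon>)" by simp
      show "e pp \<le> (1 / 2 * h + a * (K * norm (z p) + \<epsilon>)) * w pp"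
        using order_trans[OF 1 mult_right_mono[OF 2]] by (simp add: st e_def w_def)
    qed (use holder_constD[OF zL] p a K \<epsilon> st in \<open>auto simp: S_def e_def w_def\<close>)
    then show ?thesis by (simp add: e_def w_def mult_ac)
  qed
  \<comment> \<open>The shift by \<open>4 * a * \<epsilon>\<close> turns the affine recursion
    \<open>norm (z t) \<le> 3 / 2 * norm (z p) + 2 * a * \<epsilon>\<close> into a purely
    multiplicative one that can be iterated.\<close>
  have grow: "norm (z t) + 4 * a * \<epsilon> \<le> 3 / 2 * (norm (z p) + 4 * a * \<epsilon>)"
    if "0 \<le> p" "p \<le> t" "t \<le> 1" "t - p \<le> \<delta>" for p t
  proof -
    have "norm (z t) \<le> norm (z p) + norm (z t - z p)" by (metis norm_triangle_sub)
    also have "norm (z t - z p) \<le> 2 * a * (K * norm (z p) + \<epsilon>) * (t - p) powr \<beta>"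
      using that by (intro loc[where q = t]) auto
    also have "\<dots> \<le> 2 * a * (K * norm (z p) + \<epsilon>) * \<eta>"
      unfolding \<eta>_def using that \<beta> a K \<epsilon> by (intro mult_left_mono powr_mono2) auto
    also have "\<dots> = (4 * K * a * \<eta>) * (norm (z p) / 2) + 2 * a * \<epsilon> * \<eta>"
      by (simp add: algebra_simps)
    also have "\<dots> \<le> 1 * (norm (z p) / 2) + 2 * a * \<epsilon> * 1"
      using \<eta> a \<epsilon> by (intro add_mono mult_right_mono mult_left_mono) auto
    finally show ?thesis by (simp add: algebra_simps)
  qed
  have chain: "norm (z t) + 4 * a * \<epsilon> \<le> (3 / 2) ^ k * (norm (z 0) + 4 * a * \<epsilon>)"
    if "0 \<le> t" "t \<le> real k * \<delta>" "t \<le> 1" for k t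
    using that
  proof (induction k arbitrary: t)
    case 0
    then show ?case by simp
  next
    case (Suc k)
    define p where "p = max 0 (t - \<delta>)"
    have p: "0 \<le> p" "p \<le> t" "p \<le> 1" "t - p \<le> \<delta>" "p \<le> real k * \<delta>"
      using Suc.prems \<delta> by (auto simp: p_def max_def algebra_simps)
    have "norm (z t) + 4 * a * \<epsilon> \<le> 3 / 2 * (norm (z p) + 4 * a * \<epsilon>)"
      using grow p Suc.prems by blast
    also have "\<dots> \<le> 3 / 2 * ((3 / 2) ^ k * (norm (z 0) + 4 * a * \<epsilon>))"
      using Suc.IH[of p] p by (intro mult_left_mono) auto
    finally show ?case by simp
  qed
  have sup: "norm (z s) \<le> C1 * (norm (z 0) + \<epsilon>)" if "0 \<le> s" "s \<le> 1" for s
  proof -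
    have "norm (z s) \<le> norm (z s) + 4 * a * \<epsilon>" using a \<epsilon> by simp
    also have "\<dots> \<le> (3 / 2) ^ N * (norm (z 0) + 4 * a * \<epsilon>)"
      using that N by (intro chain) (auto simp: \<delta>_def)
    also have "\<dots> \<le> (3 / 2) ^ N * ((1 + 4 * a) * (norm (z 0) + \<epsilon>))"
      using a \<epsilon> by (intro mult_left_mono) (auto simp: algebra_simps)
    finally show ?thesis by (simp add: C1_def mult_ac)
  qed
  have X0: "0 \<le> norm (z 0) + \<epsilon>" using \<epsilon> by simp
  \<comment> \<open>Increments over at most \<open>\<delta>\<close> come from \<open>loc\<close>
    with left end \<open>s\<close>. Over longer intervals twice the supremum suffices, since there
    \<open>(t - s) powr \<beta> \<ge> \<eta>\<close>; this is the origin of the second summand of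
    \<open>C2\<close>.\<close>
  have hol: "norm (z t - z s) \<le> C2 * (norm (z 0) + \<epsilon>) * (t - s) powr \<beta>"
    if st: "0 \<le> s" "s \<le> t" "t \<le> 1" for s t
  proof (cases "t - s \<le> \<delta>")
    case True
    have "norm (z t - z s) \<le> 2 * a * (K * norm (z s) + \<epsilon>) * (t - s) powr \<beta>"
      using True st by (intro loc[where q = t]) auto
    also have "\<dots> \<le> 2 * a * (K * (C1 * (norm (z 0) + \<epsilon>)) + 1 * (norm (z 0) + \<epsilon>)) * (t - s) powr \<beta>"
      using sup[of s] st a K by (intro mult_left_mono mult_right_mono add_mono) auto
    also have "\<dots> = (2 * a * (K * C1 + 1)) * ((norm (z 0) + \<epsilon>) * (t - s) powr \<beta>)"
      by (simp add: algebra_simps)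
    also have "\<dots> \<le> C2 * ((norm (z 0) + \<epsilon>) * (t - s) powr \<beta>)"
      using C1 \<eta> X0 by (intro mult_right_mono) (auto simp: C2_def)
    finally show ?thesis by (simp add: mult_ac)
  next
    case False
    have "\<eta> \<le> (t - s) powr \<beta>" unfolding \<eta>_def using False \<delta> \<beta> by (intro powr_mono2) auto
    then have 1: "1 \<le> (t - s) powr \<beta> / \<eta>" using \<eta> by simp
    have "norm (z t - z s) \<le> norm (z t) + norm (z s)" by (rule norm_triangle_ineq4)
    also have "\<dots> \<le> 2 * C1 * (norm (z 0) + \<epsilon>) * 1" using sup[of s] sup[of t] st by simp
    also have "\<dots> \<le> 2 * C1 * (norm (z 0) + \<epsilon>) * ((t - s) powr \<beta> / \<eta>)"
      using 1 C1 X0 by (intro mult_left_mono) auto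
    also have "\<dots> = (2 * C1 / \<eta>) * ((norm (z 0) + \<epsilon>) * (t - s) powr \<beta>)" by simp
    also have "\<dots> \<le> C2 * ((norm (z 0) + \<epsilon>) * (t - s) powr \<beta>)"
      using a K C1 X0 by (intro mult_right_mono) (auto simp: C2_def)
    finally show ?thesis by (simp add: mult_ac)
  qed
  have dav: "norm (z t - z s - germ g F s t) \<le> C3 * (norm (z 0) + \<epsilon>) * (t - s) powr (2 * \<beta>)"
    if st: "0 \<le> s" "s \<le> t" "t \<le> 1" for s t
  proof -
    have "norm (z t - z s - germ g F s t)
      \<le> n * G * (K * (C2 * (norm (z 0) + \<epsilon>)) + K * (C1 * (norm (z 0) + \<epsilon>)) + \<epsilon>) * c * (t - s) powr (2 * \<beta>)"
      using hol sup st C1 C2 X0 by (intro davie_on[where p = 0 and q = 1]) auto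
    also have "\<dots> \<le> n * G * (K * (C2 * (norm (z 0) + \<epsilon>)) + K * (C1 * (norm (z 0) + \<epsilon>)) + (norm (z 0) + \<epsilon>)) * c * (t - s) powr (2 * \<beta>)"
      using n G c by (intro mult_left_mono mult_right_mono) auto
    finally show ?thesis by (simp add: C3_def algebra_simps)
  qed
  have C_eq: "C = C1 + C2 + C3"
    unfolding C_def gronwall_constant_def Let_def C3_def C2_def C1_def \<eta>_def \<delta>_def N_def a_def c_def n_def ..
  have C: "0 \<le> C" "C1 \<le> C" "C2 \<le> C" "C3 \<le> C" using C1 C2 C3 by (auto simp: C_eq)
  show "0 \<le> C" by fact
  show "norm (z s) \<le> C * (norm (z 0) + \<epsilon>)" if "0 \<le> s" "s \<le> 1" for s
    using sup[OF that] mult_right_mono[OF C(2) X0] by simp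
  show "holder_const \<beta> (C * (norm (z 0) + \<epsilon>)) z"
    by (rule holder_const_mono[OF _ mult_right_mono[OF C(3) X0]]) (use hol in \<open>simp add: holder_const_def\<close>)
  show "davie \<beta> (C * (norm (z 0) + \<epsilon>)) g F z"
    by (rule davie_mono[OF _ mult_right_mono[OF C(4) X0]]) (use dav in \<open>simp add: davie_def\<close>)
qed

text \<open>Read off from \<open>young_gronwall\<close> for the zero path, which avoids unfolding
  the formula.\<close>

lemma gronwall_constant_nonneg:
  assumes "1 / 2 < \<beta>" "\<beta> \<le> 1" "0 \<le> G" "0 \<le> K"
  shows "0 \<le> gronwall_constant CARD('n::finite) \<beta> G K"
  using young_gronwall(1)[OF assms, where 'n = 'n and \<epsilon> = 0 and L = 0 and D = 0 and g = "\<lambda>_ _. 0" and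
      z = "\<lambda>_. 0 :: real" and F = "\<lambda>_ _. 0"] assms
  by (auto simp: holder_const_def davie_def germ_def)

section \<open>The Young-Loeve estimate\<close>

text \<open>The two divisions may share a degenerate cell \<open>{c}\<close> with the same tag,
  which the union counts once. The sums add up because \<open>h\<close> vanishes on such a cell, as
  Riemann-Stieltjes terms do.\<close>

lemma tagged_division_sum_Un:
  fixes h :: "real \<Rightarrow> real set \<Rightarrow> 'e::real_normed_vector"
  assumes p: "p tagged_division_of {a..c}" and q: "q tagged_division_of {c..b}" and ac: "a \<le> c" "c \<le> b"
    and h: "\<And>x K. K = {c} \<Longrightarrow> h x K = 0"
  shows "(p \<union> q) tagged_division_of {a..b}"
    "(\<Sum>(x, K)\<in>p \<union> q. h x K) = (\<Sum>(x, K)\<in>p. h x K) + (\<Sum>(x, K)\<in>q. h x K)"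
proof -
  show "(p \<union> q) tagged_division_of {a..b}"
    using tagged_division_Un[OF p q] ac by (simp add: ivl_disj_un_two_touch interior_atLeastAtMost_real)
  have "(case y of (x, K) \<Rightarrow> h x K) = 0" if y: "y \<in> p \<inter> q" for y
  proof -
    obtain x K where [simp]: "y = (x, K)" by force
    have "x \<in> K" "K \<subseteq> {a..c}" "K \<subseteq> {c..b}"
      using y tagged_division_ofD(2,3)[OF p, of x K] tagged_division_ofD(3)[OF q, of x K] by auto
    then have "K = {c}" by force
    then show ?thesis using h by simp
  qed
  moreover have "finite p" "finite q" using p q by auto
  ultimately show "(\<Sum>(x, K)\<in>p \<union> q. h x K) = (\<Sum>(x, K)\<in>p. h x K) + (\<Sum>(x, K)\<in>q. h x K)"
    by (intro sum.union_inter_neutral) auto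
qed

text \<open>Bisection until the mesh is fine; by \<open>\<alpha> + \<beta> > 1\<close> the errors of the successive
  bisections form a geometric series.\<close>

lemma fine_division_near_left_sum:
  fixes f :: "real \<Rightarrow> 'e::real_normed_vector"
  assumes \<gamma>: "1 < \<alpha> + \<beta>" "0 < \<alpha>" "0 < \<beta>" and C: "0 \<le> C" "0 \<le> C'"
    and f: "\<And>s t. a \<le> s \<Longrightarrow> s \<le> t \<Longrightarrow> t \<le> b \<Longrightarrow> norm (f t - f s) \<le> C * (t - s) powr \<alpha>"
    and g: "\<And>s t. a \<le> s \<Longrightarrow> s \<le> t \<Longrightarrow> t \<le> b \<Longrightarrow> \<bar>g t - g s\<bar> \<le> C' * (t - s) powr \<beta>"
    and st: "a \<le> s" "s \<le> t" "t \<le> b" and d: "0 < d" "t - s < d * 2 ^ m"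
  shows "\<exists>p. p tagged_division_of {s..t} \<and> (\<lambda>s. ball s d) fine p \<and>
    norm ((\<Sum>(s, K)\<in>p. (g (Sup K) - g (Inf K)) *\<^sub>R f s) - (g t - g s) *\<^sub>R f s)
      \<le> C * C' / (1 - 2 powr (1 - (\<alpha> + \<beta>))) * (t - s) powr (\<alpha> + \<beta>)"
  using st d(2)
proof (induction m arbitrary: s t)
  case 0
  \<comment> \<open>One cell tagged at its left end: its Riemann sum is exactly the germ, and it is
    fine because its length is below \<open>d\<close>.\<close>
  let ?p = "{(s, {s..t})}"
  have c: "0 \<le> C * C' / (1 - 2 powr (1 - (\<alpha> + \<beta>)))" using two_powr_less_1[OF \<gamma>(1)] C by simp
  have "?p tagged_division_of {s..t}"
    using 0 tagged_division_of_self_real[of s s t] by simp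
  moreover have "(\<lambda>s. ball s d) fine ?p" using 0 by (auto simp: fine_def dist_real_def)
  ultimately show ?case using 0 c by (intro exI[of _ ?p] conjI) (simp_all add: c mult_nonneg_nonneg del: times_divide_eq_left)
next
  case (Suc m)
  define \<theta> where "\<theta> = 2 powr (1 - (\<alpha> + \<beta>))"
  have \<theta>: "0 < \<theta>" "\<theta> < 1" using two_powr_less_1[OF \<gamma>(1)] by (auto simp: \<theta>_def)
  define c where "c = C * C' / (1 - \<theta>)"
  \<comment> \<open>\<open>c\<close> is the fixed point of the recursion that one bisection imposes
    on the constant, so the same bound is valid at every depth.\<close>
  have cC: "c * \<theta> + C * C' = c" using \<theta> by (simp add: c_def field_simps)
  define u where "u = (s + t) / 2"
  have u: "s \<le> u" "u \<le> t" "u - s = (t - s) / 2" "t - u = (t - s) / 2"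
    using Suc.prems by (auto simp: u_def field_simps)
  let ?S = "\<lambda>p. \<Sum>(s, K)\<in>p. (g (Sup K) - g (Inf K)) *\<^sub>R f s"
  have fold: "C * C' / (1 - 2 powr (1 - (\<alpha> + \<beta>))) = c" by (simp add: c_def \<theta>_def)
  obtain p where p: "p tagged_division_of {s..u}" "(\<lambda>s. ball s d) fine p"
      "norm (?S p - (g u - g s) *\<^sub>R f s) \<le> c * (u - s) powr (\<alpha> + \<beta>)"
    using Suc.IH[of s u] Suc.prems u unfolding fold by auto
  obtain q where q: "q tagged_division_of {u..t}" "(\<lambda>s. ball s d) fine q"
      "norm (?S q - (g t - g u) *\<^sub>R f u) \<le> c * (t - u) powr (\<alpha> + \<beta>)"
    using Suc.IH[of u t] Suc.prems u unfolding fold by auto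
  note Un = tagged_division_sum_Un[OF p(1) q(1) u(1,2), where h = "\<lambda>s K. (g (Sup K) - g (Inf K)) *\<^sub>R f s"]
  have S: "?S (p \<union> q) = ?S p + ?S q" by (rule Un(2)) auto
  have "norm ((g t - g u) *\<^sub>R (f u - f s)) \<le> (C' * (t - s) powr \<beta>) * (C * (t - s) powr \<alpha>)"
  proof -
    have "\<bar>g t - g u\<bar> \<le> C' * (t - u) powr \<beta>" using u Suc.prems by (intro g) auto
    also have "\<dots> \<le> C' * (t - s) powr \<beta>" using u \<gamma> C by (intro mult_left_mono powr_mono2) auto
    finally have 1: "\<bar>g t - g u\<bar> \<le> C' * (t - s) powr \<beta>" .
    have "norm (f u - f s) \<le> C * (u - s) powr \<alpha>" using u Suc.prems by (intro f) auto
    also have "\<dots> \<le> C * (t - s) powr \<alpha>" using u \<gamma> C by (intro mult_left_mono powr_mono2) auto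
    finally show ?thesis using 1 C by (auto intro!: mult_mono)
  qed
  also have "\<dots> = C * C' * (t - s) powr (\<alpha> + \<beta>)" by (simp add: powr_add)
  finally have R: "norm ((g t - g u) *\<^sub>R (f u - f s)) \<le> C * C' * (t - s) powr (\<alpha> + \<beta>)" .
  have eq: "?S (p \<union> q) - (g t - g s) *\<^sub>R f s = (?S p - (g u - g s) *\<^sub>R f s) + (?S q - (g t - g u) *\<^sub>R f u)
      - (- ((g t - g u) *\<^sub>R (f u - f s)))"
    unfolding S by (simp add: algebra_simps)
  have "norm (?S (p \<union> q) - (g t - g s) *\<^sub>R f s) \<le> norm (?S p - (g u - g s) *\<^sub>R f s)
      + norm (?S q - (g t - g u) *\<^sub>R f u) + norm ((g t - g u) *\<^sub>R (f u - f s))"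
    unfolding eq by (rule order_trans[OF norm_add_diff_le]) simp
  also have "\<dots> \<le> c * ((t - s) / 2) powr (\<alpha> + \<beta>) + c * ((t - s) / 2) powr (\<alpha> + \<beta>) + C * C' * (t - s) powr (\<alpha> + \<beta>)"
    using p(3) q(3) R u by (intro add_mono) auto
  also have "c * ((t - s) / 2) powr (\<alpha> + \<beta>) + c * ((t - s) / 2) powr (\<alpha> + \<beta>) = c * (\<theta> * (t - s) powr (\<alpha> + \<beta>))"
    using Suc.prems unfolding \<theta>_def by (subst powr_half_twice[symmetric]) (auto simp: algebra_simps)
  also have "c * (\<theta> * (t - s) powr (\<alpha> + \<beta>)) + C * C' * (t - s) powr (\<alpha> + \<beta>) = (c * \<theta> + C * C') * (t - s) powr (\<alpha> + \<beta>)"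
    by (simp add: algebra_simps)
  finally have "norm (?S (p \<union> q) - (g t - g s) *\<^sub>R f s) \<le> c * (t - s) powr (\<alpha> + \<beta>)"
    unfolding cC .
  moreover have "(p \<union> q) tagged_division_of {s..t}" by (rule Un(1)) auto
  moreover have "(\<lambda>s. ball s d) fine (p \<union> q)" using p(2) q(2) by (auto intro: fine_Un)
  ultimately show ?case unfolding fold by blast
qed

lemma has_riemann_stieltjes_integralE:
  assumes "has_riemann_stieltjes_integral f g a b I" and "0 < e"
  obtains d where "d > 0" "\<And>p. p tagged_division_of {a..b} \<Longrightarrow> (\<lambda>s. ball s d) fine p \<Longrightarrow>
    norm ((\<Sum>(s, K)\<in>p. (g (Sup K) - g (Inf K)) *\<^sub>R f s) - I) < e"
proof -
  from assms(1)[unfolded has_riemann_stieltjes_integral_def, rule_format, OF assms(2)]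
  obtain d where "0 < d" "\<forall>p. p tagged_division_of {a..b} \<and> (\<lambda>s. ball s d) fine p \<longrightarrow>
      norm ((\<Sum>(s, K)\<in>p. (g (Sup K) - g (Inf K)) *\<^sub>R f s) - I) < e" by (elim exE conjE)
  then show thesis by (intro that[of d]) simp_all
qed

lemma fine_ball_mono: "(\<lambda>s. ball s d) fine p \<Longrightarrow> d \<le> d' \<Longrightarrow> (\<lambda>s. ball s d') fine p"
  unfolding fine_def using subset_ball by fast

lemma less_mult_power_2: "0 < d \<Longrightarrow> \<exists>m. (x::real) < d * 2 ^ m"
  using real_arch_pow[of 2 "x / d"] by (auto simp: field_simps)

text \<open>Both integrals start at \<open>a\<close>, so a single fine division of
  \<open>[a, s]\<close> is used for \<open>J\<close> and, extended by the division of
  \<open>[s, t]\<close> from \<open>fine_division_near_left_sum\<close>, for \<open>I\<close>. Its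
  contribution cancels in \<open>I - J\<close>, leaving a sum close to the germ; additivity of the
  integral does not have to be proved separately.\<close>

theorem young_loeve_estimate:
  fixes f :: "real \<Rightarrow> 'e::real_normed_vector"
  assumes \<gamma>: "1 < \<alpha> + \<beta>" "0 < \<alpha>" "0 < \<beta>" and C: "0 \<le> C" "0 \<le> C'"
    and f: "\<And>s t. a \<le> s \<Longrightarrow> s \<le> t \<Longrightarrow> t \<le> b \<Longrightarrow> norm (f t - f s) \<le> C * (t - s) powr \<alpha>"
    and g: "\<And>s t. a \<le> s \<Longrightarrow> s \<le> t \<Longrightarrow> t \<le> b \<Longrightarrow> \<bar>g t - g s\<bar> \<le> C' * (t - s) powr \<beta>"
    and I: "has_riemann_stieltjes_integral f g a t I" and J: "has_riemann_stieltjes_integral f g a s J"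
    and st: "a \<le> s" "s \<le> t" "t \<le> b"
  shows "norm (I - J - (g t - g s) *\<^sub>R f s)
      \<le> C * C' / (1 - 2 powr (1 - (\<alpha> + \<beta>))) * (t - s) powr (\<alpha> + \<beta>)" (is "_ \<le> ?R")
proof (rule field_le_epsilon)
  fix e :: real assume "0 < e"
  then have e: "0 < e / 2" by simp
  let ?S = "\<lambda>p. \<Sum>(s, K)\<in>p. (g (Sup K) - g (Inf K)) *\<^sub>R f s"
  obtain d1 where d1: "d1 > 0" "\<And>p. p tagged_division_of {a..t} \<Longrightarrow> (\<lambda>s. ball s d1) fine p \<Longrightarrow> norm (?S p - I) < e / 2"
    by (rule has_riemann_stieltjes_integralE[OF I e]) (rule that; assumption)
  obtain d2 where d2: "d2 > 0" "\<And>p. p tagged_division_of {a..s} \<Longrightarrow> (\<lambda>s. ball s d2) fine p \<Longrightarrow> norm (?S p - J) < e / 2"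
    by (rule has_riemann_stieltjes_integralE[OF J e]) (rule that; assumption)
  define d where "d = min d1 d2"
  have d: "d > 0" "d \<le> d1" "d \<le> d2" using d1 d2 by (auto simp: d_def)
  obtain m where m: "b - a < d * 2 ^ m" using less_mult_power_2[OF d(1)] by blast
  obtain p where p: "p tagged_division_of {a..s}" "(\<lambda>s. ball s d) fine p"
    using fine_division_near_left_sum[OF \<gamma> C f g, where a = a and b = b and s = a and t = s and d = d and m = m] st d m by auto
  obtain q where q: "q tagged_division_of {s..t}" "(\<lambda>s. ball s d) fine q"
      "norm (?S q - (g t - g s) *\<^sub>R f s) \<le> ?R"
    using fine_division_near_left_sum[OF \<gamma> C f g, where a = a and b = b and s = s and t = t and d = d and m = m] st d m by auto
  note Un = tagged_division_sum_Un[OF p(1) q(1) st(1,2), where h = "\<lambda>s K. (g (Sup K) - g (Inf K)) *\<^sub>R f s"]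
  have S: "?S (p \<union> q) = ?S p + ?S q" by (rule Un(2)) auto
  have "(p \<union> q) tagged_division_of {a..t}" by (rule Un(1)) auto
  moreover have "(\<lambda>s. ball s d1) fine (p \<union> q)"
    using p(2) q(2) d(2) by (intro fine_Un) (auto intro: fine_ball_mono)
  ultimately have 1: "norm (?S p + ?S q - I) < e / 2" using d1(2) S by metis
  have 2: "norm (?S p - J) < e / 2" using d2(2) p d(3) by (auto intro: fine_ball_mono)
  have eq: "I - J - (g t - g s) *\<^sub>R f s = (?S q - (g t - g s) *\<^sub>R f s) + (?S p - J) - (?S p + ?S q - I)"
    by (simp add: algebra_simps)
  have "norm (I - J - (g t - g s) *\<^sub>R f s) \<le> norm (?S q - (g t - g s) *\<^sub>R f s) + norm (?S p + ?S q - I) + norm (?S p - J)"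
    unfolding eq by (rule order_trans[OF norm_add_diff_le]) simp
  then show "norm (I - J - (g t - g s) *\<^sub>R f s) \<le> ?R + e" using 1 2 q(3) by simp
qed

lemma has_riemann_stieltjes_integral_trivial:
  assumes "has_riemann_stieltjes_integral f g a a I"
  shows "I = 0"
proof (rule ccontr)
  assume "I \<noteq> 0"
  then have pos: "0 < norm I" by simp
  obtain d where d: "d > 0" "\<And>p. p tagged_division_of {a..a} \<Longrightarrow> (\<lambda>s. ball s d) fine p \<Longrightarrow>
      norm ((\<Sum>(s, K)\<in>p. (g (Sup K) - g (Inf K)) *\<^sub>R f s) - I) < norm I"
    by (rule has_riemann_stieltjes_integralE[OF assms pos]) (rule that; assumption)
  have "{(a, {a..a})} tagged_division_of {a..a}" using tagged_division_of_self_real[of a a a] by simp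
  from d(2)[OF this] d(1) show False by (auto simp: fine_def)
qed

section \<open>Hoelder continuity of fractional Brownian motion\<close>

text \<open>The degenerate case is the value \<open>\<sigma> = 0\<close>, for which the formula
  remains correct also at \<open>k = 0\<close>, since \<open>0 ^ 0 = 1\<close>.\<close>

lemma gaussian_rv_moments:
  assumes "prob_space M" and Y: "gaussian_rv M Y"
  obtains \<mu> \<sigma> :: real where "0 \<le> \<sigma>" "\<And>k. integrable M (\<lambda>w. (Y w - \<mu>) ^ k)"
    "prob_space.expectation M Y = \<mu>"
    "\<And>k. prob_space.expectation M (\<lambda>w. (Y w - \<mu>) ^ (2 * k)) = fact (2 * k) / (2 ^ k * fact k) * \<sigma> ^ (2 * k)"
proof -
  interpret prob_space M by fact
  have Ym [measurable]: "Y \<in> borel_measurable M" using Y by (simp add: gaussian_rv_def)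
  from Y consider \<mu> where "AE w in M. Y w = \<mu>"
    | \<mu> \<sigma> where "\<sigma> > 0" "distributed M lborel Y (normal_density \<mu> \<sigma>)"
    unfolding gaussian_rv_def by auto
  then show thesis
  proof cases
    case 1
    have eq: "AE w in M. (Y w - \<mu>) ^ k = 0 ^ k" for k using 1 by eventually_elim simp
    have "integrable M (\<lambda>w. (Y w - \<mu>) ^ k)" for k
      by (subst integrable_cong_AE[OF _ _ eq]) auto
    moreover have "expectation Y = \<mu>"
      using 1 by (subst integral_cong_AE[where g = "\<lambda>_. \<mu>"]) (auto simp: prob_space)
    moreover have "expectation (\<lambda>w. (Y w - \<mu>) ^ (2 * k)) = fact (2 * k) / (2 ^ k * fact k) * 0 ^ (2 * k)" for k
      by (subst integral_cong_AE[OF _ _ eq]) (auto simp: prob_space power_0_left)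
    ultimately show thesis using that[of 0 \<mu>] by simp
  next
    case 2
    have int: "integrable M (\<lambda>w. (Y w - \<mu>) ^ k)" for k
      using distributed_integrable[OF 2(2), of "\<lambda>x. (x - \<mu>) ^ k"] integrable_normal_moment[OF 2(1), of \<mu> k]
      by auto
    moreover have "expectation Y = \<mu>" using normal_distributed_expectation[OF 2] by simp
    moreover have "expectation (\<lambda>w. (Y w - \<mu>) ^ (2 * k)) = fact (2 * k) / (2 ^ k * fact k) * \<sigma> ^ (2 * k)" for k
    proof -
      have "expectation (\<lambda>w. (Y w - \<mu>) ^ (2 * k)) = fact (2 * k) / ((2 / \<sigma>\<^sup>2) ^ k * fact k)"
        using distributed_integral[OF 2(2), of "\<lambda>x. (x - \<mu>) ^ (2 * k)"] integral_normal_moment_even[OF 2(1), of \<mu> k]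
        by auto
      then show ?thesis using 2(1) by (simp add: power_divide power_mult)
    qed
    ultimately show thesis using that[of \<sigma> \<mu>] 2(1) by simp
  qed
qed

text \<open>All even moments follow from the second one, which is what the covariance of the process
  determines; the case \<open>k = 1\<close> identifies \<open>\<sigma>\<^sup>2\<close>.\<close>

lemma centered_gaussian_moment:
  assumes "prob_space M" and Y: "gaussian_rv M Y" and "prob_space.expectation M Y = 0"
  shows "integrable M (\<lambda>w. Y w ^ k)"
    "prob_space.expectation M (\<lambda>w. Y w ^ (2 * k))
      = fact (2 * k) / (2 ^ k * fact k) * prob_space.expectation M (\<lambda>w. (Y w)\<^sup>2) ^ k"
proof -
  obtain \<mu> \<sigma> where 0: "0 \<le> \<sigma>" and 1: "\<And>k. integrable M (\<lambda>w. (Y w - \<mu>) ^ k)"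
    "prob_space.expectation M Y = \<mu>"
    "\<And>k. prob_space.expectation M (\<lambda>w. (Y w - \<mu>) ^ (2 * k)) = fact (2 * k) / (2 ^ k * fact k) * \<sigma> ^ (2 * k)"
    by (rule gaussian_rv_moments[OF assms(1) Y]) (rule that; assumption)
  have \<mu>: "\<mu> = 0" using 1(2) assms(3) by simp
  show "integrable M (\<lambda>w. Y w ^ k)" using 1(1)[of k] \<mu> by simp
  have "prob_space.expectation M (\<lambda>w. (Y w)\<^sup>2) = \<sigma>\<^sup>2" using 1(3)[of 1] \<mu> by (simp add: numeral_2_eq_2)
  then show "prob_space.expectation M (\<lambda>w. Y w ^ (2 * k))
      = fact (2 * k) / (2 ^ k * fact k) * prob_space.expectation M (\<lambda>w. (Y w)\<^sup>2) ^ k"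
    using 1(3)[of k] \<mu> by (simp add: power_mult)
qed

lemma fractional_brownian_motion_gaussian:
  assumes "fractional_brownian_motion M H B" and "t \<in> {0..1}"
  shows "gaussian_rv M (B i t)"
proof -
  have "gaussian_process M {0..1} (B i)" using assms by (simp add: fractional_brownian_motion_def)
  from this[unfolded gaussian_process_def, rule_format, of "{t}" "\<lambda>_. 1"] assms(2)
  show ?thesis by simp
qed

text \<open>The increment is centered Gaussian and the covariance gives it the variance
  \<open>\<bar>t - s\<bar> powr (2 * H)\<close>. The high moments are what Kolmogorov's criterion
  consumes.\<close>

lemma fractional_brownian_motion_increment:
  fixes B :: "'n::finite \<Rightarrow> real \<Rightarrow> 'w \<Rightarrow> real"
  assumes B: "fractional_brownian_motion M H B" and st: "s \<in> {0..1}" "t \<in> {0..1}"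
  shows "integrable M (\<lambda>w. (B i t w - B i s w) ^ k)" (is ?A)
    "prob_space.expectation M (\<lambda>w. (B i t w - B i s w) ^ (2 * k))
      = fact (2 * k) / (2 ^ k * fact k) * (\<bar>t - s\<bar> powr (2 * H)) ^ k" (is ?B)
proof -
  interpret prob_space M using B by (simp add: fractional_brownian_motion_def)
  have gp: "gaussian_process M {0..1} (B i)" using B by (simp add: fractional_brownian_motion_def)
  note g1 = fractional_brownian_motion_gaussian[OF B]
  have mean: "expectation (B i u) = 0" if "u \<in> {0..1}" for u
    using B that by (simp add: fractional_brownian_motion_def)
  have cov: "expectation (\<lambda>w. B i u w * B i v w) = fbm_covariance H u v"
    if "u \<in> {0..1}" "v \<in> {0..1}" for u v
    using B that by (simp add: fractional_brownian_motion_def)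
  note m = centered_gaussian_moment(1)[OF prob_space_axioms g1 mean]
  have [measurable]: "B i t \<in> borel_measurable M" "B i s \<in> borel_measurable M"
    using g1 st by (auto simp: gaussian_rv_def)
  have int1: "integrable M (B i u)" if "u \<in> {0..1}" for u using m[of u 1] that by simp
  have int2: "integrable M (\<lambda>w. (B i u w)\<^sup>2)" if "u \<in> {0..1}" for u using m[of u 2] that by simp
  have int11: "integrable M (\<lambda>w. B i t w * B i s w)"
  proof (rule Bochner_Integration.integrable_bound)
    show "integrable M (\<lambda>w. (B i t w)\<^sup>2 + (B i s w)\<^sup>2)" using int2 st by auto
    show "AE w in M. norm (B i t w * B i s w) \<le> norm ((B i t w)\<^sup>2 + (B i s w)\<^sup>2)"
    proof (rule AE_I2)
      fix w
      have "\<bar>a * b\<bar> \<le> a\<^sup>2 + b\<^sup>2" for a b :: real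
        using sum_squares_bound[of a b] sum_squares_bound[of a "-b"] zero_le_power2[of a] zero_le_power2[of b]
        unfolding abs_le_iff power2_minus by linarith
      then show "norm (B i t w * B i s w) \<le> norm ((B i t w)\<^sup>2 + (B i s w)\<^sup>2)" by simp
    qed
  qed simp
  show "?A" "?B"
  proof -
    have g: "gaussian_rv M (\<lambda>w. B i t w - B i s w)"
    \<comment> \<open>For \<open>s = t\<close> the index set \<open>{s, t}\<close> collapses and the
      combination below would be \<open>B i t\<close> instead of the zero increment.\<close>
    proof (cases "s = t")
      case True
      then show ?thesis by (auto simp: gaussian_rv_def)
    next
      case False
      then show ?thesis
        using gp[unfolded gaussian_process_def, rule_format, of "{s, t}" "\<lambda>u. if u = t then 1 else - 1"] st
        by (simp add: algebra_simps)
    qed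
    have e: "expectation (\<lambda>w. B i t w - B i s w) = 0"
      using int1 mean st by simp
    have "(\<lambda>w. (B i t w - B i s w)\<^sup>2) = (\<lambda>w. (B i t w)\<^sup>2 + (B i s w)\<^sup>2 - 2 * (B i t w * B i s w))"
      by (simp add: power2_diff fun_eq_iff)
    then have "expectation (\<lambda>w. (B i t w - B i s w)\<^sup>2)
        = fbm_covariance H t t + fbm_covariance H s s - 2 * fbm_covariance H t s"
      using int2 int11 st cov[of t t] cov[of s s] cov[of t s] by (simp add: power2_eq_square)
    also have "\<dots> = \<bar>t - s\<bar> powr (2 * H)"
      by (simp add: fbm_covariance_def field_simps)
    finally have v: "expectation (\<lambda>w. (B i t w - B i s w)\<^sup>2) = \<bar>t - s\<bar> powr (2 * H)" .
    show ?A by (rule centered_gaussian_moment(1)[OF prob_space_axioms g e])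
    show ?B using centered_gaussian_moment(2)[OF prob_space_axioms g e, of k] v by simp
  qed
qed

text \<open>The first half of Kolmogorov's criterion. Markov's inequality for the moment of order
  \<open>2 * k\<close> bounds the probability that one increment at scale \<open>m\<close> is too
  large; a union bound over the \<open>2 ^ m\<close> increments leaves a summable series, and the
  Borel-Cantelli lemma applies.\<close>

lemma AE_dyadic_increments:
  fixes Y :: "real \<Rightarrow> 'w \<Rightarrow> real"
  assumes "prob_space M"
    and Y [measurable]: "\<And>t. t \<in> {0..1} \<Longrightarrow> Y t \<in> borel_measurable M"
    and int: "\<And>s t. s \<in> {0..1} \<Longrightarrow> t \<in> {0..1} \<Longrightarrow> integrable M (\<lambda>w. (Y t w - Y s w) ^ (2 * k))"
    and mom: "\<And>s t. s \<in> {0..1} \<Longrightarrow> t \<in> {0..1} \<Longrightarrow>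
      prob_space.expectation M (\<lambda>w. (Y t w - Y s w) ^ (2 * k)) = c * (\<bar>t - s\<bar> powr (2 * H)) ^ k"
    and c: "0 \<le> c" and k: "0 < k" "1 < 2 * k * (H - \<beta>)"
  shows "AE w in M. \<exists>C\<ge>0. \<forall>m. \<forall>j<2 ^ m.
    \<bar>Y (real (Suc j) / 2 ^ m) w - Y (real j / 2 ^ m) w\<bar> \<le> C * (1 / 2 ^ m) powr \<beta>"
proof -
  interpret prob_space M by fact
  define D where "D m j w = \<bar>Y (real (Suc j) / 2 ^ m) w - Y (real j / 2 ^ m) w\<bar>" for m j w
  define q where "q m = (1 / 2 ^ m) powr \<beta>" for m :: nat
  have q: "0 < q m" for m by (simp add: q_def)
  have dy: "real j / 2 ^ m \<in> {0..1}" "real (Suc j) / 2 ^ m \<in> {0..1}" if "j < 2 ^ m" for j m :: nat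
  proof -
    have "real (Suc j) \<le> real (2 ^ m)" using that by (subst of_nat_le_iff) simp
    then have "1 + real j \<le> 2 ^ m" by simp
    then show "real j / 2 ^ m \<in> {0..1}" "real (Suc j) / 2 ^ m \<in> {0..1}"
      using that by (simp_all add: divide_le_eq)
  qed
  have Dm [measurable]: "D m j \<in> borel_measurable M" if "j < 2 ^ m" for m j
  proof -
    note [measurable] = Y[OF dy(1)[OF that]] Y[OF dy(2)[OF that]]
    show ?thesis unfolding D_def by measurable
  qed
  define E where "E m j = {w\<in>space M. q m ^ (2 * k) \<le> (D m j w) ^ (2 * k)}" for m j
  have E [measurable]: "E m j \<in> sets M" if "j < 2 ^ m" for m j
    using Dm[OF that] unfolding E_def by measurable
  define A where "A m = (\<Union>j<2 ^ m. E m j)" for m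
  have A: "A m \<in> sets M" for m unfolding A_def using E by auto
  \<comment> \<open>\<open>r / 2 = 2 powr (- (2 * k * (H - \<beta>)))\<close> is the gain per scale
    for a single increment, and the factor 2 accounts for the number of increments doubling from
    scale to scale.\<close>
  define r where "r = 2 powr (1 - 2 * k * (H - \<beta>))"
  have r: "0 < r" "r < 1" using two_powr_less_1[OF k(2)] by (auto simp: r_def)
  have pE: "prob (E m j) \<le> c * (r / 2) ^ m" if j: "j < 2 ^ m" for m j
  proof -
    have "prob {w\<in>space M. q m ^ (2 * k) \<le> (D m j w) ^ (2 * k)}
        \<le> expectation (\<lambda>w. (D m j w) ^ (2 * k)) / q m ^ (2 * k)"
    proof (rule integral_Markov_inequality_measure[where A = "{}"])
      show "integrable M (\<lambda>w. (D m j w) ^ (2 * k))"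
        using int[OF dy[OF j]] by (simp add: D_def power_even_abs)
    qed (use q in auto)
    also have "expectation (\<lambda>w. (D m j w) ^ (2 * k))
        = c * (\<bar>real (Suc j) / 2 ^ m - real j / 2 ^ m\<bar> powr (2 * H)) ^ k"
      using mom[OF dy[OF j]] by (simp add: D_def power_even_abs)
    also have "\<bar>real (Suc j) / 2 ^ m - real j / 2 ^ m\<bar> = 1 / 2 ^ m"
      by (simp add: field_simps)
    also have "c * ((1 / 2 ^ m) powr (2 * H)) ^ k / q m ^ (2 * k)
        = c * ((1 / 2 ^ m) powr (2 * k * H) / (1 / 2 ^ m) powr (2 * k * \<beta>))"
      by (simp add: q_def powr_power mult_ac)
    also have "(1 / 2 ^ m) powr (2 * k * H) / (1 / 2 ^ m) powr (2 * k * \<beta>) = (1 / 2 ^ m) powr (2 * k * (H - \<beta>))"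
      by (simp add: powr_diff right_diff_distrib)
    also have "(1 / 2 ^ m) powr (2 * k * (H - \<beta>)) = (r / 2) ^ m"
    proof -
      have "(1 / 2 ^ m) powr (2 * k * (H - \<beta>)) = (2 powr (- real m)) powr (2 * k * (H - \<beta>))"
        by (simp add: powr_minus powr_realpow inverse_eq_divide)
      also have "\<dots> = (2 powr (- (2 * k * (H - \<beta>)))) powr real m"
        by (simp add: powr_powr mult_ac)
      also have "\<dots> = (2 powr (- (2 * k * (H - \<beta>)))) ^ m" by (simp add: powr_realpow)
      also have "2 powr (- (2 * k * (H - \<beta>))) = r / 2"
        by (simp add: r_def powr_diff powr_minus inverse_eq_divide)
      finally show ?thesis .
    qed
    finally show ?thesis by (simp add: E_def)
  qed
  have pA: "prob (A m) \<le> c * r ^ m" for m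
  proof -
    have "prob (A m) \<le> (\<Sum>j<2 ^ m. prob (E m j))"
      unfolding A_def using E by (intro finite_measure_subadditive_finite) auto
    also have "\<dots> \<le> (\<Sum>j<2 ^ m :: nat. c * (r / 2) ^ m)" using pE by (intro sum_mono) auto
    also have "\<dots> = c * r ^ m" by (simp add: power_divide)
    finally show ?thesis .
  qed
  have "summable (\<lambda>m. prob (A m))"
  proof (rule summable_comparison_test')
    show "summable (\<lambda>m. c * r ^ m)" using r by (intro summable_mult summable_geometric) auto
    show "norm (prob (A m)) \<le> c * r ^ m" if "0 \<le> m" for m using pA[of m] by simp
  qed
  then have "AE w in M. eventually (\<lambda>m. w \<in> space M - A m) sequentially"
    using A by (intro borel_cantelli_AE1) (auto simp: emeasure_eq_measure)
  then show ?thesis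
  proof eventually_elim
    case (elim w)
    then obtain m0 where m0: "\<And>m. m \<ge> m0 \<Longrightarrow> w \<in> space M - A m"
      by (auto simp: eventually_sequentially)
    have late: "D m j w \<le> q m" if "m \<ge> m0" "j < 2 ^ m" for m j
    proof (rule ccontr)
      assume "\<not> D m j w \<le> q m"
      then have "q m ^ (2 * k) \<le> D m j w ^ (2 * k)" using q[of m] by (intro power_mono) auto
      then show False using m0[OF that(1)] that(2) by (auto simp: A_def E_def)
    qed
    \<comment> \<open>Past \<open>m0\<close> the constant 1 works; the finitely many ratios at
      earlier scales are simply added.\<close>
    define C where "C = 1 + (\<Sum>m<m0. \<Sum>j<2 ^ m :: nat. D m j w / q m)"
    have Dq: "0 \<le> D m j w / q m" for m j using q[of m] by (simp add: D_def)
    have C1: "1 \<le> C" unfolding C_def using Dq by (simp add: sum_nonneg)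
    have "D m j w \<le> C * q m" if j: "j < 2 ^ m" for m j
    proof (cases "m < m0")
      case True
      have "D m j w / q m \<le> (\<Sum>j<2 ^ m :: nat. D m j w / q m)"
        using Dq j by (intro member_le_sum) auto
      also have "\<dots> \<le> (\<Sum>m<m0. \<Sum>j<2 ^ m :: nat. D m j w / q m)"
        using Dq True by (intro member_le_sum[where f = "\<lambda>m. \<Sum>j<2 ^ m :: nat. D m j w / q m"]) (auto intro: sum_nonneg)
      also have "\<dots> \<le> C" by (simp add: C_def)
      finally show ?thesis using q[of m] by (simp add: pos_divide_le_eq)
    next
      case False
      then have "D m j w \<le> 1 * q m" using late[of m j] j by simp
      also have "\<dots> \<le> C * q m" using C1 q[of m] by (intro mult_right_mono) auto
      finally show ?thesis .
    qed
    with C1 show ?case unfolding D_def q_def by (intro exI[of _ C]) auto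
  qed
qed

section \<open>From dyadic increments to Hoelder continuous paths\<close>

lemma exists_dyadic_scale:
  fixes d :: real
  assumes "0 < d" "d \<le> 1"
  shows "\<exists>m. 2 ^ m * d \<le> 1 \<and> 1 < 2 ^ Suc m * d"
proof -
  define P where "P m \<longleftrightarrow> 1 < 2 ^ m * d" for m
  have "\<exists>m. P m" using real_arch_pow[of 2 "1 / d"] assms by (auto simp: P_def field_simps)
  moreover have "\<not> P 0" using assms by (simp add: P_def)
  ultimately obtain m where "\<not> P m" "P (Suc m)" by (metis nat.exhaust LeastI_ex Least_le not_less_eq_eq order_refl)
  then show ?thesis by (auto simp: P_def not_less)
qed

text \<open>Chaining: the dyadic approximations of a point from below move by at most one grid step
  at each refinement, so by continuity their increments sum to a geometric series. At the scale
  comparable to \<open>t - s\<close> the approximations of \<open>s\<close> and \<open>t\<close> are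
  equal or adjacent.\<close>

lemma dyadic_increments_imp_holder:
  fixes y :: "real \<Rightarrow> real"
  assumes cont: "continuous_on {0..1} y" and \<beta>: "0 < \<beta>" "\<beta> \<le> 1" and C: "0 \<le> C"
    and dy: "\<And>m j. j < 2 ^ m \<Longrightarrow>
      \<bar>y (real (Suc j) / 2 ^ m) - y (real j / 2 ^ m)\<bar> \<le> C * (1 / 2 ^ m) powr \<beta>"
  shows "\<exists>C'\<ge>0. holder_const \<beta> C' y"
proof -
  define q where "q = 2 powr (- \<beta>)"
  have q: "0 < q" "q < 1" using two_powr_less_1[of "1 + \<beta>"] \<beta> by (auto simp: q_def)
  have qm: "(1 / 2 ^ m) powr \<beta> = q ^ m" for m
  proof -
    have "(1 / 2 ^ m) powr \<beta> = (2 powr (- real m)) powr \<beta>"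
      by (simp add: powr_minus powr_realpow inverse_eq_divide)
    also have "\<dots> = (2 powr (- \<beta>)) powr real m" by (simp add: powr_powr mult_ac)
    finally show ?thesis by (simp add: q_def powr_realpow)
  qed
  define R where "R m s = real (nat \<lfloor>2 ^ m * s\<rfloor>) / 2 ^ m" for m :: nat and s :: real
  have R: "R m s \<le> s" "s < R m s + 1 / 2 ^ m" "0 \<le> R m s" if "0 \<le> s" for m s
  proof -
    have *: "real (nat \<lfloor>2 ^ m * s\<rfloor>) = \<lfloor>2 ^ m * s\<rfloor>" using that by simp
    have "\<lfloor>2 ^ m * s\<rfloor> \<le> 2 ^ m * s" "2 ^ m * s < \<lfloor>2 ^ m * s\<rfloor> + 1" by linarith+
    then show "R m s \<le> s" "s < R m s + 1 / 2 ^ m" "0 \<le> R m s"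
      unfolding R_def * by (auto simp: field_simps that)
  qed
  have adj: "\<bar>y (real j' / 2 ^ m) - y (real j / 2 ^ m)\<bar> \<le> C * q ^ m"
    if "j' = j \<or> j' = Suc j" "real j' \<le> 2 ^ m" for j j' m
  proof (cases "j' = j")
    case True
    then show ?thesis using C q by simp
  next
    case False
    with that have "j' = Suc j" by simp
    with that have "real (Suc j) \<le> real (2 ^ m)" by simp
    then have "j < 2 ^ m" unfolding of_nat_le_iff by simp
    then show ?thesis using dy[of j m] \<open>j' = Suc j\<close> by (simp only: qm)
  qed
  have R1: "real (nat \<lfloor>2 ^ m * s\<rfloor>) \<le> 2 ^ m" if "0 \<le> s" "s \<le> 1" for m and s :: real
  proof -
    have "real (nat \<lfloor>2 ^ m * s\<rfloor>) \<le> 2 ^ m * s" using that by simp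
    also have "\<dots> \<le> 2 ^ m" using that by simp
    finally show ?thesis .
  qed
  have refine: "\<bar>y (R (Suc m) s) - y (R m s)\<bar> \<le> C * q ^ Suc m" if s: "0 \<le> s" "s \<le> 1" for m s
  proof -
    define x where "x = 2 ^ m * s"
    have x: "0 \<le> x" using s by (simp add: x_def)
    \<comment> \<open>Refining the grid keeps the rounded point or moves it by one step of the finer
      grid.\<close>
    have "\<lfloor>2 * x\<rfloor> = 2 * \<lfloor>x\<rfloor> \<or> \<lfloor>2 * x\<rfloor> = 2 * \<lfloor>x\<rfloor> + 1" by linarith
    then have "nat \<lfloor>2 * x\<rfloor> = 2 * nat \<lfloor>x\<rfloor> \<or> nat \<lfloor>2 * x\<rfloor> = Suc (2 * nat \<lfloor>x\<rfloor>)"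
      using x by (auto simp: nat_add_distrib nat_mult_distrib)
    moreover have "real (nat \<lfloor>2 * x\<rfloor>) \<le> 2 ^ Suc m" using R1[OF s, of "Suc m"] by (simp add: x_def mult_ac)
    ultimately have "\<bar>y (real (nat \<lfloor>2 * x\<rfloor>) / 2 ^ Suc m) - y (real (2 * nat \<lfloor>x\<rfloor>) / 2 ^ Suc m)\<bar> \<le> C * q ^ Suc m"
      by (intro adj)
    moreover have "real (2 * nat \<lfloor>x\<rfloor>) / 2 ^ Suc m = R m s" by (simp add: R_def x_def)
    moreover have "real (nat \<lfloor>2 * x\<rfloor>) / 2 ^ Suc m = R (Suc m) s" by (simp add: R_def x_def mult_ac)
    ultimately show ?thesis by simp
  qed
  have tele: "\<bar>y (R (m + p) s) - y (R m s)\<bar> \<le> C / (1 - q) * (q ^ m - q ^ (m + p))"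
    if s: "0 \<le> s" "s \<le> 1" for m p s
  proof (induction p)
    case (Suc p)
    have "\<bar>y (R (m + Suc p) s) - y (R m s)\<bar>
        \<le> \<bar>y (R (Suc (m + p)) s) - y (R (m + p) s)\<bar> + \<bar>y (R (m + p) s) - y (R m s)\<bar>" by simp
    also have "\<dots> \<le> C * q ^ Suc (m + p) + C / (1 - q) * (q ^ m - q ^ (m + p))"
      using refine[OF s, of "m + p"] Suc.IH by (rule add_mono)
    also have "\<dots> \<le> C * q ^ (m + p) + C / (1 - q) * (q ^ m - q ^ (m + p))"
      using C q by (auto intro!: mult_left_mono mult_left_le_one_le)
    also have "\<dots> = C / (1 - q) * (q ^ m - q ^ (m + Suc p))"
      using q by (simp add: field_simps)
    finally show ?case .
  qed simp
  have lim: "\<bar>y s - y (R m s)\<bar> \<le> C / (1 - q) * q ^ m" if s: "0 \<le> s" "s \<le> 1" for m s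
  proof -
    have "(\<lambda>p. R (m + p) s) \<longlonglongrightarrow> s"
    proof (rule tendsto_sandwich)
      have "(\<lambda>p. s - (1 / 2) ^ (m + p)) \<longlonglongrightarrow> s - 0"
        by (intro tendsto_diff tendsto_const) (simp add: power_add tendsto_mult_right_zero LIMSEQ_realpow_zero)
      then show "(\<lambda>p. s - (1 / 2) ^ (m + p)) \<longlonglongrightarrow> s" by simp
      show "\<forall>\<^sub>F p in sequentially. s - (1 / 2) ^ (m + p) \<le> R (m + p) s"
        using R(2)[OF s(1)] by (auto simp: power_one_over less_eq_real_def algebra_simps)
    qed (use R(1)[OF s(1)] in auto)
    moreover have "R m s \<le> 1" for m using R(1)[OF s(1), of m] s(2) by linarith
    ultimately have "(\<lambda>p. y (R (m + p) s)) \<longlonglongrightarrow> y s"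
      using s R(3)[OF s(1)] by (intro continuous_on_tendsto_compose[OF cont]) (auto intro: order_trans)
    then have "(\<lambda>p. \<bar>y (R (m + p) s) - y (R m s)\<bar>) \<longlonglongrightarrow> \<bar>y s - y (R m s)\<bar>"
      by (intro tendsto_intros)
    moreover have "\<bar>y (R (m + p) s) - y (R m s)\<bar> \<le> C / (1 - q) * q ^ m" for p
      using q C by (intro order_trans[OF tele[OF s]] mult_left_mono) auto
    ultimately show ?thesis by (intro LIMSEQ_le_const2) auto
  qed
  \<comment> \<open>The summand 1 is the step between the two approximations,
    \<open>2 / (1 - q)\<close> the two chains down to \<open>s\<close> and \<open>t\<close>, and the
    factor 2 replaces \<open>2 powr \<beta>\<close> when \<open>q ^ m\<close> is compared with
    \<open>(2 * d) powr \<beta>\<close>.\<close>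
  define C' where "C' = C * (1 + 2 / (1 - q)) * 2"
  have C': "0 \<le> C'" using C q by (simp add: C'_def)
  have "\<bar>y t - y s\<bar> \<le> C' * (t - s) powr \<beta>" if st: "0 \<le> s" "s \<le> t" "t \<le> 1" for s t
  proof (cases "s = t")
    case False
    define d where "d = t - s"
    have d: "0 < d" "d \<le> 1" using False st by (auto simp: d_def)
    obtain m where m: "2 ^ m * d \<le> 1" "1 < 2 ^ Suc m * d" using exists_dyadic_scale[OF d] by blast
    have "2 ^ m * s \<le> 2 ^ m * t" using st by simp
    moreover have "2 ^ m * t \<le> 2 ^ m * s + 1" using m(1) by (simp add: d_def algebra_simps)
    ultimately have "\<lfloor>2 ^ m * t\<rfloor> = \<lfloor>2 ^ m * s\<rfloor> \<or> \<lfloor>2 ^ m * t\<rfloor> = \<lfloor>2 ^ m * s\<rfloor> + 1" by linarith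
    then have "nat \<lfloor>2 ^ m * t\<rfloor> = nat \<lfloor>2 ^ m * s\<rfloor> \<or> nat \<lfloor>2 ^ m * t\<rfloor> = Suc (nat \<lfloor>2 ^ m * s\<rfloor>)"
      using st by (auto simp: nat_add_distrib)
    then have "\<bar>y (R m t) - y (R m s)\<bar> \<le> C * q ^ m"
      unfolding R_def using st by (intro adj R1) auto
    then have "\<bar>y t - y s\<bar> \<le> C * q ^ m + C / (1 - q) * q ^ m + C / (1 - q) * q ^ m"
      using lim[of t m] lim[of s m] st by linarith
    also have "\<dots> = C * (1 + 2 / (1 - q)) * q ^ m" by (simp add: algebra_simps)
    also have "\<dots> \<le> C * (1 + 2 / (1 - q)) * (2 * d powr \<beta>)"
    proof (intro mult_left_mono)
      have "q ^ m \<le> (2 * d) powr \<beta>"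
        unfolding qm[symmetric] using m(2) d \<beta> by (intro powr_mono2) (auto simp: field_simps)
      also have "\<dots> = 2 powr \<beta> * d powr \<beta>" using d by (simp add: powr_mult)
      also have "\<dots> \<le> 2 powr 1 * d powr \<beta>" using \<beta> by (intro mult_right_mono powr_mono) auto
      finally show "q ^ m \<le> 2 * d powr \<beta>" by simp
    qed (use C q in auto)
    finally show ?thesis by (simp only: C'_def d_def mult.assoc)
  qed (use st in auto)
  then show ?thesis using C' by (auto simp: holder_const_def)
qed

text \<open>Moments of order \<open>2 * k\<close> yield every Hoelder exponent below
  \<open>H - 1 / (2 * k)\<close>. Gaussian increments have all moments, so \<open>k\<close> can be
  taken large enough to reach \<open>\<beta>\<close>.\<close>

proposition AE_fractional_brownian_motion_holder:
  fixes B :: "'n::finite \<Rightarrow> real \<Rightarrow> 'w \<Rightarrow> real"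
  assumes B: "fractional_brownian_motion M H B" and \<beta>: "0 < \<beta>" "\<beta> < H" "H < 1"
  shows "AE w in M. \<exists>G\<ge>0. \<forall>i. holder_const \<beta> G (\<lambda>t. B i t w)"
proof -
  interpret prob_space M using B by (simp add: fractional_brownian_motion_def)
  have one: "AE w in M. \<exists>G\<ge>0. holder_const \<beta> G (\<lambda>t. B i t w)" for i
  proof -
    obtain k :: nat where k: "1 / (2 * (H - \<beta>)) < real k" using reals_Archimedean2 by blast
    have k0: "0 < k" using k \<beta> by (cases k) (auto simp: field_simps)
    have k1: "1 < 2 * k * (H - \<beta>)" using k \<beta> by (simp add: field_simps)
    have meas: "B i t \<in> borel_measurable M" if "t \<in> {0..1}" for t
      using fractional_brownian_motion_gaussian[OF B that] by (simp add: gaussian_rv_def)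
    have "AE w in M. \<exists>C\<ge>0. \<forall>m. \<forall>j<2 ^ m.
      \<bar>B i (real (Suc j) / 2 ^ m) w - B i (real j / 2 ^ m) w\<bar> \<le> C * (1 / 2 ^ m) powr \<beta>"
      by (rule AE_dyadic_increments[OF prob_space_axioms meas
            fractional_brownian_motion_increment(1)[OF B]
            fractional_brownian_motion_increment(2)[OF B] _ k0 k1]) auto
    with AE_space show ?thesis
    proof eventually_elim
      case (elim w)
      have "continuous_on {0..1} (\<lambda>t. B i t w)"
        using B elim(1) by (simp add: fractional_brownian_motion_def)
      with elim(2) \<beta> show ?case
        using dyadic_increments_imp_holder[of "\<lambda>t. B i t w" \<beta>] by auto
    qed
  qed
  then have "AE w in M. \<forall>i. \<exists>G\<ge>0. holder_const \<beta> G (\<lambda>t. B i t w)"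
    by (subst AE_all_countable) auto
  then show ?thesis
  proof eventually_elim
    case (elim w)
    then obtain G where G: "\<And>i. 0 \<le> G i" "\<And>i. holder_const \<beta> (G i) (\<lambda>t. B i t w)" by metis
    have "G i \<le> sum G UNIV" for i using G(1) by (intro member_le_sum) auto
    then show ?case using G by (intro exI[of _ "sum G UNIV"]) (auto intro: sum_nonneg holder_const_mono)
  qed
qed

section \<open>Taylor estimates for smooth vector fields\<close>

text \<open>The norm of the type \<open>real ^ 'n ^ 'm\<close> is the Frobenius norm, so this is the
  Cauchy-Schwarz inequality row by row.\<close>

lemma norm_matrix_vector_mult_le:
  fixes A :: "real ^ 'n ^ 'm" and x :: "real ^ 'n"
  shows "norm (A *v x) \<le> norm A * norm x"
proof -
  have "norm (A *v x) = L2_set (\<lambda>i. \<bar>A $ i \<bullet> x\<bar>) UNIV"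
    by (simp add: norm_vec_def matrix_vector_mult_def inner_vec_def)
  also have "\<dots> \<le> L2_set (\<lambda>i. norm (A $ i) * norm x) UNIV"
    by (intro L2_set_mono) (auto simp: Cauchy_Schwarz_ineq2)
  also have "\<dots> = norm A * norm x"
    by (simp add: L2_set_left_distrib norm_vec_def)
  finally show ?thesis .
qed

text \<open>Partial derivatives are the columns of the Jacobian; this passes their bounds on to the
  matrix.\<close>

lemma norm_matrix_le_columns:
  fixes A :: "real ^ 'n ^ 'm"
  shows "norm A \<le> CARD('m) * (\<Sum>j\<in>UNIV. norm (column j A))"
proof -
  have "norm A \<le> (\<Sum>i\<in>UNIV. norm (A $ i))"
    by (simp add: norm_vec_def L2_set_le_sum)
  also have "\<dots> \<le> (\<Sum>i\<in>(UNIV :: 'm set). \<Sum>j\<in>UNIV. norm (column j A))"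
  proof (intro sum_mono)
    fix i
    have "norm (A $ i) \<le> (\<Sum>j\<in>UNIV. \<bar>A $ i $ j\<bar>)" by (rule norm_le_l1_cart)
    also have "\<dots> \<le> (\<Sum>j\<in>UNIV. norm (column j A))"
    proof (intro sum_mono)
      fix j show "\<bar>A $ i $ j\<bar> \<le> norm (column j A)"
        using component_le_norm_cart[of "column j A" i] by (simp add: column_def)
    qed
    finally show "norm (A $ i) \<le> (\<Sum>j\<in>UNIV. norm (column j A))" .
  qed
  finally show ?thesis by simp
qed

lemma iterated_partial_append:
  "iterated_partial (is @ js) f = iterated_partial is (iterated_partial js f)"
  by (induction "is") auto

lemma smooth_bounded_partial:
  assumes "smooth_bounded f"
  shows "smooth_bounded (iterated_partial js f)"
  using assms unfolding smooth_bounded_def by (simp flip: iterated_partial_append)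

lemma smooth_bounded_has_derivative:
  assumes "smooth_bounded f"
  shows "(f has_derivative (\<lambda>v. \<Sum>j\<in>UNIV. v $ j *\<^sub>R iterated_partial [j] f p)) (at p)"
proof -
  have "f differentiable (at p)"
    using assms unfolding smooth_bounded_def by (metis iterated_partial.simps(1))
  then have D: "(f has_derivative frechet_derivative f (at p)) (at p)"
    by (simp add: frechet_derivative_works)
  then interpret linear "frechet_derivative f (at p)" by (rule has_derivative_linear)
  have "frechet_derivative f (at p) v = (\<Sum>j\<in>UNIV. v $ j *\<^sub>R iterated_partial [j] f p)" for v
  proof -
    have "frechet_derivative f (at p) v = frechet_derivative f (at p) (\<Sum>j\<in>UNIV. v $ j *\<^sub>R axis j 1)"
      using basis_expansion[of v] by (simp add: scalar_mult_eq_scaleR)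
    then show ?thesis by (simp add: sum scale)
  qed
  then show ?thesis using D by (metis (no_types, lifting) ext)
qed

lemma smooth_bounded_continuous:
  assumes "smooth_bounded h"
  shows "continuous_on UNIV h"
  by (intro continuous_at_imp_continuous_on ballI has_derivative_continuous[OF smooth_bounded_has_derivative[OF assms]])

lemma smooth_bounded_bound:
  assumes "smooth_bounded f"
  obtains K where "0 < K" "\<And>p. norm (f p) \<le> K"
proof -
  have "bounded (range f)"
    using assms unfolding smooth_bounded_def by (metis iterated_partial.simps(1))
  then show thesis using that unfolding bounded_pos by auto
qed

lemma smooth_bounded_partial_bound:
  fixes f :: "real ^ 'n::finite \<Rightarrow> 'b::real_normed_vector"
  assumes "smooth_bounded f"
  obtains K where "0 < K" "\<And>j p. norm (iterated_partial [j] f p) \<le> K"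
proof -
  have "\<exists>K>0. \<forall>p. norm (iterated_partial [j] f p) \<le> K" for j
    by (rule smooth_bounded_bound[OF smooth_bounded_partial[OF assms, of "[j]"]]) blast
  then obtain K where K: "\<And>j. 0 < K j" "\<And>j p. norm (iterated_partial [j] f p) \<le> K j" by metis
  have "K j \<le> sum K UNIV" for j using K(1) by (intro member_le_sum) (auto intro: less_imp_le)
  then show thesis
    by (intro that[of "sum K UNIV"] order_trans[OF K(2)] sum_pos) (auto simp: K(1))
qed

text \<open>The set \<open>S\<close> and the partials \<open>P\<close> are kept general for three
  uses: a function itself, the difference \<open>f (p + u) - f p\<close>, and \<open>f\<close> minus
  its linear part on a ball, where the partials are small.\<close>

lemma lipschitz_of_partials:
  fixes f :: "real ^ 'n::finite \<Rightarrow> 'b::real_normed_vector" and B :: real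
  assumes S: "convex S" "p \<in> S" "q \<in> S"
    and f: "\<And>p. (f has_derivative (\<lambda>v. \<Sum>j\<in>UNIV. v $ j *\<^sub>R P j p)) (at p)"
    and P: "\<And>j p. p \<in> S \<Longrightarrow> norm (P j p) \<le> B"
  shows "norm (f p - f q) \<le> CARD('n) * B * norm (p - q)"
proof (rule differentiable_bound[OF S(1) _ _ S(2,3)])
  show "(f has_derivative (\<lambda>v. \<Sum>j\<in>UNIV. v $ j *\<^sub>R P j x)) (at x within S)" for x
    using f by (rule has_derivative_at_withinI)
  show "onorm (\<lambda>v. \<Sum>j\<in>UNIV. v $ j *\<^sub>R P j x) \<le> CARD('n) * B" if x: "x \<in> S" for x
  proof (rule onorm_le)
    fix v :: "real ^ 'n"
    have "norm (\<Sum>j\<in>UNIV. v $ j *\<^sub>R P j x) \<le> (\<Sum>j\<in>UNIV. norm (v $ j *\<^sub>R P j x))" by (rule norm_sum)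
    also have "\<dots> \<le> (\<Sum>j\<in>(UNIV :: 'n set). norm v * B)"
      using P[OF x] component_le_norm_cart[of v] by (intro sum_mono) (auto intro!: mult_mono)
    finally show "norm (\<Sum>j\<in>UNIV. v $ j *\<^sub>R P j x) \<le> CARD('n) * B * norm v" by (simp add: mult_ac)
  qed
qed

lemma smooth_bounded_lipschitz:
  fixes f :: "real ^ 'n::finite \<Rightarrow> 'b::real_normed_vector"
  assumes f: "smooth_bounded f"
  obtains K where "0 < K" "\<And>p q. norm (f p - f q) \<le> K * norm (p - q)"
proof -
  obtain K where K: "0 < K" "\<And>j p. norm (iterated_partial [j] f p) \<le> K"
    by (rule smooth_bounded_partial_bound[OF f]) (rule that; assumption)
  show thesis
    by (rule that[of "CARD('n) * K"])
      (use K lipschitz_of_partials[OF convex_UNIV UNIV_I UNIV_I smooth_bounded_has_derivative[OF f] K(2)] in auto)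
qed

text \<open>The map from \<open>p\<close> to \<open>f (p + u) - f p\<close> has partial derivatives
  of size at most a multiple of \<open>norm u\<close>, hence this Lipschitz constant.\<close>

lemma smooth_bounded_four_point:
  fixes f :: "real ^ 'n::finite \<Rightarrow> 'b::real_normed_vector"
  assumes f: "smooth_bounded f"
  obtains K where "0 < K" "\<And>p q u. norm (f (p + u) - f p - (f (q + u) - f q)) \<le> K * norm u * norm (p - q)"
proof -
  have "\<exists>K>0. \<forall>p q. norm (iterated_partial [j] f p - iterated_partial [j] f q) \<le> K * norm (p - q)" for j
    by (rule smooth_bounded_lipschitz[OF smooth_bounded_partial[OF f, of "[j]"]]) blast
  then obtain K where K: "\<And>j. 0 < K j"
    "\<And>j p q. norm (iterated_partial [j] f p - iterated_partial [j] f q) \<le> K j * norm (p - q)" by metis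
  have le: "K j \<le> sum K UNIV" for j using K(1) by (intro member_le_sum) (auto intro: less_imp_le)
  show thesis
  proof (rule that[of "CARD('n) * sum K UNIV"])
    fix p q u :: "real ^ 'n"
    have "norm (f (p + u) - f p - (f (q + u) - f q)) \<le> CARD('n) * (sum K UNIV * norm u) * norm (p - q)"
    proof (rule lipschitz_of_partials[OF convex_UNIV UNIV_I UNIV_I, where f = "\<lambda>p. f (p + u) - f p" and
          P = "\<lambda>j p. iterated_partial [j] f (p + u) - iterated_partial [j] f p"])
      fix p
      have "((\<lambda>p. f (p + u)) has_derivative (\<lambda>v. \<Sum>j\<in>UNIV. v $ j *\<^sub>R iterated_partial [j] f (p + u))) (at p)"
        by (rule has_derivative_compose[OF _ smooth_bounded_has_derivative[OF f]])
          (auto intro!: derivative_eq_intros)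
      from has_derivative_diff[OF this smooth_bounded_has_derivative[OF f]]
      show "((\<lambda>p. f (p + u) - f p) has_derivative
          (\<lambda>v. \<Sum>j\<in>UNIV. v $ j *\<^sub>R (iterated_partial [j] f (p + u) - iterated_partial [j] f p))) (at p)"
        by (simp add: sum_subtractf scaleR_diff_right)
      show "norm (iterated_partial [j] f (p + u) - iterated_partial [j] f p) \<le> sum K UNIV * norm u" for j
        using K(2)[of j "p + u" p] mult_right_mono[OF le[of j], of "norm u"] by simp
    qed
    then show "norm (f (p + u) - f p - (f (q + u) - f q)) \<le> CARD('n) * sum K UNIV * norm u * norm (p - q)"
      by (simp add: mult_ac)
  qed (use K in \<open>auto intro!: mult_pos_pos sum_pos\<close>)
qed

text \<open>After subtraction of the linear part at \<open>p\<close> the partials are at most a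
  multiple of \<open>norm (q - p)\<close> on the ball around \<open>p\<close> through
  \<open>q\<close>; the mean value theorem supplies the second factor.\<close>

lemma smooth_bounded_taylor:
  fixes f :: "real ^ 'n::finite \<Rightarrow> 'b::real_normed_vector"
  assumes f: "smooth_bounded f"
  obtains L where "0 < L"
    "\<And>p q. norm (f q - f p - (\<Sum>j\<in>UNIV. (q - p) $ j *\<^sub>R iterated_partial [j] f p)) \<le> L * (norm (q - p))\<^sup>2"
proof -
  have "\<exists>K>0. \<forall>p q. norm (iterated_partial [j] f p - iterated_partial [j] f q) \<le> K * norm (p - q)" for j
    by (rule smooth_bounded_lipschitz[OF smooth_bounded_partial[OF f, of "[j]"]]) blast
  then obtain K where K: "\<And>j. 0 < K j"
    "\<And>j p q. norm (iterated_partial [j] f p - iterated_partial [j] f q) \<le> K j * norm (p - q)" by metis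
  have le: "K j \<le> sum K UNIV" for j using K(1) by (intro member_le_sum) (auto intro: less_imp_le)
  show thesis
  proof (rule that[of "CARD('n) * sum K UNIV"])
    fix p q :: "real ^ 'n"
    let ?P = "\<lambda>j. iterated_partial [j] f"
    let ?f = "\<lambda>x. f x - (\<Sum>j\<in>UNIV. x $ j *\<^sub>R ?P j p)"
    have bound: "norm (?f q - ?f p) \<le> CARD('n) * (sum K UNIV * norm (q - p)) * norm (q - p)"
    proof (rule lipschitz_of_partials[where S = "cball p (norm (q - p))" and P = "\<lambda>j x. ?P j x - ?P j p"])
      fix x
      have "((\<lambda>x. \<Sum>j\<in>UNIV. x $ j *\<^sub>R ?P j p) has_derivative (\<lambda>v. \<Sum>j\<in>UNIV. v $ j *\<^sub>R ?P j p)) (at x)"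
        by (intro has_derivative_sum has_derivative_scaleR_left bounded_linear_imp_has_derivative bounded_linear_vec_nth)
      from has_derivative_diff[OF smooth_bounded_has_derivative[OF f] this]
      show "(?f has_derivative (\<lambda>v. \<Sum>j\<in>UNIV. v $ j *\<^sub>R (?P j x - ?P j p))) (at x)"
        by (simp add: scaleR_diff_right sum_subtractf)
    next
      fix j x assume "x \<in> cball p (norm (q - p))"
      then have x: "norm (x - p) \<le> norm (q - p)" by (simp add: dist_norm norm_minus_commute)
      have "norm (?P j x - ?P j p) \<le> K j * norm (x - p)" by (rule K(2))
      also have "\<dots> \<le> sum K UNIV * norm (q - p)"
        using x le[of j] less_imp_le[OF K(1)] by (intro mult_mono sum_nonneg) auto
      finally show "norm (?P j x - ?P j p) \<le> sum K UNIV * norm (q - p)" .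
    qed (auto simp: dist_norm norm_minus_commute)
    have eq: "?f q - ?f p = f q - f p - (\<Sum>j\<in>UNIV. (q - p) $ j *\<^sub>R ?P j p)"
      by (simp add: scaleR_diff_left sum_subtractf)
    show "norm (f q - f p - (\<Sum>j\<in>UNIV. (q - p) $ j *\<^sub>R ?P j p)) \<le> CARD('n) * sum K UNIV * (norm (q - p))\<^sup>2"
      using bound unfolding eq by (simp only: power2_eq_square mult.assoc)
  qed (use K in \<open>auto intro!: mult_pos_pos sum_pos\<close>)
qed

text \<open>With \<open>A\<close> the Jacobian of \<open>V\<close>, the last three conditions encode
  bounds for the first, second and third derivatives. Differences of \<open>A\<close> replace the
  higher derivatives, so that no tensors of higher order are needed.\<close>

definition taylor_bounds ::
    "real \<Rightarrow> (real ^ 'n::finite \<Rightarrow> real ^ 'n) \<Rightarrow> (real ^ 'n \<Rightarrow> real ^ 'n ^ 'n) \<Rightarrow> bool" where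
  "taylor_bounds K V A \<longleftrightarrow> 0 \<le> K \<and> (\<forall>p. norm (V p) \<le> K) \<and>
     (\<forall>p. (V has_derivative (\<lambda>v. A p *v v)) (at p)) \<and> (\<forall>p. norm (A p) \<le> K) \<and>
     (\<forall>p q. norm (A p - A q) \<le> K * norm (p - q)) \<and>
     (\<forall>p q u. norm (A (p + u) - A p - (A (q + u) - A q)) \<le> K * norm u * norm (p - q))"

lemma taylor_bounds_mono:
  assumes V: "taylor_bounds K V A" and "K \<le> K'"
  shows "taylor_bounds K' V A"
proof -
  have "K * norm x \<le> K' * norm x" "K * norm x * norm y \<le> K' * norm x * norm y" for x y :: "real ^ 'n"
    using assms(2) by (auto intro!: mult_right_mono)
  then show ?thesis using assms unfolding taylor_bounds_def by (meson order_trans)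
qed

lemma smooth_bounded_taylor_bounds:
  fixes V :: "real ^ 'n::finite \<Rightarrow> real ^ 'n"
  assumes V: "smooth_bounded V"
  obtains K where "taylor_bounds K V (\<lambda>p. matrix (frechet_derivative V (at p)))"
proof -
  define A where "A = (\<lambda>p. matrix (frechet_derivative V (at p)))"
  have D: "(V has_derivative frechet_derivative V (at p)) (at p)" for p
    using smooth_bounded_has_derivative[OF V, of p] frechet_derivative_works differentiable_def by blast
  have A: "(V has_derivative (\<lambda>v. A p *v v)) (at p)" for p
    using D[of p] matrix_vector_mul(2)[OF has_derivative_linear[OF D[of p]]] by (simp add: A_def)
  have col: "column j (A p) = iterated_partial [j] V p" for j p
    by (simp add: A_def column_def matrix_def vec_eq_iff)
  have colp: "column j (A p + A q) = column j (A p) + column j (A q)"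
    "column j (A p - A q) = column j (A p) - column j (A q)" 
    "column j (A p - A q - (A r - A s)) = column j (A p) - column j (A q) - (column j (A r) - column j (A s))" for j p q r s
    by (simp_all add: column_def vec_eq_iff)
  define n where "n = real (CARD('n))"
  have n: "1 \<le> n" by (simp add: n_def Suc_le_eq)
  \<comment> \<open>One factor \<open>n\<close> comes from \<open>norm_matrix_le_columns\<close>,
    the other from the number of columns.\<close>
  have mat: "norm M \<le> n * n * C" if "\<And>j. norm (column j M) \<le> C" for M :: "real ^ 'n ^ 'n" and C
  proof -
    have "norm M \<le> n * (\<Sum>j\<in>UNIV. norm (column j M))" unfolding n_def by (rule norm_matrix_le_columns)
    also have "\<dots> \<le> n * (\<Sum>j\<in>(UNIV :: 'n set). C)" using that n by (intro mult_left_mono sum_mono) auto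
    finally show ?thesis by (simp add: n_def)
  qed
  obtain K0 where K0: "0 < K0" "\<And>p. norm (V p) \<le> K0"
    by (rule smooth_bounded_bound[OF V]) (rule that; assumption)
  obtain K1 where K1: "0 < K1" "\<And>j p. norm (iterated_partial [j] V p) \<le> K1"
    by (rule smooth_bounded_partial_bound[OF V]) (rule that; assumption)
  have "\<exists>K>0. \<forall>p q. norm (iterated_partial [j] V p - iterated_partial [j] V q) \<le> K * norm (p - q)" for j
    by (rule smooth_bounded_lipschitz[OF smooth_bounded_partial[OF V, of "[j]"]]) blast
  then obtain K2 where K2: "\<And>j. 0 < K2 j"
    "\<And>j p q. norm (iterated_partial [j] V p - iterated_partial [j] V q) \<le> K2 j * norm (p - q)" by metis
  have "\<exists>K>0. \<forall>p q u. norm (iterated_partial [j] V (p + u) - iterated_partial [j] V p -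
      (iterated_partial [j] V (q + u) - iterated_partial [j] V q)) \<le> K * norm u * norm (p - q)" for j
    by (rule smooth_bounded_four_point[OF smooth_bounded_partial[OF V, of "[j]"]]) blast
  then obtain K3 where K3: "\<And>j. 0 < K3 j"
    "\<And>j p q u. norm (iterated_partial [j] V (p + u) - iterated_partial [j] V p -
      (iterated_partial [j] V (q + u) - iterated_partial [j] V q)) \<le> K3 j * norm u * norm (p - q)" by metis
  define L where "L = K0 + K1 + sum K2 UNIV + sum K3 UNIV"
  have s: "0 \<le> sum K2 UNIV" "0 \<le> sum K3 UNIV"
    using less_imp_le[OF K2(1)] less_imp_le[OF K3(1)] by (auto intro!: sum_nonneg)
  have s2: "K2 j \<le> sum K2 UNIV" for j using K2(1) by (intro member_le_sum) (auto intro: less_imp_le)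
  have s3: "K3 j \<le> sum K3 UNIV" for j using K3(1) by (intro member_le_sum) (auto intro: less_imp_le)
  have L: "0 \<le> L" "K0 \<le> L" "K1 \<le> L" "K2 j \<le> L" "K3 j \<le> L" for j
    using K0(1) K1(1) s s2[of j] s3[of j] unfolding L_def by linarith+
  have "L \<le> n * n * L" using n L mult_mono[of 1 n 1 n] mult_right_mono[of 1 "n * n" L] by simp
  have "taylor_bounds (n * n * L) V A"
    unfolding taylor_bounds_def
  proof (intro conjI allI)
    show "0 \<le> n * n * L" using n L by simp
    show "norm (V p) \<le> n * n * L" for p using K0(2)[of p] L \<open>L \<le> n * n * L\<close> by linarith
    show "(V has_derivative (\<lambda>v. A p *v v)) (at p)" for p by (rule A)
    show "norm (A p) \<le> n * n * L" for p
      using K1(2)[of _ p] L by (intro mat) (auto simp: col intro: order_trans)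
    show "norm (A p - A q) \<le> n * n * L * norm (p - q)" for p q
    proof -
      have "norm (A p - A q) \<le> n * n * (L * norm (p - q))"
        using K2(2)[of _ p q] mult_right_mono[OF L(4), of "norm (p - q)"]
        by (intro mat) (auto simp: col colp intro: order_trans)
      then show ?thesis by (simp add: mult_ac)
    qed
    show "norm (A (p + u) - A p - (A (q + u) - A q)) \<le> n * n * L * norm u * norm (p - q)" for p q u
    proof -
      have "norm (A (p + u) - A p - (A (q + u) - A q)) \<le> n * n * (L * norm u * norm (p - q))"
      proof (intro mat)
        fix j
        have "norm (column j (A (p + u) - A p - (A (q + u) - A q))) \<le> K3 j * norm u * norm (p - q)"
          unfolding colp col by (rule K3(2))
        also have "\<dots> \<le> L * norm u * norm (p - q)" using L(5) by (intro mult_right_mono) auto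
        finally show "norm (column j (A (p + u) - A p - (A (q + u) - A q))) \<le> L * norm u * norm (p - q)" .
      qed
      then show ?thesis by (simp add: mult_ac)
    qed
  qed
  then show thesis using that by (simp add: A_def)
qed

lemma smooth_bounded_family_taylor_bounds:
  fixes V :: "'i::finite \<Rightarrow> real ^ 'n::finite \<Rightarrow> real ^ 'n"
  assumes V: "\<And>i. smooth_bounded (V i)"
  obtains K where "\<And>i. taylor_bounds K (V i) (\<lambda>p. matrix (frechet_derivative (V i) (at p)))"
proof -
  have "\<exists>K. taylor_bounds K (V i) (\<lambda>p. matrix (frechet_derivative (V i) (at p)))" for i
    by (rule smooth_bounded_taylor_bounds[OF V[of i]]) (rule exI)
  then obtain K where K: "\<And>i. taylor_bounds (K i) (V i) (\<lambda>p. matrix (frechet_derivative (V i) (at p)))"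
    using choice[of "\<lambda>i K. taylor_bounds K (V i) (\<lambda>p. matrix (frechet_derivative (V i) (at p)))"] by auto
  have "0 \<le> K i" for i using K[of i] by (simp add: taylor_bounds_def)
  then have "K i \<le> sum K UNIV" for i by (intro member_le_sum) auto
  then show thesis by (intro that[of "sum K UNIV"] taylor_bounds_mono[OF K])
qed

text \<open>A centred ball is used because the derivative of a Taylor remainder is small only near
  the origin.\<close>

lemma mean_value_cball:
  fixes \<Phi> :: "real ^ 'n \<Rightarrow> real ^ 'n"
  assumes "\<And>x. (\<Phi> has_derivative (\<lambda>v. A x *v v)) (at x)"
    and "\<And>x. norm x \<le> r \<Longrightarrow> norm (A x) \<le> B" and "norm p \<le> r" "norm q \<le> r"
  shows "norm (\<Phi> p - \<Phi> q) \<le> B * norm (p - q)"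
proof (rule differentiable_bound[of "cball 0 r"])
  show "(\<Phi> has_derivative (\<lambda>v. A x *v v)) (at x within cball 0 r)" for x
    using assms(1) by (rule has_derivative_at_withinI)
  show "onorm (\<lambda>v. A x *v v) \<le> B" if "x \<in> cball 0 r" for x
    using assms(2)[of x] that
    by (intro onorm_le order_trans[OF norm_matrix_vector_mult_le]) (auto intro: mult_right_mono)
qed (use assms in auto)

section \<open>Increments of a vector field and of its Taylor remainder\<close>

context
  fixes K :: real and V :: "real ^ 'n::finite \<Rightarrow> real ^ 'n" and A
  assumes tb: "taylor_bounds K V A"
begin

lemma taylor_nonneg: "0 \<le> K"
  and taylor_norm: "norm (V p) \<le> K"
  and taylor_derivative: "(V has_derivative (\<lambda>v. A p *v v)) (at p)"
  and taylor_norm_derivative: "norm (A p) \<le> K"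
  and taylor_lipschitz_derivative: "norm (A p - A q) \<le> K * norm (p - q)"
  and taylor_four_point_derivative: "norm (A (p + u) - A p - (A (q + u) - A q)) \<le> K * norm u * norm (p - q)"
  using tb by (auto simp: taylor_bounds_def)

lemma taylor_derivative_shift: "((\<lambda>q. V (p + q)) has_derivative (\<lambda>v. A (p + q) *v v)) (at q)"
  by (rule has_derivative_compose[OF _ taylor_derivative]) (auto intro!: derivative_eq_intros)

lemma taylor_lipschitz: "norm (V p - V q) \<le> K * norm (p - q)"
  by (rule mean_value_cball[where r = "max (norm p) (norm q)", OF taylor_derivative])
    (auto simp: taylor_norm_derivative)

text \<open>Used with \<open>p\<close>, \<open>p'\<close> the values of one solution at two times
  and \<open>q\<close>, \<open>q'\<close> the distance to another solution. The bound then has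
  precisely the form that \<open>young_gronwall\<close> asks of the increments of
  \<open>F\<close>.\<close>

lemma taylor_four_point:
  "norm (V (p' + q') - V p' - (V (p + q) - V p)) \<le> K * norm (q' - q) + K * norm q * norm (p' - p)"
proof -
  have "((\<lambda>p. V (q + p) - V p) has_derivative (\<lambda>v. (A (q + p) - A p) *v v)) (at p)" for p
    using has_derivative_diff[OF taylor_derivative_shift taylor_derivative]
    by (simp add: matrix_vector_mult_diff_rdistrib)
  then have "norm ((V (q + p') - V p') - (V (q + p) - V p)) \<le> (K * norm q) * norm (p' - p)"
    by (rule mean_value_cball[where r = "max (norm p) (norm p')"])
      (use taylor_lipschitz_derivative[of "q + x" x for x] in auto)
  moreover have "norm (V (p' + q') - V (q + p')) \<le> K * norm (q' - q)"
    using taylor_lipschitz[of "p' + q'" "q + p'"] by (simp add: algebra_simps)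
  ultimately show ?thesis
    using norm_triangle_ineq[of "V (p' + q') - V (q + p')" "(V (q + p') - V p') - (V (q + p) - V p)"]
    by (simp add: algebra_simps)
qed

text \<open>The remainder at base point \<open>p\<close> has derivative
  \<open>A (p + q) - A p\<close> in \<open>q\<close>, which is of size \<open>norm q\<close>.
  Together with \<open>taylor_remainder_shift\<close>, which moves the base point, this controls the
  remainder between two times.\<close>

lemma taylor_remainder_increment:
  "norm ((V (p + q') - V p - A p *v q') - (V (p + q) - V p - A p *v q))
    \<le> K * (norm q + norm q') * norm (q' - q)"
proof (rule mean_value_cball[where A = "\<lambda>q. A (p + q) - A p" and r = "norm q + norm q'"])
  show "((\<lambda>q. V (p + q) - V p - A p *v q) has_derivative (\<lambda>v. (A (p + x) - A p) *v v)) (at x)" for x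
    using taylor_derivative_shift[of p x]
    by (auto intro!: derivative_eq_intros simp: matrix_vector_mult_diff_rdistrib
        bounded_linear.has_derivative[OF matrix_vector_mul_bounded_linear])
  show "norm (A (p + x) - A p) \<le> K * (norm q + norm q')" if "norm x \<le> norm q + norm q'" for x
    using taylor_lipschitz_derivative[of "p + x" p] mult_left_mono[OF that taylor_nonneg] by simp
qed auto

lemma taylor_remainder: "norm (V (p + q) - V p - A p *v q) \<le> K * norm q * norm q"
  using taylor_remainder_increment[of p q 0] by simp

text \<open>The derivative in \<open>q\<close> is a four-point difference of \<open>A\<close>, of
  size \<open>norm q * norm (p' - p)\<close>, and both sides vanish at \<open>q = 0\<close>. It is
  here that third derivatives of the vector field enter.\<close>

lemma taylor_remainder_shift:
  "norm ((V (p' + q) - V p' - A p' *v q) - (V (p + q) - V p - A p *v q))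
    \<le> K * norm q * norm q * norm (p' - p)"
proof -
  have "norm (((V (p' + q) - V p' - A p' *v q) - (V (p + q) - V p - A p *v q)) -
      ((V (p' + 0) - V p' - A p' *v 0) - (V (p + 0) - V p - A p *v 0)))
      \<le> (K * norm q * norm (p' - p)) * norm (q - 0)"
  proof (rule mean_value_cball[where A = "\<lambda>q. (A (p' + q) - A p') - (A (p + q) - A p)" and r = "norm q"
      and \<Phi> = "\<lambda>q. (V (p' + q) - V p' - A p' *v q) - (V (p + q) - V p - A p *v q)"])
    show "((\<lambda>q. (V (p' + q) - V p' - A p' *v q) - (V (p + q) - V p - A p *v q)) has_derivative
        (\<lambda>v. ((A (p' + x) - A p') - (A (p + x) - A p)) *v v)) (at x)" for x
      using taylor_derivative_shift[of p x] taylor_derivative_shift[of p' x]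
      by (auto intro!: derivative_eq_intros simp: matrix_vector_mult_diff_rdistrib
          bounded_linear.has_derivative[OF matrix_vector_mul_bounded_linear])
    show "norm ((A (p' + x) - A p') - (A (p + x) - A p)) \<le> K * norm q * norm (p' - p)"
      if "norm x \<le> norm q" for x
      using taylor_four_point_derivative[of p' x p]
        mult_right_mono[OF mult_left_mono[OF that taylor_nonneg], of "norm (p' - p)"] by simp
  qed auto
  then show ?thesis by (simp add: mult_ac)
qed

end

section \<open>Stability of Young equations\<close>

text \<open>On \<open>[0, 1]\<close> an error of order \<open>2 * \<beta>\<close> is also of order
  \<open>\<beta>\<close>, as is the germ. This supplies the a priori Hoelder constant that
  \<open>young_gronwall\<close> takes as input.\<close>

lemma davie_imp_holder:
  fixes F :: "'n::finite \<Rightarrow> real \<Rightarrow> 'e::real_normed_vector" and G B C :: real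
  assumes z: "davie \<beta> C g F z" and g: "\<And>i. holder_const \<beta> G (g i)" and \<beta>: "0 \<le> \<beta>" and B: "0 \<le> B"
    and F: "\<And>i s. 0 \<le> s \<Longrightarrow> s \<le> 1 \<Longrightarrow> norm (F i s) \<le> B"
  shows "holder_const \<beta> (\<bar>C\<bar> + CARD('n) * G * B) z"
  unfolding holder_const_def
proof (intro allI impI)
  fix s t :: real assume st: "0 \<le> s" "s \<le> t" "t \<le> 1"
  have "norm (z t - z s) \<le> norm (germ g F s t) + norm (z t - z s - germ g F s t)"
    by (metis norm_triangle_sub)
  also have "norm (germ g F s t) \<le> CARD('n) * G * B * (t - s) powr \<beta>"
    using norm_germ_le[OF g, of F s B t] F st B by auto
  also have "norm (z t - z s - germ g F s t) \<le> C * (t - s) powr (2 * \<beta>)" using davieD[OF z st] .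
  also have "C * (t - s) powr (2 * \<beta>) \<le> \<bar>C\<bar> * (t - s) powr \<beta>"
    using st \<beta> by (intro mult_mono powr_mono') auto
  finally show "norm (z t - z s) \<le> (\<bar>C\<bar> + CARD('n) * G * B) * (t - s) powr \<beta>"
    by (simp add: algebra_simps)
qed

text \<open>For each pair of times the condition is a closed inequality with a fixed constant, so
  pointwise convergence is enough.\<close>

lemma davie_limit:
  fixes F :: "nat \<Rightarrow> 'n::finite \<Rightarrow> real \<Rightarrow> 'e::real_normed_vector"
  assumes D: "\<And>m. davie \<beta> C g (F m) (z m)"
    and z: "\<And>s. 0 \<le> s \<Longrightarrow> s \<le> 1 \<Longrightarrow> (\<lambda>m. z m s) \<longlonglongrightarrow> z' s"
    and F: "\<And>i s. 0 \<le> s \<Longrightarrow> s \<le> 1 \<Longrightarrow> (\<lambda>m. F m i s) \<longlonglongrightarrow> F' i s"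
  shows "davie \<beta> C g F' z'"
  unfolding davie_def
proof (intro allI impI)
  fix s t :: real assume st: "0 \<le> s" "s \<le> t" "t \<le> 1"
  have "(\<lambda>m. norm (z m t - z m s - germ g (F m) s t)) \<longlonglongrightarrow> norm (z' t - z' s - germ g F' s t)"
    unfolding germ_def using st by (intro tendsto_intros z F) auto
  then show "norm (z' t - z' s - germ g F' s t) \<le> C * (t - s) powr (2 * \<beta>)"
    using davieD[OF D st] by (intro LIMSEQ_le_const2) auto
qed

lemma germ_sum:
  "germ g (\<lambda>i s. \<Sum>k\<in>I. c k *\<^sub>R F k i s) s t = (\<Sum>k\<in>I. c k *\<^sub>R germ g (F k) s t)"
  unfolding germ_def by (simp add: scaleR_sum_right sum.swap[of _ I] mult.commute)

lemma davie_sum: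
  assumes "\<And>k. k \<in> I \<Longrightarrow> davie \<beta> (C k) g (F k) (z k)"
  shows "davie \<beta> (\<Sum>k\<in>I. \<bar>c k\<bar> * C k) g (\<lambda>i s. \<Sum>k\<in>I. c k *\<^sub>R F k i s) (\<lambda>s. \<Sum>k\<in>I. c k *\<^sub>R z k s)"
  unfolding davie_def
proof (intro allI impI)
  fix s t :: real assume st: "0 \<le> s" "s \<le> t" "t \<le> 1"
  have "norm ((\<Sum>k\<in>I. c k *\<^sub>R z k t) - (\<Sum>k\<in>I. c k *\<^sub>R z k s) - germ g (\<lambda>i s. \<Sum>k\<in>I. c k *\<^sub>R F k i s) s t)
      = norm (\<Sum>k\<in>I. c k *\<^sub>R (z k t - z k s - germ g (F k) s t))"
    by (simp add: germ_sum scaleR_diff_right sum_subtractf)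
  also have "\<dots> \<le> (\<Sum>k\<in>I. norm (c k *\<^sub>R (z k t - z k s - germ g (F k) s t)))" by (rule norm_sum)
  also have "\<dots> \<le> (\<Sum>k\<in>I. \<bar>c k\<bar> * (C k * (t - s) powr (2 * \<beta>)))"
    using davieD[OF assms st] by (intro sum_mono) (auto intro!: mult_left_mono)
  finally show "norm ((\<Sum>k\<in>I. c k *\<^sub>R z k t) - (\<Sum>k\<in>I. c k *\<^sub>R z k s) -
      germ g (\<lambda>i s. \<Sum>k\<in>I. c k *\<^sub>R F k i s) s t) \<le> (\<Sum>k\<in>I. \<bar>c k\<bar> * C k) * (t - s) powr (2 * \<beta>)"
    by (simp add: sum_distrib_right mult.assoc)
qed

lemma holder_const_sum:
  assumes "\<And>k. k \<in> I \<Longrightarrow> holder_const \<beta> (C k) (z k)"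
  shows "holder_const \<beta> (\<Sum>k\<in>I. \<bar>c k\<bar> * C k) (\<lambda>s. \<Sum>k\<in>I. c k *\<^sub>R z k s)"
  unfolding holder_const_def
proof (intro allI impI)
  fix s t :: real assume st: "0 \<le> s" "s \<le> t" "t \<le> 1"
  have "norm ((\<Sum>k\<in>I. c k *\<^sub>R z k t) - (\<Sum>k\<in>I. c k *\<^sub>R z k s)) = norm (\<Sum>k\<in>I. c k *\<^sub>R (z k t - z k s))"
    by (simp add: scaleR_diff_right sum_subtractf)
  also have "\<dots> \<le> (\<Sum>k\<in>I. norm (c k *\<^sub>R (z k t - z k s)))" by (rule norm_sum)
  also have "\<dots> \<le> (\<Sum>k\<in>I. \<bar>c k\<bar> * (C k * (t - s) powr \<beta>))"
    using holder_constD[OF assms st] by (intro sum_mono) (auto intro!: mult_left_mono)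
  finally show "norm ((\<Sum>k\<in>I. c k *\<^sub>R z k t) - (\<Sum>k\<in>I. c k *\<^sub>R z k s)) \<le> (\<Sum>k\<in>I. \<bar>c k\<bar> * C k) * (t - s) powr \<beta>"
    by (simp add: sum_distrib_right mult.assoc)
qed

lemma davie_diff:
  assumes "davie \<beta> C g F z" "davie \<beta> C' g F' z'"
  shows "davie \<beta> (C + C') g (\<lambda>i s. F i s - F' i s) (\<lambda>s. z s - z' s)"
  \<comment> \<open>A difference is a sum over the two elements of \<open>bool\<close> with
    coefficients 1 and -1.\<close>
  using davie_sum[where I = "UNIV :: bool set" and c = "\<lambda>b. if b then 1 else - 1" and C = "\<lambda>b. if b then C else C'"
      and F = "\<lambda>b. if b then F else F'" and z = "\<lambda>b. if b then z else z'" and g = g and \<beta> = \<beta>] assms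
  by (simp add: UNIV_bool add.commute)

lemma holder_const_diff:
  assumes "holder_const \<beta> C z" "holder_const \<beta> C' z'"
  shows "holder_const \<beta> (C + C') (\<lambda>s. z s - z' s)"
  using holder_const_sum[where I = "UNIV :: bool set" and c = "\<lambda>b. if b then 1 else - 1" and C = "\<lambda>b. if b then C else C'"
      and z = "\<lambda>b. if b then z else z'" and \<beta> = \<beta>] assms
  by (simp add: UNIV_bool add.commute)

text \<open>The Leibniz rule. Besides the two first-order terms only
  \<open>mul (u t - u s) (w t - w s)\<close> remains, and a product of two increments of order
  \<open>\<beta>\<close> is absorbed by the error.\<close>

lemma davie_bilinear:
  fixes mul :: "'a::real_normed_vector \<Rightarrow> 'b::real_normed_vector \<Rightarrow> 'c::real_normed_vector"
    and g :: "'n::finite \<Rightarrow> real \<Rightarrow> real" and B :: real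
  assumes "bounded_bilinear mul" and u: "davie \<beta> C g F u" "holder_const \<beta> L u"
    and w: "davie \<beta> C' g F' w" "holder_const \<beta> L' w"
    and B: "\<And>s. 0 \<le> s \<Longrightarrow> s \<le> 1 \<Longrightarrow> norm (u s) \<le> B" "\<And>s. 0 \<le> s \<Longrightarrow> s \<le> 1 \<Longrightarrow> norm (w s) \<le> B"
  shows "\<exists>D. davie \<beta> D g (\<lambda>i s. mul (F i s) (w s) + mul (u s) (F' i s)) (\<lambda>s. mul (u s) (w s))"
proof -
  interpret bounded_bilinear mul by fact
  obtain k where k: "0 \<le> k" "\<And>a b. norm (mul a b) \<le> norm a * norm b * k"
    using nonneg_bounded by blast
  have B0: "0 \<le> B" using B(1)[of 0] norm_ge_zero[of "u 0"] by linarith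
  show ?thesis
    unfolding davie_def
  proof (intro exI allI impI)
    fix s t :: real assume st: "0 \<le> s" "s \<le> t" "t \<le> 1"
    let ?q = "(t - s) powr (2 * \<beta>)"
    let ?a = "u t - u s - germ g F s t" and ?b = "w t - w s - germ g F' s t"
    have g: "germ g (\<lambda>i s. mul (F i s) (w s) + mul (u s) (F' i s)) s t
        = mul (germ g F s t) (w s) + mul (u s) (germ g F' s t)"
      unfolding germ_def by (simp add: sum_left sum_right scaleR_left scaleR_right scaleR_add_right sum.distrib)
    have eq: "mul (u t) (w t) - mul (u s) (w s) - germ g (\<lambda>i s. mul (F i s) (w s) + mul (u s) (F' i s)) s t
        = mul ?a (w s) + mul (u s) ?b - (- mul (u t - u s) (w t - w s))"
      unfolding g by (simp add: diff_left diff_right add_left add_right algebra_simps)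
    have "norm (mul (u t) (w t) - mul (u s) (w s) - germ g (\<lambda>i s. mul (F i s) (w s) + mul (u s) (F' i s)) s t)
        \<le> norm (mul ?a (w s)) + norm (mul (u s) ?b) + norm (mul (u t - u s) (w t - w s))"
      unfolding eq by (rule order_trans[OF norm_add_diff_le]) simp
    also have "norm (mul ?a (w s)) \<le> (\<bar>C\<bar> * ?q) * B * k"
    proof (rule order_trans[OF k(2)])
      have "norm ?a \<le> \<bar>C\<bar> * ?q" using davieD[OF u(1) st] by (rule order_trans) (intro mult_right_mono, auto)
      then show "norm ?a * norm (w s) * k \<le> (\<bar>C\<bar> * ?q) * B * k"
        using B(2)[of s] st k B0 by (intro mult_right_mono mult_mono) auto
    qed
    also have "norm (mul (u s) ?b) \<le> B * (\<bar>C'\<bar> * ?q) * k"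
    proof (rule order_trans[OF k(2)])
      have "norm ?b \<le> \<bar>C'\<bar> * ?q" using davieD[OF w(1) st] by (rule order_trans) (intro mult_right_mono, auto)
      then show "norm (u s) * norm ?b * k \<le> B * (\<bar>C'\<bar> * ?q) * k"
        using B(1)[of s] st k B0 by (intro mult_right_mono mult_mono) auto
    qed
    also have "norm (mul (u t - u s) (w t - w s)) \<le> (\<bar>L\<bar> * (t - s) powr \<beta>) * (\<bar>L'\<bar> * (t - s) powr \<beta>) * k"
    proof (rule order_trans[OF k(2)])
      have "norm (u t - u s) \<le> \<bar>L\<bar> * (t - s) powr \<beta>" "norm (w t - w s) \<le> \<bar>L'\<bar> * (t - s) powr \<beta>"
        using holder_constD[OF u(2) st] holder_constD[OF w(2) st]
        by (meson abs_ge_self mult_right_mono order_trans powr_ge_zero)+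
      then show "norm (u t - u s) * norm (w t - w s) * k \<le> (\<bar>L\<bar> * (t - s) powr \<beta>) * (\<bar>L'\<bar> * (t - s) powr \<beta>) * k"
        using k by (intro mult_right_mono mult_mono) auto
    qed
    also have "(\<bar>L\<bar> * (t - s) powr \<beta>) * (\<bar>L'\<bar> * (t - s) powr \<beta>) * k = \<bar>L\<bar> * \<bar>L'\<bar> * k * ?q"
      by (simp add: mult_ac flip: powr_add)
    finally show "norm (mul (u t) (w t) - mul (u s) (w s) - germ g (\<lambda>i s. mul (F i s) (w s) + mul (u s) (F' i s)) s t)
        \<le> (\<bar>C\<bar> * B * k + B * \<bar>C'\<bar> * k + \<bar>L\<bar> * \<bar>L'\<bar> * k) * ?q"
      by (simp add: algebra_simps)
  qed
qed

section \<open>Stability estimates along a fixed driving path\<close>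

locale young_flow =
  fixes \<beta> G K :: real and g :: "'n::finite \<Rightarrow> real \<Rightarrow> real"
    and V :: "'n \<Rightarrow> real ^ 'n \<Rightarrow> real ^ 'n" and A :: "'n \<Rightarrow> real ^ 'n \<Rightarrow> real ^ 'n ^ 'n"
  assumes \<beta>: "1 / 2 < \<beta>" "\<beta> \<le> 1" and G: "0 \<le> G" and g: "\<And>i. holder_const \<beta> G (g i)"
    and tb: "\<And>i. taylor_bounds K (V i) (A i)"
begin

definition solution :: "real ^ 'n \<Rightarrow> (real \<Rightarrow> real ^ 'n) \<Rightarrow> bool" where
  "solution x y \<longleftrightarrow> y 0 = x \<and> (\<exists>C. davie \<beta> C g (\<lambda>i s. V i (y s)) y)"

lemma K: "0 \<le> K"
  using taylor_nonneg[OF tb] .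

definition "holder_bound = gronwall_constant CARD('n) \<beta> G K * K"

lemma holder_bound_nonneg: "0 \<le> holder_bound"
  using gronwall_constant_nonneg[OF \<beta> G K, where 'n = 'n] K by (simp add: holder_bound_def)

text \<open>\<open>young_gronwall\<close> is applied to \<open>y s - x\<close>, which starts at 0,
  with the bound \<open>K\<close> of the vector fields as \<open>\<epsilon>\<close>. Hence the
  constants depend neither on the starting point nor on the solution.\<close>

lemma solution_holder:
  assumes y: "solution x y"
  shows "holder_const \<beta> holder_bound y" "davie \<beta> holder_bound g (\<lambda>i s. V i (y s)) y"
proof -
  obtain D where D: "davie \<beta> D g (\<lambda>i s. V i (y s)) y" using y by (auto simp: solution_def)
  have H: "holder_const \<beta> (\<bar>D\<bar> + CARD('n) * G * K) y"
    using \<beta> K taylor_norm[OF tb] by (intro davie_imp_holder[OF D g]) auto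
  let ?z = "\<lambda>s. y s - x"
  have z0: "?z 0 = 0" using y by (simp add: solution_def)
  have 1: "holder_const \<beta> (\<bar>D\<bar> + CARD('n) * G * K) ?z" using H by (simp add: holder_const_def)
  have 2: "davie \<beta> D g (\<lambda>i s. V i (y s)) ?z" using D by (simp add: davie_def)
  have 3: "norm (V i (y s)) \<le> K * norm (?z s) + K" for i s
    using taylor_norm[OF tb, of i "y s"] K by (simp add: add_increasing)
  have 4: "norm (V i (y t) - V i (y s)) \<le> K * norm (?z t - ?z s) + (K * norm (?z s) + K) * (t - s) powr \<beta>" for i s t
    using taylor_lipschitz[OF tb, of i "y t" "y s"] K by (simp add: add_increasing2)
  note * = young_gronwall(3,4)[OF \<beta> G K K g 1 2 3 4]
  show "holder_const \<beta> holder_bound y" "davie \<beta> holder_bound g (\<lambda>i s. V i (y s)) y"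
    using * unfolding z0 by (simp_all add: holder_bound_def holder_const_def davie_def)
qed

text \<open>The constant with which equations linearised along a solution \<open>y\<close> enter
  \<open>young_gronwall\<close>: \<open>K\<close> bounds the coefficients, and
  \<open>K * holder_bound\<close> their oscillation along \<open>y\<close>.\<close>

definition "growth_rate = K + K * holder_bound"

lemma growth_rate: "0 \<le> growth_rate" "K \<le> growth_rate" "K * holder_bound \<le> growth_rate"
  using K holder_bound_nonneg by (auto simp: growth_rate_def)

definition "lipschitz_bound = gronwall_constant CARD('n) \<beta> G growth_rate"

lemma lipschitz_bound_nonneg: "0 \<le> lipschitz_bound"
  using gronwall_constant_nonneg[OF \<beta> G growth_rate(1), where 'n = 'n] by (simp add: lipschitz_bound_def)

text \<open>The difference of two solutions satisfies the hypotheses of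
  \<open>young_gronwall\<close> with \<open>\<epsilon> = 0\<close>, so every bound is proportional
  to the distance of the starting points; for equal starting points this is uniqueness.\<close>

lemma solution_lipschitz:
  assumes y: "solution x y" and y': "solution x' y'"
  shows "0 \<le> s \<Longrightarrow> s \<le> 1 \<Longrightarrow> norm (y' s - y s) \<le> lipschitz_bound * norm (x' - x)"
    "holder_const \<beta> (lipschitz_bound * norm (x' - x)) (\<lambda>s. y' s - y s)"
    "davie \<beta> (lipschitz_bound * norm (x' - x)) g (\<lambda>i s. V i (y' s) - V i (y s)) (\<lambda>s. y' s - y s)"
proof -
  let ?z = "\<lambda>s. y' s - y s" and ?F = "\<lambda>i s. V i (y' s) - V i (y s)"
  have z0: "?z 0 = x' - x" using y y' by (simp add: solution_def)
  note 1 = holder_const_diff[OF solution_holder(1)[OF y'] solution_holder(1)[OF y]]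
  note 2 = davie_diff[OF solution_holder(2)[OF y'] solution_holder(2)[OF y]]
  have 3: "norm (?F i s) \<le> growth_rate * norm (?z s) + 0" for i s
    using taylor_lipschitz[OF tb, of i "y' s" "y s"] mult_right_mono[OF growth_rate(2), of "norm (?z s)"] by simp
  have 4: "norm (?F i t - ?F i s) \<le> growth_rate * norm (?z t - ?z s) + (growth_rate * norm (?z s) + 0) * (t - s) powr \<beta>"
    if st: "0 \<le> s" "s \<le> t" "t \<le> 1" for i s t
  proof -
    have "norm (?F i t - ?F i s) \<le> K * norm (?z t - ?z s) + K * norm (?z s) * norm (y t - y s)"
      using taylor_four_point[OF tb, of i "y t" "?z t" "y s" "?z s"] by simp
    also have "\<dots> \<le> K * norm (?z t - ?z s) + K * norm (?z s) * (holder_bound * (t - s) powr \<beta>)"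
      using holder_constD[OF solution_holder(1)[OF y] st] K by (intro add_left_mono mult_left_mono) auto
    also have "\<dots> = K * norm (?z t - ?z s) + (K * holder_bound) * (norm (?z s) * (t - s) powr \<beta>)" by simp
    also have "\<dots> \<le> growth_rate * norm (?z t - ?z s) + growth_rate * (norm (?z s) * (t - s) powr \<beta>)"
      using growth_rate by (intro add_mono mult_right_mono) auto
    finally show ?thesis by (simp add: mult_ac)
  qed
  note * = young_gronwall(2-4)[OF \<beta> G growth_rate(1) order_refl g 1 2 3 4, folded lipschitz_bound_def]
  show "norm (y' s - y s) \<le> lipschitz_bound * norm (x' - x)" if "0 \<le> s" "s \<le> 1"
    using *(1)[of s] that unfolding z0 by simp
  show "holder_const \<beta> (lipschitz_bound * norm (x' - x)) ?z" "davie \<beta> (lipschitz_bound * norm (x' - x)) g ?F ?z"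
    using *(2,3) unfolding z0 by simp_all
qed

text \<open>The 2 comes from \<open>taylor_remainder_increment\<close>, where both distances occur,
  and \<open>holder_bound\<close> from \<open>taylor_remainder_shift\<close>, where the base point
  moves along the solution.\<close>

definition "remainder_bound = K * lipschitz_bound\<^sup>2 * (2 + holder_bound)"

lemma remainder_bound: "0 \<le> remainder_bound" "K * lipschitz_bound\<^sup>2 \<le> remainder_bound"
  using K holder_bound_nonneg mult_left_mono[of 1 "2 + holder_bound" "K * lipschitz_bound\<^sup>2"]
  by (auto simp: remainder_bound_def)

text \<open>The second-order error is stated for linear combinations of solutions, so that it yields both
  the convergence of the difference quotients and the linearity of the limit.\<close>

lemma solution_combination:
  assumes y: "solution x y" and ys: "\<And>k. k \<in> I \<Longrightarrow> solution (xs k) (ys k)" and s: "0 \<le> s" "s \<le> 1"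
  shows "norm (\<Sum>k\<in>I. c k *\<^sub>R (ys k s - y s))
    \<le> lipschitz_bound * (norm (\<Sum>k\<in>I. c k *\<^sub>R (xs k - x)) + remainder_bound * (\<Sum>k\<in>I. \<bar>c k\<bar> * (norm (xs k - x))\<^sup>2))"
proof -
  define h where "h k = norm (xs k - x)" for k
  have h: "0 \<le> h k" for k by (simp add: h_def)
  define d where "d k s = ys k s - y s" for k s
  define z where "z s = (\<Sum>k\<in>I. c k *\<^sub>R d k s)" for s
  define F where "F i s = (\<Sum>k\<in>I. c k *\<^sub>R (V i (ys k s) - V i (y s)))" for i s
  \<comment> \<open>The Taylor remainders of the single solutions: the combination \<open>z\<close>
    satisfies the linearised equation up to the forcing by these terms.\<close>
  define R where "R i k s = V i (y s + d k s) - V i (y s) - A i (y s) *v d k s" for i k s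
  have F_eq: "F i s = A i (y s) *v z s + (\<Sum>k\<in>I. c k *\<^sub>R R i k s)" for i s
  proof -
    have "A i (y s) *v z s = (\<Sum>k\<in>I. c k *\<^sub>R (A i (y s) *v d k s))"
      unfolding z_def by (simp add: linear_sum[OF matrix_vector_mul_linear] o_def matrix_vector_mult_scaleR)
    then show ?thesis
      unfolding F_def R_def by (simp add: d_def scaleR_diff_right sum_subtractf sum.distrib)
  qed
  have dk: "norm (d k s) \<le> lipschitz_bound * h k" if "k \<in> I" "0 \<le> s" "s \<le> 1" for k s
    using solution_lipschitz(1)[OF y ys] that by (simp add: d_def h_def)
  have dh: "norm (d k t - d k s) \<le> lipschitz_bound * h k * (t - s) powr \<beta>" if "k \<in> I" "0 \<le> s" "s \<le> t" "t \<le> 1" for k s t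
    using holder_constD[OF solution_lipschitz(2)[OF y ys] that(2-4)] that(1) by (simp add: d_def h_def)
  \<comment> \<open>The forcing is quadratic in the distances of the starting points and takes the
    place of \<open>\<epsilon>\<close> in \<open>young_gronwall\<close>.\<close>
  define E where "E = remainder_bound * (\<Sum>k\<in>I. \<bar>c k\<bar> * (h k)\<^sup>2)"
  have E: "0 \<le> E" using remainder_bound by (auto simp: E_def intro!: mult_nonneg_nonneg sum_nonneg)
  have sum_R: "norm (\<Sum>k\<in>I. c k *\<^sub>R S k) \<le> E * q"
    if "\<And>k. k \<in> I \<Longrightarrow> norm (S k) \<le> remainder_bound * (h k)\<^sup>2 * q" for S :: "'a \<Rightarrow> real ^ 'n" and q
  proof -
    have "norm (\<Sum>k\<in>I. c k *\<^sub>R S k) \<le> (\<Sum>k\<in>I. norm (c k *\<^sub>R S k))" by (rule norm_sum)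
    also have "\<dots> \<le> (\<Sum>k\<in>I. \<bar>c k\<bar> * (remainder_bound * (h k)\<^sup>2 * q))"
      using that by (intro sum_mono) (auto intro!: mult_left_mono)
    also have "\<dots> = E * q" by (simp add: E_def sum_distrib_left sum_distrib_right mult_ac)
    finally show ?thesis .
  qed
  have 1: "holder_const \<beta> (\<Sum>k\<in>I. \<bar>c k\<bar> * (lipschitz_bound * h k)) z"
    unfolding z_def d_def h_def by (intro holder_const_sum solution_lipschitz(2) y ys)
  have 2: "davie \<beta> (\<Sum>k\<in>I. \<bar>c k\<bar> * (lipschitz_bound * h k)) g F z"
    unfolding z_def d_def h_def F_def by (intro davie_sum solution_lipschitz(3) y ys)
  have 3: "norm (F i s) \<le> growth_rate * norm (z s) + E" if s: "0 \<le> s" "s \<le> 1" for i s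
  proof -
    have "norm (\<Sum>k\<in>I. c k *\<^sub>R R i k s) \<le> E * 1"
    proof (rule sum_R)
      fix k assume k: "k \<in> I"
      have "norm (R i k s) \<le> K * norm (d k s) * norm (d k s)"
        unfolding R_def by (rule taylor_remainder[OF tb])
      also have "\<dots> \<le> K * (lipschitz_bound * h k) * (lipschitz_bound * h k)"
        using dk[OF k s] K lipschitz_bound_nonneg h[of k] by (intro mult_mono) auto
      also have "\<dots> = K * lipschitz_bound\<^sup>2 * (h k)\<^sup>2" by (simp add: power2_eq_square)
      also have "\<dots> \<le> remainder_bound * (h k)\<^sup>2" using remainder_bound by (intro mult_right_mono) auto
      finally show "norm (R i k s) \<le> remainder_bound * (h k)\<^sup>2 * 1" by simp
    qed
    moreover have "norm (A i (y s) *v z s) \<le> growth_rate * norm (z s)"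
      using growth_rate(2) taylor_norm_derivative[OF tb, of i "y s"]
      by (intro order_trans[OF norm_matrix_vector_mult_le] mult_right_mono) auto
    ultimately show ?thesis
      unfolding F_eq by (intro order_trans[OF norm_triangle_ineq]) simp
  qed
  have 4: "norm (F i t - F i s) \<le> growth_rate * norm (z t - z s) + (growth_rate * norm (z s) + E) * (t - s) powr \<beta>"
    if st: "0 \<le> s" "s \<le> t" "t \<le> 1" for i s t
  proof -
    let ?q = "(t - s) powr \<beta>"
    have yq: "norm (y t - y s) \<le> holder_bound * ?q" using holder_constD[OF solution_holder(1)[OF y] st] .
    have "norm (\<Sum>k\<in>I. c k *\<^sub>R (R i k t - R i k s)) \<le> E * ?q"
    proof (rule sum_R)
      fix k assume k: "k \<in> I"
      let ?R = "\<lambda>p q. V i (p + q) - V i p - A i p *v q"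
      \<comment> \<open>First the distance between the solutions changes with the base point held at
        time \<open>t\<close>, then the base point moves.\<close>
      have "norm (R i k t - R i k s)
          \<le> norm (?R (y t) (d k t) - ?R (y t) (d k s)) + norm (?R (y t) (d k s) - ?R (y s) (d k s))"
        unfolding R_def by (rule norm_diff_triangle_le[OF order_refl order_refl])
      also have "\<dots> \<le> K * (norm (d k s) + norm (d k t)) * norm (d k t - d k s)
          + K * norm (d k s) * norm (d k s) * norm (y t - y s)"
        by (intro add_mono taylor_remainder_increment[OF tb] taylor_remainder_shift[OF tb])
      also have "\<dots> \<le> K * (lipschitz_bound * h k + lipschitz_bound * h k) * (lipschitz_bound * h k * ?q) + K * (lipschitz_bound * h k) * (lipschitz_bound * h k) * (holder_bound * ?q)"
        using dk[OF k, of s] dk[OF k, of t] dh[OF k st] yq st K lipschitz_bound_nonneg h[of k]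
        by (intro add_mono mult_mono mult_nonneg_nonneg add_nonneg_nonneg) auto
      also have "\<dots> = remainder_bound * (h k)\<^sup>2 * ?q" by (simp add: remainder_bound_def power2_eq_square algebra_simps)
      finally show "norm (R i k t - R i k s) \<le> remainder_bound * (h k)\<^sup>2 * ?q" .
    qed
    moreover have "norm (A i (y t) *v (z t - z s)) \<le> growth_rate * norm (z t - z s)"
      using growth_rate(2) taylor_norm_derivative[OF tb, of i "y t"]
      by (intro order_trans[OF norm_matrix_vector_mult_le] mult_right_mono) auto
    moreover have "norm ((A i (y t) - A i (y s)) *v z s) \<le> growth_rate * norm (z s) * ?q"
    proof -
      have "norm (A i (y t) - A i (y s)) \<le> K * (holder_bound * ?q)"
        using taylor_lipschitz_derivative[OF tb, of i "y t" "y s"] mult_left_mono[OF yq K] by simp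
      also have "\<dots> \<le> growth_rate * ?q" using mult_right_mono[OF growth_rate(3), of ?q] by (simp add: mult_ac)
      finally have "norm (A i (y t) - A i (y s)) * norm (z s) \<le> growth_rate * ?q * norm (z s)"
        by (intro mult_right_mono) auto
      then show ?thesis by (intro order_trans[OF norm_matrix_vector_mult_le]) (simp add: mult_ac)
    qed
    moreover have "F i t - F i s = A i (y t) *v (z t - z s) + (A i (y t) - A i (y s)) *v z s
        - (- (\<Sum>k\<in>I. c k *\<^sub>R (R i k t - R i k s)))"
      unfolding F_eq by (simp add: matrix_vector_mult_diff_distrib matrix_vector_mult_diff_rdistrib
          scaleR_diff_right sum_subtractf)
    ultimately show ?thesis
      using norm_add_diff_le[of "A i (y t) *v (z t - z s)" "(A i (y t) - A i (y s)) *v z s"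
          "- (\<Sum>k\<in>I. c k *\<^sub>R (R i k t - R i k s))"]
      unfolding norm_minus_cancel by (simp add: distrib_right)
  qed
  have "z 0 = (\<Sum>k\<in>I. c k *\<^sub>R (xs k - x))"
    unfolding z_def d_def using y ys by (intro sum.cong) (auto simp: solution_def)
  then show ?thesis
    using young_gronwall(2)[OF \<beta> G growth_rate(1) E g 1 2 3 4, folded lipschitz_bound_def, of s] s
    by (simp add: z_def d_def E_def h_def)
qed

end

section \<open>The derivative of the flow\<close>

definition outer_product :: "real ^ 'n \<Rightarrow> real ^ 'n \<Rightarrow> real ^ 'n ^ 'n" where
  "outer_product u v = (\<chi> a b. u $ a * v $ b)"

lemma bounded_bilinear_outer_product: "bounded_bilinear (outer_product :: real ^ 'n \<Rightarrow> real ^ 'n \<Rightarrow> _)"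
proof -
  have "bilinear (outer_product :: real ^ 'n \<Rightarrow> real ^ 'n \<Rightarrow> _)"
    unfolding bilinear_def
    by (auto intro!: linearI simp: outer_product_def vec_eq_iff algebra_simps)
  then show ?thesis by (simp add: bilinear_conv_bounded_bilinear)
qed

text \<open>The derivative at the identity, in direction \<open>M\<close>, of the congruence action
  taking \<open>z\<close> to \<open>g ** z ** transpose g\<close>. It is the generator under which
  \<open>J C(x) J\<^sup>T\<close> evolves when \<open>J\<close> satisfies the linearised
  equation.\<close>

definition lie_action :: "real ^ 'n ^ 'n \<Rightarrow> real ^ 'n ^ 'n \<Rightarrow> real ^ 'n ^ 'n" where
  "lie_action M z = M ** z + z ** transpose M"

lemma bounded_bilinear_lie_action:
  "bounded_bilinear (lie_action :: real ^ 'n::finite ^ 'n \<Rightarrow> real ^ 'n ^ 'n \<Rightarrow> _)"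
proof -
  have "bilinear (lie_action :: real ^ 'n ^ 'n \<Rightarrow> real ^ 'n ^ 'n \<Rightarrow> _)"
    unfolding bilinear_def
    by (auto intro!: linearI simp: lie_action_def vec_eq_iff matrix_matrix_mult_def transpose_def
        algebra_simps sum.distrib sum_distrib_left)
  then show ?thesis by (simp add: bilinear_conv_bounded_bilinear)
qed

lemma lie_action_outer_product:
  "lie_action M (outer_product u u) = outer_product (M *v u) u + outer_product u (M *v u)"
  by (simp add: lie_action_def outer_product_def vec_eq_iff matrix_matrix_mult_def transpose_def
      matrix_vector_mult_def sum_distrib_left sum_distrib_right mult_ac)

lemma inner_outer_product: "\<xi> \<bullet> (outer_product u u *v \<xi>) = (u \<bullet> \<xi>)\<^sup>2"
proof -
  have "outer_product u u *v \<xi> = (u \<bullet> \<xi>) *\<^sub>R u"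
    by (simp add: outer_product_def matrix_vector_mult_def inner_vec_def vec_eq_iff sum_distrib_right sum_distrib_left mult_ac)
  then show ?thesis by (simp add: power2_eq_square inner_commute)
qed

text \<open>\<open>Y j m\<close> stands for the solution started at
  \<open>x + (1 / real (Suc m)) *\<^sub>R axis j 1\<close>; the columns are then the difference
  quotients along the axes, built from countably many paths.\<close>

definition difference_quotient :: "(real \<Rightarrow> real ^ 'n) \<Rightarrow> ('n \<Rightarrow> nat \<Rightarrow> real \<Rightarrow> real ^ 'n) \<Rightarrow> nat \<Rightarrow> real \<Rightarrow> real ^ 'n ^ 'n" where
  "difference_quotient y Y m s = (\<chi> a j. real (Suc m) * (Y j m s - y s) $ a)"

text \<open>With \<open>lim\<close> the derivative is defined for every family of paths, in
  particular on the exceptional null set, and stays measurable as a limit.\<close>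

definition flow_derivative :: "(real \<Rightarrow> real ^ 'n) \<Rightarrow> ('n \<Rightarrow> nat \<Rightarrow> real \<Rightarrow> real ^ 'n) \<Rightarrow> real \<Rightarrow> real ^ 'n ^ 'n" where
  "flow_derivative y Y s = lim (\<lambda>m. difference_quotient y Y m s)"

lemma difference_quotient_mult:
  "difference_quotient y Y m s *v v = (\<Sum>j\<in>UNIV. (v $ j * real (Suc m)) *\<^sub>R (Y j m s - y s))"
  by (simp add: difference_quotient_def matrix_vector_mult_def vec_eq_iff sum_distrib_right mult_ac)

section \<open>Convergence of the difference quotients and the linearised equation\<close>

context young_flow
begin

context
  fixes x y Y
  assumes y: "solution x y"
    and Y: "\<And>j m. solution (x + (1 / real (Suc m)) *\<^sub>R axis j 1) (Y j m)"
begin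

text \<open>In the combination with coefficients \<open>Suc m\<close> and \<open>- Suc m'\<close>
  the displacements of the starting points cancel, so only the quadratic terms of
  \<open>solution_combination\<close> survive.\<close>

lemma column_difference_quotient_Cauchy:
  assumes s: "0 \<le> s" "s \<le> 1"
  shows "norm (real (Suc m) *\<^sub>R (Y j m s - y s) - real (Suc m') *\<^sub>R (Y j m' s - y s))
    \<le> lipschitz_bound * remainder_bound * (1 / real (Suc m) + 1 / real (Suc m'))"
proof -
  define M where "M b = (if b then m else m')" for b
  define c where "c b = (if b then real (Suc m) else - real (Suc m'))" for b
  have "norm (\<Sum>b\<in>UNIV. c b *\<^sub>R (Y j (M b) s - y s)) \<le> lipschitz_bound *
      (norm (\<Sum>b\<in>UNIV. c b *\<^sub>R (x + (1 / real (Suc (M b))) *\<^sub>R axis j 1 - x)) +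
       remainder_bound * (\<Sum>b\<in>UNIV. \<bar>c b\<bar> * (norm (x + (1 / real (Suc (M b))) *\<^sub>R axis j 1 - x))\<^sup>2))"
    by (intro solution_combination[OF y _ s] Y)
  moreover have "(\<Sum>b\<in>UNIV. c b *\<^sub>R (x + (1 / real (Suc (M b))) *\<^sub>R axis j 1 - x)) = 0"
  proof -
    have "real (Suc k) *\<^sub>R (1 / real (Suc k)) *\<^sub>R v = v" for k and v :: "real ^ 'n"
      unfolding scaleR_scaleR by simp
    then have "c b *\<^sub>R (x + (1 / real (Suc (M b))) *\<^sub>R axis j 1 - x) = (if b then axis j 1 else - axis j 1)" for b
      by (cases b) (simp_all only: c_def M_def if_True if_False add_diff_cancel_left' scaleR_minus_left)
    then show ?thesis by (simp add: UNIV_bool)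
  qed
  moreover have "(\<Sum>b\<in>UNIV. \<bar>c b\<bar> * (norm (x + (1 / real (Suc (M b))) *\<^sub>R axis j 1 - x))\<^sup>2)
      = 1 / real (Suc m) + 1 / real (Suc m')"
    by (simp add: UNIV_bool c_def M_def power2_eq_square add.commute del: of_nat_Suc)
  moreover have "(\<Sum>b\<in>UNIV. c b *\<^sub>R (Y j (M b) s - y s))
      = real (Suc m) *\<^sub>R (Y j m s - y s) - real (Suc m') *\<^sub>R (Y j m' s - y s)"
    by (simp add: UNIV_bool c_def M_def algebra_simps)
  ultimately show ?thesis by (simp only: norm_zero add_0 mult.assoc)
qed

lemma difference_quotient_convergent:
  assumes s: "0 \<le> s" "s \<le> 1"
  shows "convergent (\<lambda>m. difference_quotient y Y m s)"
proof -
  have "convergent (\<lambda>m. real (Suc m) *\<^sub>R (Y j m s - y s))" for j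
  proof (rule Cauchy_convergent, rule CauchyI)
    fix e :: real assume e: "0 < e"
    let ?C = "lipschitz_bound * remainder_bound"
    have "(\<lambda>m. ?C * (1 / real (Suc m))) \<longlonglongrightarrow> ?C * 0"
      using LIMSEQ_inverse_real_of_nat by (intro tendsto_mult_left) (simp add: inverse_eq_divide)
    then have "\<forall>\<^sub>F m in sequentially. ?C * (1 / real (Suc m)) < e / 2"
      using e by (intro order_tendstoD(2)) auto
    then obtain N where N: "\<And>m. m \<ge> N \<Longrightarrow> ?C * (1 / real (Suc m)) < e / 2"
      by (auto simp: eventually_sequentially)
    have "norm (real (Suc m) *\<^sub>R (Y j m s - y s) - real (Suc m') *\<^sub>R (Y j m' s - y s)) < e"
      if "m \<ge> N" "m' \<ge> N" for m m'
      using column_difference_quotient_Cauchy[OF s, of m j m'] N[OF that(1)] N[OF that(2)]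
      by (simp only: distrib_left)
    then show "\<exists>N. \<forall>m\<ge>N. \<forall>m'\<ge>N. norm (real (Suc m) *\<^sub>R (Y j m s - y s) - real (Suc m') *\<^sub>R (Y j m' s - y s)) < e"
      by blast
  qed
  then obtain l where l: "\<And>j. (\<lambda>m. real (Suc m) *\<^sub>R (Y j m s - y s)) \<longlonglongrightarrow> l j"
    unfolding convergent_def by metis
  have "(\<lambda>m. difference_quotient y Y m s) \<longlonglongrightarrow> (\<chi> a j. l j $ a)"
    unfolding difference_quotient_def
    by (intro tendsto_vec_lambda) (use tendsto_vec_nth[OF l] in simp)
  then show ?thesis by (rule convergentI)
qed

lemma tendsto_flow_derivative:
  "0 \<le> s \<Longrightarrow> s \<le> 1 \<Longrightarrow> (\<lambda>m. difference_quotient y Y m s) \<longlonglongrightarrow> flow_derivative y Y s"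
  using difference_quotient_convergent unfolding flow_derivative_def convergent_LIMSEQ_iff by simp

lemma tendsto_flow_derivative_mult:
  "0 \<le> s \<Longrightarrow> s \<le> 1 \<Longrightarrow> (\<lambda>m. difference_quotient y Y m s *v v) \<longlonglongrightarrow> flow_derivative y Y s *v v"
  unfolding matrix_vector_mult_def
  by (intro tendsto_vec_lambda tendsto_sum tendsto_mult tendsto_const tendsto_vec_nth tendsto_flow_derivative)

text \<open>The path \<open>y'\<close> is compared with the combination of the axis solutions that
  has the same displacement at time 0. The first-order term then cancels, and of the quadratic ones
  only that of \<open>y'\<close> persists as the steps tend to 0.\<close>

lemma flow_derivative_remainder:
  assumes y': "solution x' y'" and s: "0 \<le> s" "s \<le> 1"
  shows "norm (y' s - y s - flow_derivative y Y s *v (x' - x)) \<le> lipschitz_bound * remainder_bound * (norm (x' - x))\<^sup>2"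
proof -
  define h where "h = x' - x"
  \<comment> \<open>The index \<open>None\<close> stands for the path from \<open>x'\<close>, and
    \<open>Some j\<close> for the solution displaced along axis \<open>j\<close>.\<close>
  define p where "p m k = (case k of None \<Rightarrow> x' | Some j \<Rightarrow> x + (1 / real (Suc m)) *\<^sub>R axis j 1)" for m k
  define q where "q m k = (case k of None \<Rightarrow> y' | Some j \<Rightarrow> Y j m)" for m k
  define c where "c m k = (case k of None \<Rightarrow> 1 | Some j \<Rightarrow> - (h $ j * real (Suc m)))" for m k
  have U: "(\<Sum>k\<in>UNIV. f k) = f None + (\<Sum>j\<in>(UNIV :: 'n set). f (Some j))" for f :: "'n option \<Rightarrow> 'e::comm_monoid_add"
    by (simp add: UNIV_option_conv sum.reindex)
  have bound: "norm (y' s - y s - difference_quotient y Y m s *v h)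
      \<le> lipschitz_bound * (remainder_bound * ((norm h)\<^sup>2 + (\<Sum>j\<in>UNIV. \<bar>h $ j\<bar>) * (1 / real (Suc m))))" for m
  proof -
    have "solution (p m k) (q m k)" for k
      using y' Y by (auto simp: p_def q_def split: option.split)
    then have "norm (\<Sum>k\<in>UNIV. c m k *\<^sub>R (q m k s - y s)) \<le> lipschitz_bound * (norm (\<Sum>k\<in>UNIV. c m k *\<^sub>R (p m k - x))
        + remainder_bound * (\<Sum>k\<in>UNIV. \<bar>c m k\<bar> * (norm (p m k - x))\<^sup>2))"
      by (intro solution_combination[OF y _ s])
    also have "(\<Sum>k\<in>UNIV. c m k *\<^sub>R (q m k s - y s)) = y' s - y s - difference_quotient y Y m s *v h"
      unfolding U difference_quotient_mult by (simp add: c_def q_def sum_negf)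
    also have "(\<Sum>k\<in>UNIV. c m k *\<^sub>R (p m k - x)) = h - (\<Sum>j\<in>UNIV. h $ j *\<^sub>R axis j 1)"
      unfolding U by (simp add: c_def p_def sum_negf flip: h_def del: of_nat_Suc)
    also have "(\<Sum>j\<in>UNIV. h $ j *\<^sub>R axis j 1) = h"
      using basis_expansion[of h] by (simp add: scalar_mult_eq_scaleR)
    also have "(\<Sum>k\<in>UNIV. \<bar>c m k\<bar> * (norm (p m k - x))\<^sup>2) = (norm h)\<^sup>2 + (\<Sum>j\<in>UNIV. \<bar>h $ j\<bar>) * (1 / real (Suc m))"
      unfolding U
      by (simp add: c_def p_def h_def abs_mult sum_distrib_right sum_divide_distrib power2_eq_square del: of_nat_Suc)
    finally show ?thesis by simp
  qed
  have "(\<lambda>m. norm (y' s - y s - difference_quotient y Y m s *v h)) \<longlonglongrightarrow> norm (y' s - y s - flow_derivative y Y s *v h)"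
    by (intro tendsto_intros tendsto_flow_derivative_mult s)
  moreover have "(\<lambda>m. lipschitz_bound * (remainder_bound * ((norm h)\<^sup>2 + (\<Sum>j\<in>UNIV. \<bar>h $ j\<bar>) * (1 / real (Suc m)))))
      \<longlonglongrightarrow> lipschitz_bound * (remainder_bound * ((norm h)\<^sup>2 + (\<Sum>j\<in>UNIV. \<bar>h $ j\<bar>) * 0))"
    using LIMSEQ_inverse_real_of_nat by (intro tendsto_intros) (simp add: inverse_eq_divide)
  ultimately show ?thesis
    using LIMSEQ_le[OF _ _ exI[of _ 0]] bound by (fastforce simp: h_def mult_ac)
qed

lemma flow_derivative_0: "flow_derivative y Y 0 *v v = v"
proof -
  have "Y j m 0 - y 0 = (1 / real (Suc m)) *\<^sub>R axis j 1" for j m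
    using y Y[of m j] by (simp add: solution_def)
  then have "difference_quotient y Y m 0 *v v = v" for m
    using basis_expansion[of v]
    by (simp add: difference_quotient_mult scalar_mult_eq_scaleR del: of_nat_Suc)
  then show ?thesis
    using tendsto_flow_derivative_mult[of 0 v] by (simp add: LIMSEQ_const_iff)
qed

lemma flow_derivative_bounded:
  assumes s: "0 \<le> s" "s \<le> 1"
  shows "norm (flow_derivative y Y s *v v) \<le> (\<Sum>j\<in>UNIV. \<bar>v $ j\<bar>) * lipschitz_bound"
proof (rule LIMSEQ_le_const2[OF tendsto_norm[OF tendsto_flow_derivative_mult[OF s]]], intro exI allI impI)
  fix m
  have "norm (difference_quotient y Y m s *v v) \<le> (\<Sum>j\<in>UNIV. norm ((v $ j * real (Suc m)) *\<^sub>R (Y j m s - y s)))"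
    unfolding difference_quotient_mult by (rule norm_sum)
  also have "\<dots> \<le> (\<Sum>j\<in>UNIV. \<bar>v $ j\<bar> * lipschitz_bound)"
  proof (intro sum_mono)
    fix j
    have "norm (Y j m s - y s) \<le> lipschitz_bound * (1 / real (Suc m))"
      using solution_lipschitz(1)[OF y Y[of m j] s] by (simp del: of_nat_Suc)
    then have "real (Suc m) * norm (Y j m s - y s) \<le> lipschitz_bound"
      by (simp add: field_simps)
    then have "\<bar>v $ j\<bar> * (real (Suc m) * norm (Y j m s - y s)) \<le> \<bar>v $ j\<bar> * lipschitz_bound"
      by (intro mult_left_mono) auto
    then show "norm ((v $ j * real (Suc m)) *\<^sub>R (Y j m s - y s)) \<le> \<bar>v $ j\<bar> * lipschitz_bound"
      by (simp add: abs_mult mult_ac)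
  qed
  finally show "norm (difference_quotient y Y m s *v v) \<le> (\<Sum>j\<in>UNIV. \<bar>v $ j\<bar>) * lipschitz_bound"
    by (simp add: sum_distrib_right)
qed

text \<open>The equation of the difference quotients passes to the limit. The constant does not
  depend on \<open>m\<close>, as the displacement \<open>1 / Suc m\<close> cancels the factor
  \<open>Suc m\<close> of the quotient.\<close>

lemma flow_derivative_davie:
  "davie \<beta> ((\<Sum>j\<in>UNIV. \<bar>v $ j\<bar>) * lipschitz_bound) g (\<lambda>i s. A i (y s) *v (flow_derivative y Y s *v v)) (\<lambda>s. flow_derivative y Y s *v v)"
proof (rule davie_limit)
  fix m
  have "davie \<beta> (\<Sum>j\<in>UNIV. \<bar>v $ j * real (Suc m)\<bar> * (lipschitz_bound * norm (x + (1 / real (Suc m)) *\<^sub>R axis j 1 - x))) g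
      (\<lambda>i s. \<Sum>j\<in>UNIV. (v $ j * real (Suc m)) *\<^sub>R (V i (Y j m s) - V i (y s)))
      (\<lambda>s. \<Sum>j\<in>UNIV. (v $ j * real (Suc m)) *\<^sub>R (Y j m s - y s))"
    by (intro davie_sum solution_lipschitz(3) y Y)
  then show "davie \<beta> ((\<Sum>j\<in>UNIV. \<bar>v $ j\<bar>) * lipschitz_bound) g
      (\<lambda>i s. \<Sum>j\<in>UNIV. (v $ j * real (Suc m)) *\<^sub>R (V i (Y j m s) - V i (y s)))
      (\<lambda>s. difference_quotient y Y m s *v v)"
    by (simp add: difference_quotient_mult abs_mult sum_distrib_right del: of_nat_Suc)
next
  fix i s assume s: "(0 :: real) \<le> s" "s \<le> 1"
  \<comment> \<open>Replacing increments of \<open>V i\<close> by \<open>A i (y s)\<close> costs an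
    error of order \<open>1 / (Suc m)\<^sup>2\<close>, which vanishes even after multiplication by
    \<open>Suc m\<close>.\<close>
  let ?R = "\<lambda>j m. V i (Y j m s) - V i (y s) - A i (y s) *v (Y j m s - y s)"
  have "(\<lambda>m. real (Suc m) *\<^sub>R ?R j m) \<longlonglongrightarrow> 0" for j
  proof (rule Lim_null_comparison[OF always_eventually])
    show "\<forall>m. norm (real (Suc m) *\<^sub>R ?R j m) \<le> K * lipschitz_bound\<^sup>2 * (1 / real (Suc m))"
    proof
      fix m
      have d: "norm (Y j m s - y s) \<le> lipschitz_bound * (1 / real (Suc m))"
        using solution_lipschitz(1)[OF y Y[of m j] s] by (simp del: of_nat_Suc)
      have "norm (?R j m) \<le> K * norm (Y j m s - y s) * norm (Y j m s - y s)"
        using taylor_remainder[OF tb, of i "y s" "Y j m s - y s"] by simp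
      also have "\<dots> \<le> K * (lipschitz_bound * (1 / real (Suc m))) * (lipschitz_bound * (1 / real (Suc m)))"
        using d K lipschitz_bound_nonneg by (intro mult_mono) auto
      finally have "real (Suc m) * norm (?R j m)
          \<le> real (Suc m) * (K * (lipschitz_bound * (1 / real (Suc m))) * (lipschitz_bound * (1 / real (Suc m))))"
        by (intro mult_left_mono) auto
      also have "\<dots> = K * lipschitz_bound\<^sup>2 * (1 / real (Suc m))"
        by (simp add: power2_eq_square del: of_nat_Suc)
      finally show "norm (real (Suc m) *\<^sub>R ?R j m) \<le> K * lipschitz_bound\<^sup>2 * (1 / real (Suc m))" by simp
    qed
    show "(\<lambda>m. K * lipschitz_bound\<^sup>2 * (1 / real (Suc m))) \<longlonglongrightarrow> 0"
      using LIMSEQ_inverse_real_of_nat by (intro tendsto_mult_right_zero) (simp add: inverse_eq_divide)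
  qed
  then have "(\<lambda>m. A i (y s) *v (difference_quotient y Y m s *v v) + (\<Sum>j\<in>UNIV. v $ j *\<^sub>R (real (Suc m) *\<^sub>R ?R j m)))
      \<longlonglongrightarrow> A i (y s) *v (flow_derivative y Y s *v v) + (\<Sum>j\<in>(UNIV :: 'n set). v $ j *\<^sub>R 0)"
    by (intro tendsto_add tendsto_sum tendsto_scaleR tendsto_const
        bounded_linear.tendsto[OF matrix_vector_mul_bounded_linear tendsto_flow_derivative_mult[OF s]])
  moreover have "A i (y s) *v (difference_quotient y Y m s *v v) + (\<Sum>j\<in>UNIV. v $ j *\<^sub>R (real (Suc m) *\<^sub>R ?R j m))
      = (\<Sum>j\<in>UNIV. (v $ j * real (Suc m)) *\<^sub>R (V i (Y j m s) - V i (y s)))" for m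
  proof -
    have "A i (y s) *v (difference_quotient y Y m s *v v)
        = (\<Sum>j\<in>UNIV. (v $ j * real (Suc m)) *\<^sub>R (A i (y s) *v (Y j m s - y s)))"
      unfolding difference_quotient_mult
      by (simp add: linear_sum[OF matrix_vector_mul_linear] o_def matrix_vector_mult_scaleR del: of_nat_Suc)
    then show ?thesis
      by (simp add: scaleR_diff_right sum_subtractf del: of_nat_Suc)
  qed
  ultimately show "(\<lambda>m. \<Sum>j\<in>UNIV. (v $ j * real (Suc m)) *\<^sub>R (V i (Y j m s) - V i (y s)))
      \<longlonglongrightarrow> A i (y s) *v (flow_derivative y Y s *v v)" by simp
qed (rule tendsto_flow_derivative_mult)

lemma flow_derivative_holder: "\<exists>L. holder_const \<beta> L (\<lambda>s. flow_derivative y Y s *v v)"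
proof -
  define B where "B = K * ((\<Sum>j\<in>UNIV. \<bar>v $ j\<bar>) * lipschitz_bound)"
  have B: "0 \<le> B" using K lipschitz_bound_nonneg by (auto simp: B_def intro!: mult_nonneg_nonneg sum_nonneg)
  have "norm (A i (y s) *v (flow_derivative y Y s *v v)) \<le> B" if s: "0 \<le> s" "s \<le> 1" for i s
  proof -
    have "norm (A i (y s)) * norm (flow_derivative y Y s *v v) \<le> B"
      unfolding B_def using flow_derivative_bounded[OF s] taylor_norm_derivative[OF tb] K by (intro mult_mono) auto
    then show ?thesis by (rule order_trans[OF norm_matrix_vector_mult_le])
  qed
  then show ?thesis
    using davie_imp_holder[OF flow_derivative_davie g _ B] \<beta> by fastforce
qed

end

end

section \<open>Transport of the cometric\<close>

text \<open>Its squared norm is the quadratic form of the cometric at the covector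
  \<open>\<xi>\<close>. For \<open>\<xi>\<close> the gradient of a function at \<open>p\<close> it
  is the carre du champ of that function.\<close>

definition frame_map :: "('n::finite \<Rightarrow> real ^ 'n \<Rightarrow> real ^ 'n) \<Rightarrow> real ^ 'n \<Rightarrow> real ^ 'n \<Rightarrow> real ^ 'n" where
  "frame_map V p \<xi> = (\<chi> k. V k p \<bullet> \<xi>)"

context young_flow
begin

lemma norm_frame_map_le: "norm (frame_map V p \<xi>) \<le> CARD('n) * K * norm \<xi>"
proof -
  have "norm (frame_map V p \<xi>) \<le> (\<Sum>k\<in>UNIV. \<bar>V k p \<bullet> \<xi>\<bar>)"
    using norm_le_l1_cart[of "frame_map V p \<xi>"] by (simp add: frame_map_def)
  also have "\<dots> \<le> (\<Sum>k\<in>(UNIV :: 'n set). K * norm \<xi>)"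
    using taylor_norm[OF tb]
    by (intro sum_mono order_trans[OF Cauchy_Schwarz_ineq2] mult_right_mono) auto
  finally show ?thesis by simp
qed

lemma davie_sum_ex:
  fixes F :: "'k \<Rightarrow> 'n \<Rightarrow> real \<Rightarrow> 'e::real_normed_vector"
  assumes "\<And>k. \<exists>D. davie \<beta> D g (F k) (z k)"
  shows "\<exists>D. davie \<beta> D g (\<lambda>i s. \<Sum>k\<in>I. F k i s) (\<lambda>s. \<Sum>k\<in>I. z k s)"
proof -
  obtain D where "\<And>k. davie \<beta> (D k) g (F k) (z k)" using assms by metis
  then have "davie \<beta> (\<Sum>k\<in>I. \<bar>1\<bar> * D k) g (\<lambda>i s. \<Sum>k\<in>I. 1 *\<^sub>R F k i s) (\<lambda>s. \<Sum>k\<in>I. 1 *\<^sub>R z k s)"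
    by (intro davie_sum)
  then show ?thesis by auto
qed

lemma davie_diff_ex:
  "\<exists>D. davie \<beta> D g F z \<Longrightarrow> \<exists>D. davie \<beta> D g F' z' \<Longrightarrow>
    \<exists>D. davie \<beta> D g (\<lambda>i s. F i s - F' i s) (\<lambda>s. z s - z' s)"
  by (blast intro: davie_diff)

text \<open>The chain rule for \<open>V k\<close> along a solution: the Taylor error is quadratic in
  the increment of \<open>y\<close>, hence already of order \<open>2 * \<beta>\<close>.\<close>

lemma vector_field_davie:
  assumes y: "solution x y"
  shows "\<exists>D. davie \<beta> D g (\<lambda>i s. A k (y s) *v V i (y s)) (\<lambda>s. V k (y s))"
  unfolding davie_def
proof (intro exI allI impI)
  fix s t :: real assume st: "0 \<le> s" "s \<le> t" "t \<le> 1"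
  let ?q = "(t - s) powr (2 * \<beta>)"
  have germ: "germ g (\<lambda>i s. A k (y s) *v V i (y s)) s t = A k (y s) *v germ g (\<lambda>i s. V i (y s)) s t"
    unfolding germ_def by (simp add: linear_sum[OF matrix_vector_mul_linear] o_def matrix_vector_mult_scaleR)
  have eq: "V k (y t) - V k (y s) - germ g (\<lambda>i s. A k (y s) *v V i (y s)) s t
      = (V k (y s + (y t - y s)) - V k (y s) - A k (y s) *v (y t - y s))
        + A k (y s) *v (y t - y s - germ g (\<lambda>i s. V i (y s)) s t)"
    unfolding germ by (simp add: matrix_vector_mult_diff_distrib)
  have "norm (V k (y t) - V k (y s) - germ g (\<lambda>i s. A k (y s) *v V i (y s)) s t)
      \<le> norm (V k (y s + (y t - y s)) - V k (y s) - A k (y s) *v (y t - y s))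
        + norm (A k (y s) *v (y t - y s - germ g (\<lambda>i s. V i (y s)) s t))"
    unfolding eq by (rule norm_triangle_ineq)
  also have "\<dots> \<le> K * norm (y t - y s) * norm (y t - y s)
      + norm (A k (y s)) * norm (y t - y s - germ g (\<lambda>i s. V i (y s)) s t)"
    by (intro add_mono taylor_remainder[OF tb] norm_matrix_vector_mult_le)
  also have "\<dots> \<le> K * (holder_bound * (t - s) powr \<beta>) * (holder_bound * (t - s) powr \<beta>)
      + K * (holder_bound * ?q)"
    using holder_constD[OF solution_holder(1)[OF y] st] davieD[OF solution_holder(2)[OF y] st]
      taylor_norm_derivative[OF tb, of k "y s"] K holder_bound_nonneg
    by (intro add_mono mult_mono mult_nonneg_nonneg) auto
  also have "\<dots> = (K * holder_bound * holder_bound + K * holder_bound) * ?q"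
    by (simp add: algebra_simps flip: powr_add)
  finally show "norm (V k (y t) - V k (y s) - germ g (\<lambda>i s. A k (y s) *v V i (y s)) s t)
      \<le> (K * holder_bound * holder_bound + K * holder_bound) * ?q" .
qed

lemma vector_field_holder:
  assumes y: "solution x y"
  shows "holder_const \<beta> (K * holder_bound) (\<lambda>s. V k (y s))"
  unfolding holder_const_def
proof (intro allI impI)
  fix s t :: real assume st: "0 \<le> s" "s \<le> t" "t \<le> 1"
  show "norm (V k (y t) - V k (y s)) \<le> K * holder_bound * (t - s) powr \<beta>"
    using taylor_lipschitz[OF tb, of k "y t" "y s"]
      mult_left_mono[OF holder_constD[OF solution_holder(1)[OF y] st] K] by simp
qed

end

section \<open>Invariance of the cometric\<close>

locale skew_young_flow = young_flow \<beta> G K g V A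
  for \<beta> G K :: real and g :: "'n::finite \<Rightarrow> real \<Rightarrow> real" and V A +
  fixes \<omega> :: "'n \<Rightarrow> 'n \<Rightarrow> 'n \<Rightarrow> real ^ 'n \<Rightarrow> real"
  assumes bracket: "A k p *v V i p - A i p *v V k p = (\<Sum>l\<in>UNIV. \<omega> i k l p *\<^sub>R V l p)"
    and skew: "\<omega> i k l p = - \<omega> i l k p"
begin

text \<open>By skew symmetry the structure functions cancel, so the cometric is transported by the
  same linear equation along the flow as under the derivative of the flow.\<close>

lemma cometric_lie_action:
  "(\<Sum>k\<in>UNIV. outer_product (A k p *v V i p) (V k p) + outer_product (V k p) (A k p *v V i p))
    = lie_action (A i p) (\<Sum>k\<in>UNIV. outer_product (V k p) (V k p))"
proof -
  interpret o: bounded_bilinear "outer_product :: real ^ 'n \<Rightarrow> real ^ 'n \<Rightarrow> _"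
    by (rule bounded_bilinear_outer_product)
  interpret l: bounded_bilinear "lie_action :: real ^ 'n ^ 'n \<Rightarrow> real ^ 'n ^ 'n \<Rightarrow> _"
    by (rule bounded_bilinear_lie_action)
  \<comment> \<open>\<open>W k\<close> is the bracket of \<open>V i\<close> and \<open>V k\<close>.
    The claim reduces to the vanishing of the symmetrised sum of
    \<open>outer_product (V k p) (W k)\<close>, whose coefficients are
    \<open>\<omega> i k l p + \<omega> i l k p\<close>.\<close>
  define W where "W k = (\<Sum>l\<in>UNIV. \<omega> i k l p *\<^sub>R V l p)" for k
  have A: "A k p *v V i p = A i p *v V k p + W k" for k
    using bracket[of k p i] by (simp add: W_def algebra_simps)
  have "(\<Sum>k\<in>UNIV. outer_product (V k p) (W k)) = (\<Sum>k\<in>UNIV. \<Sum>l\<in>UNIV. \<omega> i k l p *\<^sub>R outer_product (V k p) (V l p))"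
    by (simp add: W_def o.sum_right o.scaleR_right)
  also have "\<dots> = (\<Sum>l\<in>UNIV. \<Sum>k\<in>UNIV. \<omega> i k l p *\<^sub>R outer_product (V k p) (V l p))"
    by (rule sum.swap)
  also have "\<dots> = (\<Sum>k\<in>UNIV. \<Sum>l\<in>UNIV. - (\<omega> i k l p *\<^sub>R outer_product (V l p) (V k p)))"
  proof (intro sum.cong refl)
    fix k l
    show "\<omega> i l k p *\<^sub>R outer_product (V l p) (V k p) = - (\<omega> i k l p *\<^sub>R outer_product (V l p) (V k p))"
      by (subst skew) simp
  qed
  also have "\<dots> = - (\<Sum>k\<in>UNIV. outer_product (W k) (V k p))"
    by (simp add: W_def o.sum_left o.scaleR_left sum_negf)
  finally have "(\<Sum>k\<in>UNIV. outer_product (V k p) (W k)) = - (\<Sum>k\<in>UNIV. outer_product (W k) (V k p))" .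
  then show ?thesis
    by (simp add: A o.add_left o.add_right sum.distrib l.sum_right lie_action_outer_product)
qed

context
  fixes x y Y
  assumes y: "solution x y"
    and Y: "\<And>j m. solution (x + (1 / real (Suc m)) *\<^sub>R axis j 1) (Y j m)"
begin

abbreviation "J \<equiv> flow_derivative y Y"

text \<open>Feeds \<open>davie_imp_holder\<close>, so that the defect has the a priori Hoelder
  regularity from which \<open>young_gronwall\<close> starts.\<close>

lemma cometric_defect_bounded:
  "\<exists>B. \<forall>s. 0 \<le> s \<longrightarrow> s \<le> 1 \<longrightarrow> norm ((\<Sum>k\<in>UNIV. outer_product (J s *v V k x) (J s *v V k x))
      - (\<Sum>k\<in>UNIV. outer_product (V k (y s)) (V k (y s)))) \<le> B"
proof -
  interpret o: bounded_bilinear "outer_product :: real ^ 'n \<Rightarrow> real ^ 'n \<Rightarrow> _"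
    by (rule bounded_bilinear_outer_product)
  obtain c where c: "0 \<le> c" "\<And>u v. norm (outer_product (u :: real ^ 'n) v) \<le> norm u * norm v * c"
    using o.nonneg_bounded by blast
  define b where "b k = (\<Sum>j\<in>UNIV. \<bar>V k x $ j\<bar>) * lipschitz_bound" for k
  have "norm ((\<Sum>k\<in>UNIV. outer_product (J s *v V k x) (J s *v V k x))
      - (\<Sum>k\<in>UNIV. outer_product (V k (y s)) (V k (y s)))) \<le> (\<Sum>k\<in>UNIV. b k * b k * c) + (\<Sum>k\<in>(UNIV :: 'n set). K * K * c)"
    if s: "0 \<le> s" "s \<le> 1" for s
  proof (intro order_trans[OF norm_triangle_ineq4] add_mono order_trans[OF norm_sum] sum_mono)
    fix k
    have "norm (J s *v V k x) \<le> b k" unfolding b_def by (rule flow_derivative_bounded[OF y Y s])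
    then show "norm (outer_product (J s *v V k x) (J s *v V k x)) \<le> b k * b k * c"
      using c(1) by (intro order_trans[OF c(2)] mult_right_mono mult_mono) (auto intro: order_trans[OF norm_ge_zero])
    show "norm (outer_product (V k (y s)) (V k (y s))) \<le> K * K * c"
      using c(1) K taylor_norm[OF tb] by (intro order_trans[OF c(2)] mult_right_mono mult_mono) auto
  qed
  then show ?thesis by blast
qed

lemma cometric_transport:
  assumes s: "0 \<le> s" "s \<le> 1"
  shows "(\<Sum>k\<in>UNIV. outer_product (J s *v V k x) (J s *v V k x))
    = (\<Sum>k\<in>UNIV. outer_product (V k (y s)) (V k (y s)))"
proof -
  interpret l: bounded_bilinear "lie_action :: real ^ 'n ^ 'n \<Rightarrow> real ^ 'n ^ 'n \<Rightarrow> _"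
    by (rule bounded_bilinear_lie_action)
  obtain c where c: "0 \<le> c" "\<And>M z. norm (lie_action (M :: real ^ 'n ^ 'n) z) \<le> norm M * norm z * c"
    using l.nonneg_bounded by blast
  define z where "z s = (\<Sum>k\<in>UNIV. outer_product (J s *v V k x) (J s *v V k x))
      - (\<Sum>k\<in>UNIV. outer_product (V k (y s)) (V k (y s)))" for s
  define F where "F i s = lie_action (A i (y s)) (z s)" for i s
  have D1: "\<exists>D. davie \<beta> D g
      (\<lambda>i s. outer_product (A i (y s) *v (J s *v V k x)) (J s *v V k x) + outer_product (J s *v V k x) (A i (y s) *v (J s *v V k x)))
      (\<lambda>s. outer_product (J s *v V k x) (J s *v V k x))" for k
  proof -
    obtain L where L: "holder_const \<beta> L (\<lambda>s. J s *v V k x)" using flow_derivative_holder[OF y Y] by blast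
    show ?thesis
      by (rule davie_bilinear[OF bounded_bilinear_outer_product flow_derivative_davie[OF y Y] L
            flow_derivative_davie[OF y Y] L flow_derivative_bounded[OF y Y] flow_derivative_bounded[OF y Y]])
  qed
  have D2: "\<exists>D. davie \<beta> D g
      (\<lambda>i s. outer_product (A k (y s) *v V i (y s)) (V k (y s)) + outer_product (V k (y s)) (A k (y s) *v V i (y s)))
      (\<lambda>s. outer_product (V k (y s)) (V k (y s)))" for k
  proof -
    obtain D where D: "davie \<beta> D g (\<lambda>i s. A k (y s) *v V i (y s)) (\<lambda>s. V k (y s))"
      using vector_field_davie[OF y] by blast
    show ?thesis
      by (rule davie_bilinear[OF bounded_bilinear_outer_product D vector_field_holder[OF y] D
            vector_field_holder[OF y] taylor_norm[OF tb] taylor_norm[OF tb]])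
  qed
  \<comment> \<open>The first sum is what the Leibniz rule gives for the transported cometric, the
    second what it gives for the cometric along \<open>y\<close>; \<open>cometric_lie_action\<close>
    brings the latter to the same linear form.\<close>
  have F_eq: "F i s = (\<Sum>k\<in>UNIV. outer_product (A i (y s) *v (J s *v V k x)) (J s *v V k x) + outer_product (J s *v V k x) (A i (y s) *v (J s *v V k x)))
      - (\<Sum>k\<in>UNIV. outer_product (A k (y s) *v V i (y s)) (V k (y s)) + outer_product (V k (y s)) (A k (y s) *v V i (y s)))" for i s
    unfolding cometric_lie_action by (simp add: F_def z_def l.diff_right l.sum_right lie_action_outer_product)
  have "\<exists>D. davie \<beta> D g F z"
    unfolding F_eq[abs_def] z_def[abs_def] by (intro davie_diff_ex davie_sum_ex D1 D2)
  then obtain D where D: "davie \<beta> D g F z" by blast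
  \<comment> \<open>The analogue of \<open>growth_rate\<close>, with \<open>c\<close> the bound of
    the bilinear map \<open>lie_action\<close>.\<close>
  define k where "k = c * K + c * (K * holder_bound)"
  have k: "0 \<le> k" "c * K \<le> k" "c * (K * holder_bound) \<le> k"
    using c(1) K holder_bound_nonneg by (auto simp: k_def)
  have F1: "norm (F i s) \<le> k * norm (z s) + 0" for i s
  proof -
    have "norm (F i s) \<le> norm (A i (y s)) * norm (z s) * c" unfolding F_def by (rule c(2))
    also have "\<dots> \<le> K * norm (z s) * c"
      using taylor_norm_derivative[OF tb] c(1) by (intro mult_right_mono) auto
    also have "\<dots> = (c * K) * norm (z s)" by simp
    also have "\<dots> \<le> k * norm (z s)" using k by (intro mult_right_mono) auto
    finally show ?thesis by simp
  qed
  have F2: "norm (F i t - F i s) \<le> k * norm (z t - z s) + (k * norm (z s) + 0) * (t - s) powr \<beta>"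
    if st: "0 \<le> s" "s \<le> t" "t \<le> 1" for i s t
  proof -
    have "F i t - F i s = lie_action (A i (y t)) (z t - z s) + lie_action (A i (y t) - A i (y s)) (z s)"
      by (simp add: F_def l.diff_left l.diff_right)
    then have "norm (F i t - F i s) \<le> norm (lie_action (A i (y t)) (z t - z s)) + norm (lie_action (A i (y t) - A i (y s)) (z s))"
      by (simp add: norm_triangle_ineq)
    also have "\<dots> \<le> norm (A i (y t)) * norm (z t - z s) * c + norm (A i (y t) - A i (y s)) * norm (z s) * c"
      by (intro add_mono c(2))
    also have "\<dots> \<le> K * norm (z t - z s) * c + (K * (holder_bound * (t - s) powr \<beta>)) * norm (z s) * c"
    proof -
      have "norm (A i (y t) - A i (y s)) \<le> K * (holder_bound * (t - s) powr \<beta>)"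
        using taylor_lipschitz_derivative[OF tb, of i "y t" "y s"]
          mult_left_mono[OF holder_constD[OF solution_holder(1)[OF y] st] K] by simp
      then show ?thesis
        using taylor_norm_derivative[OF tb, of i "y t"] c(1) by (intro add_mono mult_right_mono) auto
    qed
    also have "\<dots> = (c * K) * norm (z t - z s) + (c * (K * holder_bound)) * (norm (z s) * (t - s) powr \<beta>)"
      by (simp add: mult_ac)
    also have "\<dots> \<le> k * norm (z t - z s) + k * (norm (z s) * (t - s) powr \<beta>)"
      using k by (intro add_mono mult_right_mono) auto
    finally show ?thesis by (simp add: mult_ac)
  qed
  have z0: "z 0 = 0"
    using y by (simp add: z_def flow_derivative_0[OF y Y] solution_def)
  obtain B where B: "\<And>s. 0 \<le> s \<Longrightarrow> s \<le> 1 \<Longrightarrow> norm (z s) \<le> B"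
    using cometric_defect_bounded unfolding z_def by blast
  have B0: "0 \<le> B" using order_trans[OF norm_ge_zero B[of 0]] by simp
  have "norm (F i s) \<le> k * B" if "0 \<le> s" "s \<le> 1" for i s
    using F1[of i s] mult_left_mono[OF B[OF that] k(1)] by simp
  with davie_imp_holder[OF D g _ mult_nonneg_nonneg[OF k(1) B0]] \<beta>
  obtain L where L: "holder_const \<beta> L z" by fastforce
  \<comment> \<open>Both the initial value and the forcing are 0, and the bound of
    \<open>young_gronwall\<close> is proportional to their sum.\<close>
  have "norm (z s) \<le> 0"
    using young_gronwall(2)[OF \<beta> G k(1) order_refl g L D F1 F2, of s] s z0 by simp
  then show ?thesis by (simp add: z_def)
qed

text \<open>The identity of \<open>cometric_transport\<close> evaluated as a quadratic form at
  \<open>\<xi>\<close>. Here \<open>\<xi> v* J s\<close> is the transpose of \<open>J s\<close>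
  applied to \<open>\<xi>\<close>, the pullback of the covector by the flow.\<close>

lemma frame_map_flow_derivative:
  assumes s: "0 \<le> s" "s \<le> 1"
  shows "norm (frame_map V x (\<xi> v* J s)) = norm (frame_map V (y s) \<xi>)"
proof -
  have inner_sum: "\<xi> \<bullet> ((\<Sum>k\<in>UNIV. outer_product (u k) (u k)) *v \<xi>) = (\<Sum>k\<in>UNIV. (u k \<bullet> \<xi>)\<^sup>2)"
    for u :: "'n \<Rightarrow> real ^ 'n"
  proof -
    have "linear (\<lambda>M :: real ^ 'n ^ 'n. \<xi> \<bullet> (M *v \<xi>))"
      by (intro linearI) (auto simp: matrix_vector_mult_add_rdistrib inner_add_right
          matrix_vector_mult_def inner_vec_def sum_distrib_left sum.distrib algebra_simps)
    from linear_sum[OF this, of "\<lambda>k. outer_product (u k) (u k)" UNIV] show ?thesis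
      by (simp add: inner_outer_product)
  qed
  have "(\<Sum>k\<in>UNIV. ((J s *v V k x) \<bullet> \<xi>)\<^sup>2) = (\<Sum>k\<in>UNIV. (V k (y s) \<bullet> \<xi>)\<^sup>2)"
    using arg_cong[OF cometric_transport[OF s], of "\<lambda>M. \<xi> \<bullet> (M *v \<xi>)"] unfolding inner_sum .
  moreover have "V k x \<bullet> (\<xi> v* J s) = (J s *v V k x) \<bullet> \<xi>" for k
    by (metis dot_lmul_matrix inner_commute)
  ultimately show ?thesis
    by (simp add: frame_map_def norm_vec_def L2_set_def)
qed

text \<open>By duality it suffices to bound the transpose of \<open>J s\<close>. There the frame at
  \<open>x\<close> bounds from below, the frame at \<open>y s\<close> from above, and the isometry
  connects them. The constant is therefore independent of \<open>G\<close>.\<close>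

lemma norm_flow_derivative_le:
  assumes s: "0 \<le> s" "s \<le> 1" and c: "0 < c" "\<And>\<xi>. c * norm \<xi> \<le> norm (frame_map V x \<xi>)"
  shows "norm (J s *v v) \<le> CARD('n) * K / c * norm v"
proof -
  define u where "u = J s *v v"
  have "c * norm (u v* J s) \<le> CARD('n) * K * norm u"
    using c(2)[of "u v* J s"] norm_frame_map_le[of "y s" u] frame_map_flow_derivative[OF s, of u] by simp
  then have 1: "norm (u v* J s) \<le> CARD('n) * K / c * norm u" using c(1) by (simp add: field_simps)
  have "norm u * norm u = (u v* J s) \<bullet> v"
    by (simp add: dot_lmul_matrix u_def dot_square_norm flip: power2_eq_square)
  also have "\<dots> \<le> norm (u v* J s) * norm v" by (rule norm_cauchy_schwarz)
  also have "\<dots> \<le> CARD('n) * K / c * norm u * norm v" using 1 by (intro mult_right_mono) auto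
  finally have "norm u * norm u \<le> norm u * (CARD('n) * K / c * norm v)" by (simp add: mult_ac)
  moreover have "0 \<le> CARD('n) * K / c * norm v" using K c(1) by simp
  ultimately show ?thesis
    unfolding u_def[symmetric] by (metis mult_le_cancel_left_pos norm_ge_zero order_le_less)
qed

end

text \<open>Chaining the first-order bound along a subdivision of the segment, so that only countably many
  starting points are involved.\<close>

lemma solution_lipschitz_chain:
  assumes Y: "\<And>k N. solution (x + (real k / real (Suc N)) *\<^sub>R h) (Y (x + (real k / real (Suc N)) *\<^sub>R h))"
    and YY: "\<And>k N j m. solution (x + (real k / real (Suc N)) *\<^sub>R h + (1 / real (Suc m)) *\<^sub>R axis j 1)
      (Y (x + (real k / real (Suc N)) *\<^sub>R h + (1 / real (Suc m)) *\<^sub>R axis j 1))"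
    and c: "0 < c" "\<And>r \<xi>. 0 \<le> r \<Longrightarrow> r \<le> 1 \<Longrightarrow> c * norm \<xi> \<le> norm (frame_map V (x + r *\<^sub>R h) \<xi>)"
    and s: "0 \<le> s" "s \<le> 1"
  shows "norm (Y (x + h) s - Y x s) \<le> CARD('n) * K / c * norm h"
proof -
  define C where "C = lipschitz_bound * remainder_bound"
  define \<Lambda> where "\<Lambda> = CARD('n) * K / c"
  have bound: "norm (Y (x + h) s - Y x s) \<le> \<Lambda> * norm h + C * (norm h)\<^sup>2 * (1 / real (Suc N))" for N
  proof -
    define p where "p k = x + (real k / real (Suc N)) *\<^sub>R h" for k
    have step: "norm (Y (p (Suc k)) s - Y (p k) s) \<le> (\<Lambda> * norm h + C * (norm h)\<^sup>2 * (1 / real (Suc N))) / real (Suc N)"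
      if k: "k < Suc N" for k
    proof -
      let ?J = "flow_derivative (Y (p k)) (\<lambda>j m. Y (p k + (1 / real (Suc m)) *\<^sub>R axis j 1))"
      have d: "p (Suc k) - p k = (1 / real (Suc N)) *\<^sub>R h"
        by (simp add: p_def add_divide_distrib flip: scaleR_diff_left)
      have "norm (Y (p (Suc k)) s - Y (p k) s) \<le> norm (?J s *v (p (Suc k) - p k))
          + norm (Y (p (Suc k)) s - Y (p k) s - ?J s *v (p (Suc k) - p k))"
        by (metis norm_triangle_sub)
      also have "norm (Y (p (Suc k)) s - Y (p k) s - ?J s *v (p (Suc k) - p k)) \<le> C * (norm (p (Suc k) - p k))\<^sup>2"
        unfolding C_def by (rule flow_derivative_remainder[OF _ _ _ s]) (use Y YY in \<open>simp_all add: p_def del: of_nat_Suc\<close>)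
      also have "norm (?J s *v (p (Suc k) - p k)) \<le> \<Lambda> * norm (p (Suc k) - p k)"
        unfolding \<Lambda>_def
      proof (rule norm_flow_derivative_le[OF _ _ s c(1)])
        show "c * norm \<xi> \<le> norm (frame_map V (p k) \<xi>)" for \<xi>
          unfolding p_def using k by (intro c(2)) (auto simp: divide_le_eq)
      qed (use Y YY in \<open>simp_all add: p_def del: of_nat_Suc\<close>)
      finally show ?thesis
        unfolding d by (simp add: power2_eq_square add_divide_distrib)
    qed
    have "Y (x + h) s - Y x s = (\<Sum>k<Suc N. Y (p (Suc k)) s - Y (p k) s)"
      by (subst sum_lessThan_telescope) (simp add: p_def)
    also have "norm \<dots> \<le> (\<Sum>k<Suc N. norm (Y (p (Suc k)) s - Y (p k) s))" by (rule norm_sum)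
    also have "\<dots> \<le> (\<Sum>k<Suc N. (\<Lambda> * norm h + C * (norm h)\<^sup>2 * (1 / real (Suc N))) / real (Suc N))"
      using step by (intro sum_mono) auto
    also have "\<dots> = \<Lambda> * norm h + C * (norm h)\<^sup>2 * (1 / real (Suc N))"
      by (simp only: sum_constant card_lessThan) simp
    finally show ?thesis .
  qed
  \<comment> \<open>The constant \<open>C\<close> depends on the driving path, but each of the
    \<open>Suc N\<close> steps contributes only
    \<open>C * (norm h)\<^sup>2 / (Suc N)\<^sup>2\<close>. In the limit only
    \<open>\<Lambda>\<close> is left.\<close>
  have "(\<lambda>N. \<Lambda> * norm h + C * (norm h)\<^sup>2 * (1 / real (Suc N))) \<longlonglongrightarrow> \<Lambda> * norm h + C * (norm h)\<^sup>2 * 0"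
    using LIMSEQ_inverse_real_of_nat by (intro tendsto_intros) (simp add: inverse_eq_divide)
  then show ?thesis
    using LIMSEQ_le_const[of _ _ "norm (Y (x + h) s - Y x s)"] bound unfolding \<Lambda>_def by fastforce
qed

end

section \<open>The gradient bound\<close>

lemma holder_onD_ordered:
  assumes "holder_on \<alpha> {a..b} f"
  obtains C where "0 \<le> C" "\<And>s t. a \<le> s \<Longrightarrow> s \<le> t \<Longrightarrow> t \<le> b \<Longrightarrow> norm (f t - f s) \<le> C * (t - s) powr \<alpha>"
proof -
  obtain C where C: "\<forall>s\<in>{a..b}. \<forall>t\<in>{a..b}. norm (f s - f t) \<le> C * \<bar>s - t\<bar> powr \<alpha>"
    using assms unfolding holder_on_def by blast
  show thesis
  proof (rule that[of "\<bar>C\<bar>"])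
    fix s t assume st: "a \<le> s" "s \<le> t" "t \<le> b"
    then have "norm (f t - f s) \<le> C * \<bar>t - s\<bar> powr \<alpha>" by (intro C[rule_format]) auto
    also have "\<dots> \<le> \<bar>C\<bar> * \<bar>t - s\<bar> powr \<alpha>" by (intro mult_right_mono) auto
    finally show "norm (f t - f s) \<le> \<bar>C\<bar> * (t - s) powr \<alpha>" using st by simp
  qed simp
qed

text \<open>The exponents in the definition of the Young integral depend on the solution; the regularity
  \<open>\<beta>\<close> of the driving path is recovered from the equation.\<close>

lemma (in young_flow) solves_young_equation_imp_solution:
  assumes eq: "solves_young_equation V g x y"
  shows "solution x y"
proof -
  have "\<forall>t\<in>{0..1}. \<exists>I. (\<forall>i. has_young_integral (\<lambda>s. V i (y s)) (g i) 0 t (I i)) \<and> y t = x + (\<Sum>i\<in>UNIV. I i)"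
    using eq by (simp add: solves_young_equation_def)
  from bchoice[OF this] obtain I where "\<forall>t\<in>{0..1}. (\<forall>i. has_young_integral (\<lambda>s. V i (y s)) (g i) 0 t (I t i)) \<and>
      y t = x + (\<Sum>i\<in>UNIV. I t i)" by blast
  then have I: "has_young_integral (\<lambda>s. V i (y s)) (g i) 0 t (I t i)" and y: "y t = x + (\<Sum>i\<in>UNIV. I t i)"
    if "0 \<le> t" "t \<le> 1" for i t using that by auto
  have RS: "has_riemann_stieltjes_integral (\<lambda>s. V i (y s)) (g i) 0 t (I t i)" if "0 \<le> t" "t \<le> 1" for i t
    using I[OF that] by (simp add: has_young_integral_def)
  \<comment> \<open>The equation at time 0 involves integrals over a single point, and these
    vanish.\<close>
  have y0: "y 0 = x"
    using y[of 0] has_riemann_stieltjes_integral_trivial[OF RS[of 0]] by simp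
  have incr: "y t - y s - germ g (\<lambda>i s. V i (y s)) s t
      = (\<Sum>i\<in>UNIV. I t i - I s i - (g i t - g i s) *\<^sub>R V i (y s))" if "0 \<le> s" "s \<le> t" "t \<le> 1" for s t
    using y[of t] y[of s] that by (simp add: germ_def sum_subtractf)
  have "\<exists>D. \<forall>s t. 0 \<le> s \<longrightarrow> s \<le> t \<longrightarrow> t \<le> 1 \<longrightarrow>
      norm (I t i - I s i - (g i t - g i s) *\<^sub>R V i (y s)) \<le> D * (t - s)" for i
  proof -
    \<comment> \<open>The exponents are taken from the integral over all of \<open>[0, 1]\<close>,
      so they serve every pair of times.\<close>
    obtain \<alpha> \<gamma> where \<alpha>: "0 < \<alpha>" "0 < \<gamma>" "1 < \<alpha> + \<gamma>" "holder_on \<alpha> {0..1} (\<lambda>s. V i (y s))" "holder_on \<gamma> {0..1} (g i)"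
      using I[of 1 i] by (auto simp: has_young_integral_def)
    obtain C where C: "0 \<le> C" "\<And>s t. 0 \<le> s \<Longrightarrow> s \<le> t \<Longrightarrow> t \<le> 1 \<Longrightarrow> norm (V i (y t) - V i (y s)) \<le> C * (t - s) powr \<alpha>"
      by (rule holder_onD_ordered[OF \<alpha>(4)]) (rule that; assumption)
    obtain C' where C': "0 \<le> C'" "\<And>s t. 0 \<le> s \<Longrightarrow> s \<le> t \<Longrightarrow> t \<le> 1 \<Longrightarrow> norm (g i t - g i s) \<le> C' * (t - s) powr \<gamma>"
      by (rule holder_onD_ordered[OF \<alpha>(5)]) (rule that; assumption)
    let ?D = "C * C' / (1 - 2 powr (1 - (\<alpha> + \<gamma>)))"
    have D: "0 \<le> ?D" using C(1) C'(1) two_powr_less_1[OF \<alpha>(3)] by simp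
    have "norm (I t i - I s i - (g i t - g i s) *\<^sub>R V i (y s)) \<le> ?D * (t - s)" if st: "0 \<le> s" "s \<le> t" "t \<le> 1" for s t
    proof -
      have "norm (I t i - I s i - (g i t - g i s) *\<^sub>R V i (y s)) \<le> ?D * (t - s) powr (\<alpha> + \<gamma>)"
        by (rule young_loeve_estimate[where a = 0 and b = 1])
          (use \<alpha> C C' RS st in auto)
      \<comment> \<open>In a first pass the unknown exponent above 1 is lowered to 1, which is
        enough to show that \<open>y\<close> is Hoelder of order \<open>\<beta>\<close>.\<close>
      also have "\<dots> \<le> ?D * (t - s) powr 1"
        using \<alpha> st D by (intro mult_left_mono powr_mono') auto
      finally show ?thesis using st by simp
    qed
    then show ?thesis by blast
  qed
  then obtain D where D: "\<And>i s t. 0 \<le> s \<Longrightarrow> s \<le> t \<Longrightarrow> t \<le> 1 \<Longrightarrow>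
      norm (I t i - I s i - (g i t - g i s) *\<^sub>R V i (y s)) \<le> D i * (t - s)" by metis
  define L where "L = CARD('n) * G * K + (\<Sum>i\<in>UNIV. \<bar>D i\<bar>)"
  have L: "0 \<le> L" using G K by (auto simp: L_def intro!: add_nonneg_nonneg sum_nonneg)
  have yL: "norm (y t - y s) \<le> L * (t - s) powr \<beta>" if st: "0 \<le> s" "s \<le> t" "t \<le> 1" for s t
  proof -
    have "norm (y t - y s) \<le> norm (germ g (\<lambda>i s. V i (y s)) s t) + norm (y t - y s - germ g (\<lambda>i s. V i (y s)) s t)"
      by (metis norm_triangle_sub)
    also have "norm (germ g (\<lambda>i s. V i (y s)) s t) \<le> CARD('n) * G * K * (t - s) powr \<beta>"
      using taylor_norm[OF tb] K st by (intro norm_germ_le[OF g]) auto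
    also have "norm (y t - y s - germ g (\<lambda>i s. V i (y s)) s t) \<le> (\<Sum>i\<in>UNIV. \<bar>D i\<bar>) * (t - s) powr \<beta>"
      unfolding incr[OF st] sum_distrib_right
    proof (intro order_trans[OF norm_sum] sum_mono)
      fix i
      have "norm (I t i - I s i - (g i t - g i s) *\<^sub>R V i (y s)) \<le> D i * (t - s) powr 1"
        using D[OF st, of i] st by simp
      also have "\<dots> \<le> \<bar>D i\<bar> * (t - s) powr \<beta>"
        using st \<beta> by (intro mult_mono powr_mono') auto
      finally show "norm (I t i - I s i - (g i t - g i s) *\<^sub>R V i (y s)) \<le> \<bar>D i\<bar> * (t - s) powr \<beta>" .
    qed
    finally show ?thesis by (simp add: L_def algebra_simps)
  qed
  have VL: "norm (V i (y t) - V i (y s)) \<le> K * L * (t - s) powr \<beta>" if st: "0 \<le> s" "s \<le> t" "t \<le> 1" for i s t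
    using taylor_lipschitz[OF tb, of i "y t" "y s"] mult_left_mono[OF yL[OF st] K] by simp
  \<comment> \<open>In a second pass the integrand and the driver both have the exponent
    \<open>\<beta>\<close>, and the same estimate gives the order
    \<open>2 * \<beta>\<close>.\<close>
  let ?D = "K * L * G / (1 - 2 powr (1 - (\<beta> + \<beta>)))"
  have "norm (y t - y s - germ g (\<lambda>i s. V i (y s)) s t) \<le> (\<Sum>i\<in>(UNIV :: 'n set). ?D) * (t - s) powr (2 * \<beta>)"
    if st: "0 \<le> s" "s \<le> t" "t \<le> 1" for s t
    unfolding incr[OF st] sum_distrib_right
  proof (intro order_trans[OF norm_sum] sum_mono)
    fix i
    have "norm (I t i - I s i - (g i t - g i s) *\<^sub>R V i (y s)) \<le> ?D * (t - s) powr (\<beta> + \<beta>)"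
      by (rule young_loeve_estimate[where a = 0 and b = 1])
        (use \<beta> K L G VL RS st holder_constD[OF g] in auto)
    then show "norm (I t i - I s i - (g i t - g i s) *\<^sub>R V i (y s)) \<le> ?D * (t - s) powr (2 * \<beta>)"
      by (simp only: mult_2)
  qed
  then show ?thesis using y0 unfolding solution_def davie_def by blast
qed

text \<open>A basis at \<open>x\<close> makes \<open>frame_map V x\<close> injective and so bounded
  below; Lipschitz continuity preserves half of the bound nearby. The basis property at each point
  gives no constant uniform over the whole space, hence the restriction to a ball.\<close>

lemma frame_lower_bound:
  fixes V :: "'n::finite \<Rightarrow> real ^ 'n \<Rightarrow> real ^ 'n"
  assumes basis: "is_basis (\<lambda>i. V i x)" and K: "0 \<le> K" "\<And>i p. norm (V i p - V i x) \<le> K * norm (p - x)"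
  obtains c r where "0 < c" "0 < r" "\<And>p \<xi>. norm (p - x) \<le> r \<Longrightarrow> c * norm \<xi> \<le> norm (frame_map V p \<xi>)"
proof -
  have lin: "linear (frame_map V x)"
    by (intro linearI) (auto simp: frame_map_def vec_eq_iff inner_add_right)
  have "\<xi> = 0" if "frame_map V x \<xi> = 0" for \<xi>
  proof -
    have "orthogonal \<xi> v" if "v \<in> range (\<lambda>i. V i x)" for v
      using that \<open>frame_map V x \<xi> = 0\<close> by (auto simp: frame_map_def vec_eq_iff orthogonal_def inner_commute)
    then have "orthogonal \<xi> \<xi>"
      using orthogonal_to_span[of \<xi> "range (\<lambda>i. V i x)" \<xi>] basis by (simp add: is_basis_def)
    then show ?thesis by (simp add: orthogonal_self)
  qed
  then have "inj (frame_map V x)" using linear_injective_0[OF lin] by blast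
  then obtain B where B: "0 < B" "\<And>\<xi>. B * norm \<xi> \<le> norm (frame_map V x \<xi>)"
    using linear_inj_bounded_below_pos[OF lin] by blast
  \<comment> \<open>The summand 1 keeps the denominator positive when \<open>K = 0\<close>.\<close>
  define r where "r = B / (2 * (CARD('n) * K + 1))"
  have d: "0 < real (CARD('n)) * K + 1" using K(1) by (simp add: add_nonneg_pos)
  have r: "0 < r" using B d by (simp add: r_def)
  show thesis
  proof (rule that[of "B / 2" r])
    fix p \<xi> assume p: "norm (p - x) \<le> r"
    have "norm (frame_map V x \<xi> - frame_map V p \<xi>) \<le> (\<Sum>k\<in>UNIV. \<bar>(V k x - V k p) \<bullet> \<xi>\<bar>)"
      using norm_le_l1_cart[of "frame_map V x \<xi> - frame_map V p \<xi>"] by (simp add: frame_map_def inner_diff_left)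
    also have "\<dots> \<le> (\<Sum>k\<in>(UNIV :: 'n set). K * r * norm \<xi>)"
    proof (intro sum_mono order_trans[OF Cauchy_Schwarz_ineq2] mult_right_mono)
      fix k show "norm (V k x - V k p) \<le> K * r"
        using K(2)[of k p] mult_left_mono[OF p K(1)] by (simp add: norm_minus_commute)
    qed auto
    also have "\<dots> = (CARD('n) * K) * r * norm \<xi>" by simp
    also have "\<dots> \<le> (CARD('n) * K + 1) * r * norm \<xi>" using r by (intro mult_right_mono) auto
    also have "\<dots> = B / 2 * norm \<xi>" using d by (simp add: r_def field_simps)
    finally have "norm (frame_map V x \<xi> - frame_map V p \<xi>) \<le> B / 2 * norm \<xi>" .
    then show "B / 2 * norm \<xi> \<le> norm (frame_map V p \<xi>)"
      using B(2)[of \<xi>] norm_triangle_ineq2[of "frame_map V x \<xi>" "frame_map V p \<xi>"] by simp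
  qed (use B r in auto)
qed

lemma borel_measurable_matrix:
  fixes F :: "'a \<Rightarrow> real ^ 'n ^ 'm"
  assumes "\<And>i j. (\<lambda>w. F w $ i $ j) \<in> borel_measurable M"
  shows "F \<in> borel_measurable M"
  unfolding borel_measurable_euclidean_space[of F]
proof
  fix b :: "real ^ 'n ^ 'm" assume "b \<in> Basis"
  then obtain i u where "b = axis i u" "u \<in> Basis" unfolding Basis_vec_def by blast
  moreover from this obtain j where "u = axis j 1" unfolding Basis_vec_def by auto
  ultimately have "b = axis i (axis j 1)" by simp
  then show "(\<lambda>w. F w \<bullet> b) \<in> borel_measurable M" using assms by (simp add: inner_axis)
qed

section \<open>Almost sure statements for the flow at a fixed time\<close>

locale fbm_flow = prob_space M
  for M :: "'w measure" +
  fixes \<beta> K :: real and B :: "'n::finite \<Rightarrow> real \<Rightarrow> 'w \<Rightarrow> real"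
    and V :: "'n \<Rightarrow> real ^ 'n \<Rightarrow> real ^ 'n" and A :: "'n \<Rightarrow> real ^ 'n \<Rightarrow> real ^ 'n ^ 'n"
    and \<omega> :: "'n \<Rightarrow> 'n \<Rightarrow> 'n \<Rightarrow> real ^ 'n \<Rightarrow> real"
    and X :: "real ^ 'n \<Rightarrow> real \<Rightarrow> 'w \<Rightarrow> real ^ 'n" and t :: real
  assumes \<beta>: "1 / 2 < \<beta>" "\<beta> \<le> 1"
    and holder: "AE w in M. \<exists>G\<ge>0. \<forall>i. holder_const \<beta> G (\<lambda>t. B i t w)"
    and tb: "\<And>i. taylor_bounds K (V i) (A i)"
    and basis: "\<And>p. is_basis (\<lambda>i. V i p)"
    and bracket: "\<And>i k p. A k p *v V i p - A i p *v V k p = (\<Sum>l\<in>UNIV. \<omega> i k l p *\<^sub>R V l p)"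
    and skew: "\<And>i k l p. \<omega> i k l p = - \<omega> i l k p"
    and t: "0 \<le> t" "t \<le> 1"
    and X_measurable [measurable]: "\<And>p. X p t \<in> borel_measurable M"
    and X_solves: "\<And>p. AE w in M. solves_young_equation V (\<lambda>i s. B i s w) p (\<lambda>s. X p s w)"
begin

text \<open>The gateway from probability to the pathwise theory: the null sets of countably many
  starting points are merged into one, off which the path-by-path locale can be interpreted with a
  random \<open>G\<close>.\<close>

lemma AE_skew_young_flow:
  assumes "countable S"
  shows "AE w in M. \<exists>G. skew_young_flow \<beta> G K (\<lambda>i s. B i s w) V A \<omega> \<and>
    (\<forall>p\<in>S. young_flow.solution \<beta> (\<lambda>i s. B i s w) V p (\<lambda>s. X p s w))"
proof -
  have "AE w in M. \<forall>p\<in>S. solves_young_equation V (\<lambda>i s. B i s w) p (\<lambda>s. X p s w)"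
    using X_solves assms by (subst AE_ball_countable) auto
  with holder show ?thesis
  proof eventually_elim
    case (elim w)
    then obtain G where G: "0 \<le> G" "\<And>i. holder_const \<beta> G (\<lambda>t. B i t w)" by blast
    interpret skew_young_flow \<beta> G K "\<lambda>i s. B i s w" V A \<omega>
      by unfold_locales (rule \<beta> G tb bracket skew)+
    show ?case
      using elim(2)
      by (intro exI[of _ G] conjI ballI skew_young_flow_axioms solves_young_equation_imp_solution) auto
  qed
qed

definition perturbed :: "real ^ 'n \<Rightarrow> 'n \<Rightarrow> nat \<Rightarrow> real ^ 'n" where
  "perturbed p j m = p + (1 / real (Suc m)) *\<^sub>R axis j 1"

text \<open>The exceptional null set of \<open>X p\<close> depends on \<open>p\<close>, so the derivative is defined from countably many
  starting points.\<close>

definition DX :: "real ^ 'n \<Rightarrow> 'w \<Rightarrow> real ^ 'n ^ 'n" where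
  "DX p w = flow_derivative (\<lambda>s. X p s w) (\<lambda>j m s. X (perturbed p j m) s w) t"

lemma DX_measurable [measurable]: "DX p \<in> borel_measurable M"
proof -
  have [measurable]: "(\<lambda>w. X p t w $ i) \<in> borel_measurable M" for p i
    by (rule measurable_compose[OF X_measurable borel_measurable_continuous_onI]) (intro continuous_intros)
  have "(\<lambda>w. difference_quotient (\<lambda>s. X p s w) (\<lambda>j m s. X (perturbed p j m) s w) m t) \<in> borel_measurable M" for m
    unfolding difference_quotient_def
    by (rule borel_measurable_matrix) simp
  then show ?thesis
    unfolding DX_def[abs_def] flow_derivative_def by (rule borel_measurable_lim_metric)
qed

text \<open>The constant is random but common to the whole sequence. Sequences suffice because the
  derivative of the expectation is tested along sequences.\<close>

lemma AE_remainder: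
  fixes xs :: "nat \<Rightarrow> real ^ 'n"
  shows "AE w in M. \<exists>C. \<forall>n. norm (X (xs n) t w - X p t w - DX p w *v (xs n - p)) \<le> C * (norm (xs n - p))\<^sup>2"
proof -
  let ?S = "insert p (range (\<lambda>(j, m). perturbed p j m) \<union> range xs)"
  have "countable ?S" by simp
  from AE_skew_young_flow[OF this] show ?thesis
  proof eventually_elim
    case (elim w)
    then obtain G where "skew_young_flow \<beta> G K (\<lambda>i s. B i s w) V A \<omega>"
      and sol: "\<And>p. p \<in> ?S \<Longrightarrow> young_flow.solution \<beta> (\<lambda>i s. B i s w) V p (\<lambda>s. X p s w)" by blast
    then interpret skew_young_flow \<beta> G K "\<lambda>i s. B i s w" V A \<omega> by simp
    have "solution (p + (1 / real (Suc m)) *\<^sub>R axis j 1) (\<lambda>s. X (perturbed p j m) s w)" for j m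
      using sol[of "perturbed p j m"] by (force simp: perturbed_def)
    from flow_derivative_remainder[OF sol[of p] this sol[of "xs n" for n] t]
    show ?case unfolding DX_def by auto
  qed
qed

lemma AE_frame_map: "AE w in M. \<forall>\<xi>. norm (frame_map V p (\<xi> v* DX p w)) = norm (frame_map V (X p t w) \<xi>)"
proof -
  let ?S = "insert p (range (\<lambda>(j, m). perturbed p j m))"
  have "countable ?S" by simp
  from AE_skew_young_flow[OF this] show ?thesis
  proof eventually_elim
    case (elim w)
    then obtain G where "skew_young_flow \<beta> G K (\<lambda>i s. B i s w) V A \<omega>"
      and sol: "\<And>p. p \<in> ?S \<Longrightarrow> young_flow.solution \<beta> (\<lambda>i s. B i s w) V p (\<lambda>s. X p s w)" by blast
    then interpret skew_young_flow \<beta> G K "\<lambda>i s. B i s w" V A \<omega> by simp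
    have "solution (p + (1 / real (Suc m)) *\<^sub>R axis j 1) (\<lambda>s. X (perturbed p j m) s w)" for j m
      using sol[of "perturbed p j m"] by (force simp: perturbed_def)
    from frame_map_flow_derivative[OF sol[of p] this t] show ?case unfolding DX_def by auto
  qed
qed

lemma AE_norm_DX_le:
  assumes c: "0 < c" "\<And>\<xi>. c * norm \<xi> \<le> norm (frame_map V p \<xi>)"
  shows "AE w in M. \<forall>v. norm (DX p w *v v) \<le> CARD('n) * K / c * norm v"
proof -
  let ?S = "insert p (range (\<lambda>(j, m). perturbed p j m))"
  have "countable ?S" by simp
  from AE_skew_young_flow[OF this] show ?thesis
  proof eventually_elim
    case (elim w)
    then obtain G where "skew_young_flow \<beta> G K (\<lambda>i s. B i s w) V A \<omega>"
      and sol: "\<And>p. p \<in> ?S \<Longrightarrow> young_flow.solution \<beta> (\<lambda>i s. B i s w) V p (\<lambda>s. X p s w)" by blast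
    then interpret skew_young_flow \<beta> G K "\<lambda>i s. B i s w" V A \<omega> by simp
    have "solution (p + (1 / real (Suc m)) *\<^sub>R axis j 1) (\<lambda>s. X (perturbed p j m) s w)" for j m
      using sol[of "perturbed p j m"] by (force simp: perturbed_def)
    from norm_flow_derivative_le[OF sol[of p] this t c] show ?case unfolding DX_def by auto
  qed
qed

text \<open>The constant is deterministic, which makes it usable as a dominating bound.\<close>

lemma AE_lipschitz:
  assumes c: "0 < c" "\<And>r \<xi>. 0 \<le> r \<Longrightarrow> r \<le> 1 \<Longrightarrow> c * norm \<xi> \<le> norm (frame_map V (p + r *\<^sub>R h) \<xi>)"
  shows "AE w in M. norm (X (p + h) t w - X p t w) \<le> CARD('n) * K / c * norm h"
proof -
  let ?q = "\<lambda>k N. p + (real k / real (Suc N)) *\<^sub>R h"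
  let ?S = "range (\<lambda>(k, N). ?q k N) \<union> range (\<lambda>(k, N, j, m). perturbed (?q k N) j m)"
  have "countable ?S" by simp
  from AE_skew_young_flow[OF this] show ?thesis
  proof eventually_elim
    case (elim w)
    then obtain G where "skew_young_flow \<beta> G K (\<lambda>i s. B i s w) V A \<omega>"
      and sol: "\<And>p. p \<in> ?S \<Longrightarrow> young_flow.solution \<beta> (\<lambda>i s. B i s w) V p (\<lambda>s. X p s w)" by blast
    then interpret skew_young_flow \<beta> G K "\<lambda>i s. B i s w" V A \<omega> by simp
    have "solution (?q k N) (\<lambda>s. X (?q k N) s w)" for k N
      by (rule sol) auto
    moreover have "solution (perturbed (?q k N) j m) (\<lambda>s. X (perturbed (?q k N) j m) s w)" for k N j m
      by (rule sol, rule UnI2, rule image_eqI[where x = "(k, N, j, m)"]) auto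
    ultimately show ?case
      using solution_lipschitz_chain[of p h "\<lambda>p s. X p s w", OF _ _ c t] by (simp add: perturbed_def)
  qed
qed

section \<open>Differentiation under the expectation and the gradient inequality\<close>

context
  fixes f :: "real ^ 'n \<Rightarrow> real"
  assumes f: "smooth_bounded f"
begin

definition gradient :: "real ^ 'n \<Rightarrow> real ^ 'n" where
  "gradient p = (\<chi> j. iterated_partial [j] f p)"

lemma gradient_has_derivative: "(f has_derivative (\<lambda>v. gradient p \<bullet> v)) (at p)"
  using smooth_bounded_has_derivative[OF f, of p] by (simp add: gradient_def inner_vec_def mult.commute)

lemma f_measurable [measurable]: "f \<in> borel_measurable borel"
  using smooth_bounded_continuous[OF f] by (rule borel_measurable_continuous_onI)

lemma gradient_continuous: "continuous_on UNIV gradient"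
  unfolding gradient_def
  by (intro continuous_on_vec_lambda smooth_bounded_continuous smooth_bounded_partial[OF f])

lemma gradient_measurable [measurable]: "gradient \<in> borel_measurable borel"
  using gradient_continuous by (rule borel_measurable_continuous_onI)

lemma gradient_bounded:
  obtains C where "0 < C" "\<And>p. norm (gradient p) \<le> C"
proof -
  obtain C where C: "0 < C" "\<And>j p. norm (iterated_partial [j] f p) \<le> C"
    by (rule smooth_bounded_partial_bound[OF f]) (rule that; assumption)
  have "norm (gradient p) \<le> CARD('n) * C" for p
  proof -
    have "norm (gradient p) \<le> (\<Sum>j\<in>UNIV. \<bar>gradient p $ j\<bar>)" by (rule norm_le_l1_cart)
    also have "\<dots> \<le> (\<Sum>j\<in>(UNIV :: 'n set). C)" using C(2) by (intro sum_mono) (simp add: gradient_def)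
    finally show ?thesis by simp
  qed
  then show thesis using C(1) by (intro that[of "CARD('n) * C"]) auto
qed

lemma carre_du_champ_eq: "sqrt (carre_du_champ V f p) = norm (frame_map V p (gradient p))"
proof -
  have "lie_derivative (V i) f p = V i p \<bullet> gradient p" for i
    using fun_cong[OF frechet_derivative_at[OF gradient_has_derivative[of p]], of "V i p"]
    by (simp add: lie_derivative_def inner_commute)
  then show ?thesis
    by (simp add: carre_du_champ_def frame_map_def norm_vec_def L2_set_def)
qed

lemma mult_DX_measurable [measurable]: "(\<lambda>w. DX p w *v v) \<in> borel_measurable M"
proof -
  have "linear (\<lambda>A :: real ^ 'n ^ 'n. A *v v)"
    by (intro linearI) (auto simp: matrix_vector_mult_add_rdistrib scaleR_matrix_vector_assoc)
  then have "continuous_on UNIV (\<lambda>A :: real ^ 'n ^ 'n. A *v v)"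
    by (simp add: linear_continuous_on linear_conv_bounded_linear)
  from measurable_compose[OF DX_measurable borel_measurable_continuous_onI[OF this]] show ?thesis .
qed

text \<open>Dominated convergence with a division of labour: pointwise convergence of the remainders
  uses \<open>AE_remainder\<close> with its random constant, domination uses
  \<open>AE_lipschitz\<close> and \<open>AE_norm_DX_le\<close> with deterministic ones.\<close>

lemma transition_operator_has_derivative:
  "(transition_operator M X t f has_derivative (\<lambda>v. expectation (\<lambda>w. gradient (X x t w) \<bullet> (DX x w *v v)))) (at x)"
  "integrable M (\<lambda>w. gradient (X x t w) \<bullet> (DX x w *v v))"
proof -
  obtain c r where c: "0 < c" "0 < r" "\<And>p \<xi>. norm (p - x) \<le> r \<Longrightarrow> c * norm \<xi> \<le> norm (frame_map V p \<xi>)"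
    by (rule frame_lower_bound[OF basis taylor_nonneg[OF tb] taylor_lipschitz[OF tb], of x]) (rule that; assumption)
  define \<Lambda> where "\<Lambda> = CARD('n) * K / c"
  have \<Lambda>: "0 \<le> \<Lambda>" using c(1) taylor_nonneg[OF tb] by (simp add: \<Lambda>_def)
  have JL: "AE w in M. \<forall>v. norm (DX x w *v v) \<le> \<Lambda> * norm v"
    unfolding \<Lambda>_def using c by (intro AE_norm_DX_le) auto
  obtain Q where Q: "0 < Q" "\<And>p. norm (gradient p) \<le> Q"
    by (rule gradient_bounded) (rule that; assumption)
  define D where "D w v = gradient (X x t w) \<bullet> (DX x w *v v)" for w v
  have D_meas [measurable]: "(\<lambda>w. D w v) \<in> borel_measurable M" for v
    unfolding D_def by measurable
  have D_le: "AE w in M. \<forall>v. norm (D w v) \<le> Q * \<Lambda> * norm v"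
    using JL
  proof eventually_elim
    case (elim w)
    show ?case
    proof
      fix v
      have "norm (D w v) \<le> norm (gradient (X x t w)) * norm (DX x w *v v)"
        unfolding D_def real_norm_def by (rule Cauchy_Schwarz_ineq2)
      also have "\<dots> \<le> Q * (\<Lambda> * norm v)" using Q elim by (intro mult_mono) auto
      finally show "norm (D w v) \<le> Q * \<Lambda> * norm v" by simp
    qed
  qed
  have D_int: "integrable M (\<lambda>w. D w v)" for v
    by (rule integrable_const_bound[where B = "Q * \<Lambda> * norm v"]) (use D_le in auto)
  show "integrable M (\<lambda>w. gradient (X x t w) \<bullet> (DX x w *v v))" for v
    using D_int[of v] by (simp add: D_def)
  obtain Cf where Cf: "0 < Cf" "\<And>p. norm (f p) \<le> Cf"
    by (rule smooth_bounded_bound[OF f]) (rule that; assumption)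
  have f_int: "integrable M (\<lambda>w. f (X p t w))" for p
    by (rule integrable_const_bound[where B = Cf]) (use Cf in auto)
  obtain T where T: "0 < T" "\<And>p q. norm (f q - f p - gradient p \<bullet> (q - p)) \<le> T * (norm (q - p))\<^sup>2"
  proof -
    obtain T where "0 < T"
      "\<And>p q. norm (f q - f p - (\<Sum>j\<in>UNIV. (q - p) $ j *\<^sub>R iterated_partial [j] f p)) \<le> T * (norm (q - p))\<^sup>2"
      by (rule smooth_bounded_taylor[OF f]) (rule that; assumption)
    then show thesis by (intro that[of T]) (simp_all add: gradient_def inner_vec_def mult.commute)
  qed
  have lin: "bounded_linear (\<lambda>v. expectation (\<lambda>w. D w v))"
  proof (rule bounded_linear_intro[where K = "Q * \<Lambda>"])
    show "expectation (\<lambda>w. D w (u + v)) = expectation (\<lambda>w. D w u) + expectation (\<lambda>w. D w v)" for u v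
      using D_int by (simp add: D_def matrix_vector_right_distrib inner_add_right)
    show "expectation (\<lambda>w. D w (a *\<^sub>R v)) = a *\<^sub>R expectation (\<lambda>w. D w v)" for a v
      by (simp add: D_def matrix_vector_mult_scaleR)
    show "norm (expectation (\<lambda>w. D w v)) \<le> norm v * (Q * \<Lambda>)" for v
    proof -
      have "norm (expectation (\<lambda>w. D w v)) \<le> expectation (\<lambda>w. norm (D w v))" by (rule integral_norm_bound)
      also have "\<dots> \<le> expectation (\<lambda>w. Q * \<Lambda> * norm v)"
        using D_le D_int by (intro integral_mono_AE) auto
      finally show ?thesis by (simp add: prob_space mult_ac)
    qed
  qed
  \<comment> \<open>Restricting to the ball keeps all sequences in the region where the frame is
    bounded below by \<open>c\<close>. As the ball is open, the restriction is lifted at the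
    end.\<close>
  have "(transition_operator M X t f has_derivative (\<lambda>v. expectation (\<lambda>w. D w v))) (at x within ball x r)"
    unfolding has_derivative_iff_norm
  proof (intro conjI lin, unfold tendsto_at_iff_sequentially, intro allI impI)
    fix xs :: "nat \<Rightarrow> real ^ 'n" assume xs: "\<forall>n. xs n \<in> ball x r - {x}" "xs \<longlonglongrightarrow> x"
    define h where "h n = xs n - x" for n
    have h: "0 < norm (h n)" "norm (h n) < r" "xs n = x + h n" for n
      using xs(1) by (auto simp: h_def dist_norm norm_minus_commute)
    have h0: "(\<lambda>n. norm (h n)) \<longlonglongrightarrow> 0"
      using xs(2) unfolding h_def by (intro tendsto_norm_zero) (simp add: LIM_zero)
    have XL: "AE w in M. \<forall>n. norm (X (xs n) t w - X x t w) \<le> \<Lambda> * norm (h n)"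
    proof (subst AE_all_countable, intro allI)
      fix n
      have "norm (x + a *\<^sub>R h n - x) \<le> r" if "0 \<le> a" "a \<le> 1" for a
        using h(2)[of n] mult_right_mono[of a 1 "norm (h n)"] that by simp
      then show "AE w in M. norm (X (xs n) t w - X x t w) \<le> \<Lambda> * norm (h n)"
        unfolding h(3) \<Lambda>_def using c by (intro AE_lipschitz) auto
    qed
    define q where "q n w = (f (X (xs n) t w) - f (X x t w) - D w (h n)) / norm (h n)" for n w
    have "(\<lambda>n. expectation (q n)) \<longlonglongrightarrow> expectation (\<lambda>_. 0)"
    proof (rule integral_dominated_convergence)
      show "q n \<in> borel_measurable M" for n unfolding q_def by measurable
      \<comment> \<open>One \<open>Q * \<Lambda>\<close> bounds the linear part of the increment of
        \<open>f\<close>, the other the candidate derivative;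
        \<open>T * \<Lambda>\<^sup>2 * r\<close> bounds the Taylor remainder of \<open>f\<close>, as
        \<open>norm (h n) < r\<close>.\<close>
      show "integrable M (\<lambda>_. T * \<Lambda>\<^sup>2 * r + 2 * Q * \<Lambda>)" by simp
      show "AE w in M. norm (q n w) \<le> T * \<Lambda>\<^sup>2 * r + 2 * Q * \<Lambda>" for n
        using XL D_le
      proof eventually_elim
        case (elim w)
        let ?d = "X (xs n) t w - X x t w"
        have "norm (f (X (xs n) t w) - f (X x t w)) \<le> norm (gradient (X x t w) \<bullet> ?d) + T * (norm ?d)\<^sup>2"
          using T(2)[of "X (xs n) t w" "X x t w"] unfolding real_norm_def by linarith
        also have "norm (gradient (X x t w) \<bullet> ?d) \<le> Q * (\<Lambda> * norm (h n))"
          using Q elim(1) unfolding real_norm_def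
          by (intro order_trans[OF Cauchy_Schwarz_ineq2] mult_mono) auto
        also have "T * (norm ?d)\<^sup>2 \<le> T * (\<Lambda> * norm (h n))\<^sup>2"
          using elim(1) T(1) by (intro mult_left_mono power_mono) auto
        finally have "norm (f (X (xs n) t w) - f (X x t w)) \<le> Q * (\<Lambda> * norm (h n)) + T * (\<Lambda> * norm (h n))\<^sup>2" by simp
        moreover have "norm (D w (h n)) \<le> Q * \<Lambda> * norm (h n)" using elim(2) by blast
        ultimately have "norm (f (X (xs n) t w) - f (X x t w) - D w (h n))
            \<le> Q * (\<Lambda> * norm (h n)) + T * (\<Lambda> * norm (h n))\<^sup>2 + Q * \<Lambda> * norm (h n)"
          by (meson add_mono norm_triangle_ineq4 order_trans)
        also have "\<dots> = (T * \<Lambda>\<^sup>2 * norm (h n) + 2 * Q * \<Lambda>) * norm (h n)"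
          by (simp add: power2_eq_square algebra_simps)
        also have "\<dots> \<le> (T * \<Lambda>\<^sup>2 * r + 2 * Q * \<Lambda>) * norm (h n)"
          using T(1) h(2)[of n] by (intro mult_right_mono add_right_mono mult_left_mono) auto
        finally show ?case using h(1)[of n] by (simp add: q_def pos_divide_le_eq)
      qed
      show "AE w in M. (\<lambda>n. q n w) \<longlonglongrightarrow> 0"
        using XL AE_remainder[of xs x]
      proof eventually_elim
        case (elim w)
        then obtain C where C: "\<And>n. norm (X (xs n) t w - X x t w - DX x w *v h n) \<le> C * (norm (h n))\<^sup>2"
          by (auto simp: h_def)
        show ?case
        proof (rule Lim_null_comparison[OF always_eventually], rule allI)
          fix n
          let ?d = "X (xs n) t w - X x t w"
          have "f (X (xs n) t w) - f (X x t w) - D w (h n)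
              = (f (X (xs n) t w) - f (X x t w) - gradient (X x t w) \<bullet> ?d) + gradient (X x t w) \<bullet> (?d - DX x w *v h n)"
            by (simp add: D_def inner_diff_right)
          then have "norm (f (X (xs n) t w) - f (X x t w) - D w (h n))
              \<le> norm (f (X (xs n) t w) - f (X x t w) - gradient (X x t w) \<bullet> ?d) + norm (gradient (X x t w) \<bullet> (?d - DX x w *v h n))"
            by (simp only: norm_triangle_ineq)
          also have "\<dots> \<le> T * (\<Lambda> * norm (h n))\<^sup>2 + Q * (C * (norm (h n))\<^sup>2)"
          proof (rule add_mono)
            have "norm (f (X (xs n) t w) - f (X x t w) - gradient (X x t w) \<bullet> ?d) \<le> T * (norm ?d)\<^sup>2" by (rule T(2))
            also have "\<dots> \<le> T * (\<Lambda> * norm (h n))\<^sup>2"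
              using elim(1) T(1) by (intro mult_left_mono power_mono) auto
            finally show "norm (f (X (xs n) t w) - f (X x t w) - gradient (X x t w) \<bullet> ?d) \<le> T * (\<Lambda> * norm (h n))\<^sup>2" .
            show "norm (gradient (X x t w) \<bullet> (?d - DX x w *v h n)) \<le> Q * (C * (norm (h n))\<^sup>2)"
              using Q C[of n] unfolding real_norm_def
              by (intro order_trans[OF Cauchy_Schwarz_ineq2] mult_mono) auto
          qed
          also have "\<dots> = (T * \<Lambda>\<^sup>2 + Q * C) * norm (h n) * norm (h n)"
            by (simp add: power2_eq_square algebra_simps)
          finally show "norm (q n w) \<le> (T * \<Lambda>\<^sup>2 + Q * C) * norm (h n)"
            using h(1)[of n] by (simp add: q_def pos_divide_le_eq)
        qed (use tendsto_mult_right_zero[OF h0] in auto)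
      qed
    qed auto
    moreover have "expectation (q n) = (transition_operator M X t f (xs n) - transition_operator M X t f x - expectation (\<lambda>w. D w (h n))) / norm (h n)" for n
    proof -
      have "q n = (\<lambda>w. (f (X (xs n) t w) - f (X x t w) - D w (h n)) / norm (h n))" by (simp add: q_def fun_eq_iff)
      then show ?thesis using f_int D_int by (simp add: transition_operator_def)
    qed
    ultimately have "(\<lambda>n. norm ((transition_operator M X t f (xs n) - transition_operator M X t f x - expectation (\<lambda>w. D w (h n))) / norm (h n))) \<longlonglongrightarrow> 0"
      by (intro tendsto_norm_zero) simp
    then show "((\<lambda>y. norm (transition_operator M X t f y - transition_operator M X t f x - expectation (\<lambda>w. D w (y - x))) / norm (y - x)) \<circ> xs) \<longlonglongrightarrow> 0"
      by (simp add: o_def h_def)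
  qed
  then show "(transition_operator M X t f has_derivative (\<lambda>v. expectation (\<lambda>w. gradient (X x t w) \<bullet> (DX x w *v v)))) (at x)"
    using c(2) by (simp add: D_def at_within_open[of x "ball x r"])
qed

theorem gradient_bound:
  "sqrt (carre_du_champ V (transition_operator M X t f) x)
    \<le> transition_operator M X t (\<lambda>y. sqrt (carre_du_champ V f y)) x"
proof -
  define Y where "Y w = frame_map V x (gradient (X x t w) v* DX x w)" for w
  have Y_nth: "Y w $ i = gradient (X x t w) \<bullet> (DX x w *v V i x)" for w i
    by (simp add: Y_def frame_map_def dot_lmul_matrix inner_commute[of "V i x"])
  note int = transition_operator_has_derivative(2)[of x]
  have Y_int: "integrable M Y"
  proof -
    have "integrable M (\<lambda>w. \<Sum>i\<in>UNIV. Y w $ i *\<^sub>R axis i (1 :: real))"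
      using int by (intro Bochner_Integration.integrable_sum integrable_scaleR_left) (simp add: Y_nth)
    moreover have "(\<Sum>i\<in>UNIV. Y w $ i *\<^sub>R axis i (1 :: real)) = Y w" for w
      using basis_expansion[of "Y w"] by (simp add: scalar_mult_eq_scaleR)
    ultimately show ?thesis by simp
  qed
  have lie: "lie_derivative (V i) (transition_operator M X t f) x = expectation Y $ i" for i
  proof -
    have "lie_derivative (V i) (transition_operator M X t f) x = expectation (\<lambda>w. Y w $ i)"
      using fun_cong[OF frechet_derivative_at[OF transition_operator_has_derivative(1)[of x]], of "V i x"]
      by (simp add: lie_derivative_def Y_nth)
    then show ?thesis
      using integral_bounded_linear[OF bounded_linear_vec_nth Y_int] by simp
  qed
  have "sqrt (carre_du_champ V (transition_operator M X t f) x) = norm (expectation Y)"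
    by (simp add: carre_du_champ_def lie norm_vec_def L2_set_def)
  also have "\<dots> \<le> expectation (\<lambda>w. norm (Y w))" by (rule integral_norm_bound)
  \<comment> \<open>The isometry of \<open>AE_frame_map\<close> at the random covector
    \<open>gradient (X x t w)\<close>; its exceptional set is common to all covectors, so a random
    one may be inserted.\<close>
  also have "\<dots> = expectation (\<lambda>w. norm (frame_map V (X x t w) (gradient (X x t w))))"
  proof (rule integral_cong_AE)
    show "AE w in M. norm (Y w) = norm (frame_map V (X x t w) (gradient (X x t w)))"
      using AE_frame_map[of x] by (auto simp: Y_def)
    have "continuous_on UNIV (\<lambda>p. norm (frame_map V p (gradient p)))"
      unfolding frame_map_def
      by (intro continuous_intros continuous_on_vec_lambda gradient_continuous
          continuous_at_imp_continuous_on ballI has_derivative_continuous[OF taylor_derivative[OF tb]])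
    from measurable_compose[OF X_measurable borel_measurable_continuous_onI[OF this]]
    show "(\<lambda>w. norm (frame_map V (X x t w) (gradient (X x t w)))) \<in> borel_measurable M" .
  qed (use Y_int in auto)
  finally show ?thesis by (simp add: transition_operator_def carre_du_champ_eq)
qed

end

end

section \<open>Application to fractional Brownian motion\<close>

theorem theorem5p5:
  fixes H :: real
    and M :: "'w measure"
    and B :: "'n::finite \<Rightarrow> real \<Rightarrow> 'w \<Rightarrow> real"
    and V :: "'n \<Rightarrow> real ^ 'n \<Rightarrow> real ^ 'n"
    and \<omega> :: "'n \<Rightarrow> 'n \<Rightarrow> 'n \<Rightarrow> real ^ 'n \<Rightarrow> real"
    and X :: "real ^ 'n \<Rightarrow> real \<Rightarrow> 'w \<Rightarrow> real ^ 'n"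
    and f :: "real ^ 'n \<Rightarrow> real"
    and t :: real
    and x :: "real ^ 'n"
  assumes "1 / 2 < H" and "H < 1"
    and "fractional_brownian_motion M H B"
    and "\<And>i. smooth_bounded (V i)"
    and "\<And>y. is_basis (\<lambda>i. V i y)"
    and "\<And>i j y. lie_bracket (V i) (V j) y = (\<Sum>k\<in>UNIV. \<omega> i j k y *\<^sub>R V k y)"
    and "\<And>i j k. smooth_bounded (\<omega> i j k)"
    and "\<And>i j k y. \<omega> i j k y = - \<omega> i k j y"
    and "\<And>y s. s \<in> {0..1} \<Longrightarrow> X y s \<in> borel_measurable M"
    and "\<And>y. AE w in M. solves_young_equation V (\<lambda>i s. B i s w) y (\<lambda>s. X y s w)"
    and "smooth_bounded f"
    and "t \<in> {0..1}"
  shows "sqrt (carre_du_champ V (transition_operator M X t f) x)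
           \<le> transition_operator M X t (\<lambda>y. sqrt (carre_du_champ V f y)) x"
proof -
  \<comment> \<open>An exponent strictly between \<open>1 / 2\<close>, as sewing requires, and
    \<open>H\<close>, as the paths allow.\<close>
  define \<beta> where "\<beta> = (H + 1 / 2) / 2"
  have \<beta>: "1 / 2 < \<beta>" "\<beta> \<le> 1" "0 < \<beta>" "\<beta> < H" using assms(1,2) by (auto simp: \<beta>_def)
  define A where "A i = (\<lambda>p. matrix (frechet_derivative (V i) (at p)))" for i
  obtain K where "\<And>i. taylor_bounds K (V i) (\<lambda>p. matrix (frechet_derivative (V i) (at p)))"
    by (rule smooth_bounded_family_taylor_bounds[where V = V, OF assms(4)]) (rule that; assumption)
  then have K: "taylor_bounds K (V i) (A i)" for i by (simp add: A_def)
  have deriv: "frechet_derivative (V i) (at p) = (\<lambda>v. A i p *v v)" for i p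
    using frechet_derivative_at[OF taylor_derivative[OF K]] by simp
  interpret prob_space M using assms(3) by (simp add: fractional_brownian_motion_def)
  interpret fbm_flow M \<beta> K B V A \<omega> X t
  proof
    show "A k p *v V i p - A i p *v V k p = (\<Sum>l\<in>UNIV. \<omega> i k l p *\<^sub>R V l p)" for i k p
      using assms(6)[of i k p] by (simp add: lie_bracket_def deriv)
    show "AE w in M. \<exists>G\<ge>0. \<forall>i. holder_const \<beta> G (\<lambda>t. B i t w)"
      by (rule AE_fractional_brownian_motion_holder[OF assms(3) \<beta>(3,4) assms(2)])
    show "0 \<le> t" "t \<le> 1" using assms(12) by auto
    show "X p t \<in> borel_measurable M" for p using assms(9,12) by simp
  qed (rule \<beta> K assms)+
  show ?thesis by (rule gradient_bound[OF assms(11)])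
qed

end
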